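(* Let $\overline{P}>0$ and let $n \geq 1$ be an integer. Consider the system of equations $$ \left\{ \begin{array}{rcl} 1 - \sum_{i=1}^{p} f_{i} \lambda_{\ell}^{-i} & = & \zeta \left( 1 + \sum_{j=1}^{q} g_{j} \lambda_{\ell}^{-j} \right), \quad \ell = 1, \ldots, n,\\ \zeta^2 \dfrac{\overline{P}}{\sigma_{\widehat{\mathbf{v}}}^2} & = & \prod_{\ell=1}^{n} \lambda_{\ell}^2 - 1, \end{array} \right. $$ in the unknowns $\lambda_1,\ldots,\lambda_n\in\mathbb{C}$, where $\zeta \in \mathbb{R}$, $\zeta \neq 0$, is an auxiliary parameter. Suppose that this system has at least one solution $[\lambda_1,\ldots,\lambda_n]^{\mathrm{T}}$ (for some $\zeta\in\mathbb{R}\setminus\{0\}$) such that $|\lambda_\ell|>1$ for $\ell=1,\ldots,n$, the $\lambda_\ell$ are pairwise distinct, and $\prod_{\ell=1}^n\lambda_\ell\in\mathbb{R}$. Among all such solutions, denote by $[\overline{\lambda}_1,\ldots,\overline{\lambda}_n]^{\mathrm{T}}$ the one that provides the largest $\left|\prod_{\ell=1}^n\lambda_\ell\right|$. Then a lower bound of the feedback capacity $C_{\mathrm{f}}$, under power constraint $\overline{P}$, of the additive Gaussian noise channel with ARMA noise $$ \mathbf{v}_{k} = \sum_{i=1}^{p} f_{i} \mathbf{v}_{k-i} + \widehat{\mathbf{v}}_k + \sum_{j=1}^{q} g_{j} \widehat{\mathbf{v}}_{k-j} $$ is given by $$ \log \left| \prod_{\ell=1}^{n} \overline{\lambda}_{\ell}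 \right| , \qquad \text{i.e., } C_{\mathrm{f}} \geq \log \left| \prod_{\ell=1}^{n} \overline{\lambda}_{\ell} \right| . $$
   Context: All random variables are real-valued and zero-mean; $\log$ is to base $2$. ARMA noise: $f_1,\ldots,f_p,g_1,\ldots,g_q\in\mathbb{R}$; $\{\widehat{\mathbf{v}}_k\}$ is white Gaussian with variance $\sigma_{\widehat{\mathbf{v}}}^2>0$; $\{\mathbf{v}_k\}$ is the stationary output of the LTI filter $F(z)=\dfrac{1+\sum_{j=1}^q g_jz^{-j}}{1-\sum_{i=1}^p f_iz^{-i}}$ driven by $\{\widehat{\mathbf{v}}_k\}$. It is assumed that $F(z)$ is stable and minimum-phase (all its poles and zeros lie strictly inside the unit circle). Feedback capacity: for the channel with (stationary Gaussian) noise $\{\mathbf{z}_k\}$, the output is $\mathbf{y}_k=\mathbf{x}_k(\mathbf{m},\mathbf{y}_{1,\ldots,k-1})+\mathbf{z}_k$, $k=1,2,\ldots$, where $\mathbf{m}$ is the message and $\mathbf{x}_k$ is the channel input, which may depend on the message and the past outputs. The feedback capacity with power constraint $\overline{P}$ is $$C_{\mathrm f}=\lim_{k\to\infty}\sup\frac{I(\mathbf{m};\mathbf{y}_{1,\ldots,k})}{k}=\lim_{k\to\infty}\sup\frac{h(\mathbf{y}_{1,\ldots,k})-h(\mathbf{z}_{1,\ldots,k})}{k},$$ with supremum over all channel inputs $\mathbf{x}_{1,\ldots,k}$ satisfying $\frac1k\sum_{i=1}^k\mathbb{E}[\mathbf{x}_i^2(\mathbf{m},\mathbf{y}_{1,\ldots,i-1})]\le\overline{P}$.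 It is known (Kim, 2010) that this equals $\sup_{\{\mathbf{x}_k\}}[h_\infty(\mathbf{y})-h_\infty(\mathbf{z})]$, where $h_\infty$ is the differential entropy rate and the supremum is over all stationary input processes of the form $\mathbf{x}_k=\sum_{i=1}^\infty b_i\mathbf{z}_{k-i}$, $b_i\in\mathbb{R}$, with $\mathbb{E}[\mathbf{x}_k^2]\le\overline{P}$. In the claim the noise is $\mathbf{z}_k=\mathbf{v}_k$. *)

theory Defs
  imports
    "HOL-Probability.Probability"
    "HOL-Computational_Algebra.Formal_Power_Series"
begin

text \<open>
  The filter is \<open>F(z) = arma_num g q z / arma_den f p z\<close>, where only the coefficients
  \<open>f 1, \<dots>, f p\<close> and \<open>g 1, \<dots>, g q\<close> are used. Poles and zeros are those of the denominator and
  the numerator as given: a common factor outside the open unit disc is not cancelled, hence not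
  allowed. At \<open>z = 0\<close> both functions have the value 1 (because \<open>1 / 0 = 0\<close>), which is harmless in
  the two conditions below, as 0 lies inside the unit disc.
\<close>

definition arma_den :: "(nat \<Rightarrow> real) \<Rightarrow> nat \<Rightarrow> complex \<Rightarrow> complex" where
  "arma_den f p z = 1 - (\<Sum>i=1..p. of_real (f i) * (1 / z) ^ i)"

definition arma_num :: "(nat \<Rightarrow> real) \<Rightarrow> nat \<Rightarrow> complex \<Rightarrow> complex" where
  "arma_num g q z = 1 + (\<Sum>j=1..q. of_real (g j) * (1 / z) ^ j)"

definition arma_stable :: "(nat \<Rightarrow> real) \<Rightarrow> nat \<Rightarrow> bool" where
  "arma_stable f p \<longleftrightarrow> (\<forall>z. arma_den f p z = 0 \<longrightarrow> cmod z < 1)"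

definition arma_minimum_phase :: "(nat \<Rightarrow> real) \<Rightarrow> nat \<Rightarrow> bool" where
  "arma_minimum_phase g q \<longleftrightarrow> (\<forall>z. arma_num g q z = 0 \<longrightarrow> cmod z < 1)"

text \<open>The impulse response of \<open>F\<close>: its power series coefficients in \<open>1 / z\<close>.\<close>

definition arma_impulse ::
    "(nat \<Rightarrow> real) \<Rightarrow> nat \<Rightarrow> (nat \<Rightarrow> real) \<Rightarrow> nat \<Rightarrow> nat \<Rightarrow> real" where
  "arma_impulse f p g q =
     fps_nth ((1 + (\<Sum>j=1..q. fps_const (g j) * fps_X ^ j)) /
              (1 - (\<Sum>i=1..p. fps_const (f i) * fps_X ^ i)))"

definition white_gaussian :: "'a measure \<Rightarrow> real \<Rightarrow> (int \<Rightarrow> 'a \<Rightarrow> real) \<Rightarrow> bool" where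
  "white_gaussian M \<sigma> w \<longleftrightarrow>
     prob_space.indep_vars M (\<lambda>_. borel) w UNIV \<and>
     (\<forall>k. distributed M lborel (w k) (normal_density 0 \<sigma>))"

text \<open>
  The stationary output of the filter driven by \<open>w\<close>: time is two-sided and the input is convolved
  with the impulse response, so there is no initial transient.
\<close>

definition filter_output ::
    "'a measure \<Rightarrow> (nat \<Rightarrow> real) \<Rightarrow> (int \<Rightarrow> 'a \<Rightarrow> real) \<Rightarrow> (int \<Rightarrow> 'a \<Rightarrow> real) \<Rightarrow> bool" where
  "filter_output M h w v \<longleftrightarrow>
     (\<forall>k. v k \<in> borel_measurable M \<and>
          (AE \<omega> in M. (\<lambda>j. h j * w (k - int j) \<omega>) sums v k \<omega>))"

definition arma_recursion ::
    "'a measure \<Rightarrow> (nat \<Rightarrow> real) \<Rightarrow> nat \<Rightarrow> (nat \<Rightarrow> real) \<Rightarrow> nat \<Rightarrow>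
     (int \<Rightarrow> 'a \<Rightarrow> real) \<Rightarrow> (int \<Rightarrow> 'a \<Rightarrow> real) \<Rightarrow> bool" where
  "arma_recursion M f p g q w v \<longleftrightarrow>
     (\<forall>k. AE \<omega> in M. v k \<omega> =
        (\<Sum>i=1..p. f i * v (k - int i) \<omega>) + w k \<omega> + (\<Sum>j=1..q. g j * w (k - int j) \<omega>))"

text \<open>
  Feedback coding. An encoder \<open>x\<close> gives at time \<open>k\<close> the channel input \<open>x k (m, y)\<close>, where \<open>m\<close> is
  the message and \<open>y\<close> holds the past outputs, indexed by \<open>{1..<k}\<close> (it is \<open>undefined\<close> elsewhere).
\<close>

type_synonym encoder = "nat \<Rightarrow> real \<times> (nat \<Rightarrow> real) \<Rightarrow> real"

function channel_output :: "encoder \<Rightarrow> real \<Rightarrow> (nat \<Rightarrow> real) \<Rightarrow> nat \<Rightarrow> real" where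
  "channel_output x m z k =
     x k (m, \<lambda>i. if i \<in> {1..<k} then channel_output x m z i else undefined) + z k"
  by pat_completeness auto
termination
  by (relation "Wellfounded.measure (\<lambda>(x, m, z, k). k)") auto

declare channel_output.simps [simp del]

definition channel_input :: "encoder \<Rightarrow> real \<Rightarrow> (nat \<Rightarrow> real) \<Rightarrow> nat \<Rightarrow> real" where
  "channel_input x m z k = x k (m, restrict (channel_output x m z) {1..<k})"

lemma channel_output_eq: "channel_output x m z k = channel_input x m z k + z k"
  by (simp add: channel_input_def restrict_def channel_output.simps [of x m z k])

text \<open>
  The message has law \<open>\<mu>\<close> and is independent of the noise \<open>z\<close>: the two live on the product
  space \<open>\<mu> \<Otimes>\<^sub>M M\<close>.
\<close>

definition input_rv :: "encoder \<Rightarrow> (nat \<Rightarrow> 'a \<Rightarrow> real) \<Rightarrow> nat \<Rightarrow> real \<times> 'a \<Rightarrow> real" where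
  "input_rv x z k = (\<lambda>(m, \<omega>). channel_input x m (\<lambda>i. z i \<omega>) k)"

definition output_rv :: "encoder \<Rightarrow> (nat \<Rightarrow> 'a \<Rightarrow> real) \<Rightarrow> nat \<Rightarrow> real \<times> 'a \<Rightarrow> real" where
  "output_rv x z k = (\<lambda>(m, \<omega>). channel_output x m (\<lambda>i. z i \<omega>) k)"

definition admissible_code ::
    "'a measure \<Rightarrow> (nat \<Rightarrow> 'a \<Rightarrow> real) \<Rightarrow> real \<Rightarrow> nat \<Rightarrow> real measure \<Rightarrow> encoder \<Rightarrow> bool" where
  "admissible_code M z P k \<mu> x \<longleftrightarrow>
     prob_space \<mu> \<and> sets \<mu> = sets borel \<and>
     integrable \<mu> (\<lambda>m. m) \<and> (\<integral>m. m \<partial>\<mu>) = 0 \<and>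
     (\<forall>i\<in>{1..k}. x i \<in> borel_measurable (borel \<Otimes>\<^sub>M Pi\<^sub>M {1..<i} (\<lambda>_. borel))) \<and>
     (\<forall>i\<in>{1..k}. integrable (\<mu> \<Otimes>\<^sub>M M) (\<lambda>s. (input_rv x z i s)\<^sup>2) \<and>
                 (\<integral>s. input_rv x z i s \<partial>(\<mu> \<Otimes>\<^sub>M M)) = 0) \<and>
     (\<Sum>i=1..k. \<integral>s. (input_rv x z i s)\<^sup>2 \<partial>(\<mu> \<Otimes>\<^sub>M M)) / real k \<le> P"

definition code_information ::
    "'a measure \<Rightarrow> (nat \<Rightarrow> 'a \<Rightarrow> real) \<Rightarrow> nat \<Rightarrow> real measure \<Rightarrow> encoder \<Rightarrow> real" where
  "code_information M z k \<mu> x =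
     prob_space.mutual_information (\<mu> \<Otimes>\<^sub>M M) 2 borel (Pi\<^sub>M {1..k} (\<lambda>_. borel))
       fst (\<lambda>s. \<lambda>i\<in>{1..k}. output_rv x z i s)"

definition block_capacity :: "'a measure \<Rightarrow> (nat \<Rightarrow> 'a \<Rightarrow> real) \<Rightarrow> real \<Rightarrow> nat \<Rightarrow> ereal" where
  "block_capacity M z P k =
     (SUP (\<mu>, x) \<in> {(\<mu>, x). admissible_code M z P k \<mu> x}.
        ereal (code_information M z k \<mu> x / real k))"

text \<open>
  The limit of the block capacities, taken as a lower limit so that the definition does not
  presuppose convergence; where the limit exists the two agree. Only the noise at the times
  \<open>1, 2, \<dots>\<close> matters.
\<close>

definition feedback_capacity :: "'a measure \<Rightarrow> (nat \<Rightarrow> 'a \<Rightarrow> real) \<Rightarrow> real \<Rightarrow> ereal" where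
  "feedback_capacity M z P = liminf (block_capacity M z P)"

text \<open>
  The solutions \<open>l 1, \<dots>, l n\<close> of the system of equations that are admitted in the maximization;
  the auxiliary parameter \<open>\<zeta>\<close> may differ from solution to solution.
\<close>

definition arma_solution ::
    "(nat \<Rightarrow> real) \<Rightarrow> nat \<Rightarrow> (nat \<Rightarrow> real) \<Rightarrow> nat \<Rightarrow> real \<Rightarrow> real \<Rightarrow> nat \<Rightarrow> (nat \<Rightarrow> complex) \<Rightarrow> bool" where
  "arma_solution f p g q \<sigma> P n l \<longleftrightarrow>
     (\<exists>\<zeta>::real. \<zeta> \<noteq> 0 \<and>
        (\<forall>k\<in>{1..n}. arma_den f p (l k) = of_real \<zeta> * arma_num g q (l k)) \<and>
        of_real (\<zeta>\<^sup>2 * (P / \<sigma>\<^sup>2)) = (\<Prod>k=1..n. (l k)\<^sup>2) - 1) \<and>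
     (\<forall>k\<in>{1..n}. cmod (l k) > 1) \<and>
     inj_on l {1..n} \<and>
     (\<Prod>k=1..n. l k) \<in> \<real>"

end

theory Submission
  imports Defs "HOL-Computational_Algebra.Fundamental_Theorem_Algebra"
begin

text \<open>
  Write \<open>N\<close>, \<open>D\<close> for numerator and denominator as polynomials in \<open>w = 1 / z\<close> and \<open>F = N / D\<close>. If \<open>G\<close> is a
  strictly causal filter such that \<open>H = F + G\<close> vanishes at points \<open>w\<close> of the open unit disc, then the
  input \<open>x = V + G u\<close>, with \<open>u\<close> the innovations of the noise and \<open>V\<close> a finite signal carrying the
  message, produces the output \<open>y = V + H u\<close>. Evaluating the output polynomial at \<open>w\<close> cancels the
  noise up to an error of order \<open>k |w|\<^sup>k\<close> after \<open>k\<close> steps, so about \<open>|w|\<^sup>-\<^sup>k / k\<close> message points can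
  be resolved at each such \<open>w\<close>, which gives the rate \<open>\<Sum> log (1 / |w|)\<close>. On the solutions of the
  system \<open>F\<close> takes the constant value \<open>1 / \<zeta>\<close>, so one may take \<open>G = - (1 - Q) / \<zeta>\<close> with \<open>Q\<close> a Blaschke
  product normalized at 0, which costs the power \<open>\<sigma>\<^sup>2 (\<Prod> |w|\<^sup>-\<^sup>2 - 1) / \<zeta>\<^sup>2\<close>.

  The filter has to be real, which needs a root set closed under conjugation. A solution of the system
  need not have this property; in that case \<open>\<zeta>\<close> is moved away from 0 until the set of all roots of
  \<open>D - \<zeta> N\<close> in the disc meets the power constraint, using that the Mahler measure of
  \<open>D - \<zeta> N\<close> is continuous in \<open>\<zeta>\<close>.
\<close>

section \<open>Information carried by a uniform message\<close>

text \<open>Capacity is a limit of mutual informations over arbitrary encoders, so the lower bound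
  needs an explicit code at every block length. Its information is estimated by comparing the joint
  law with a discrete Gaussian posterior centred at a linear estimate of the message; this takes the
  place of a decoding error probability and Fano's inequality.

  Two obstacles shape the coding part. The encoder sees nothing before time 1, while the stationary
  noise has an infinite past, so whitening leaves a residual; its total energy is bounded and
  vanishes after division by the block length. And a solution of the system spends the power
  exactly, while the message signal costs energy too; hence codes are built only for rates strictly
  below the bound, which is then reached as a limit.

  The obstacle in the choice of \<open>\<zeta>\<close> is that roots may collide, cross the unit
  circle or escape to infinity. The Mahler measure of \<open>D - \<zeta> N\<close> passes through
  all these events continuously, so no individual root has to be followed. Simplicity of the roots
  is needed only at the final \<open>\<zeta>\<close>, where multiple roots are avoided because they
  occur for finitely many parameters.\<close>

definition uniform_message :: "real set \<Rightarrow> real measure" where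
  "uniform_message A = distr (measure_pmf (pmf_of_set A)) borel (\<lambda>m. m)"

lemma sets_uniform_message [measurable_cong, simp]: "sets (uniform_message A) = sets borel"
  and space_uniform_message [simp]: "space (uniform_message A) = UNIV"
  by (simp_all add: uniform_message_def)

lemma prob_space_uniform_message: "prob_space (uniform_message A)"
  unfolding uniform_message_def by (rule prob_space.prob_space_distr) (auto intro: prob_space_measure_pmf)

lemma nn_integral_uniform_message:
  assumes "finite A" "A \<noteq> {}" and h: "h \<in> borel_measurable borel"
  shows "(\<integral>\<^sup>+m. h m \<partial>uniform_message A) = (\<Sum>a\<in>A. h a) / card A"
  unfolding uniform_message_def using assms
  by (subst nn_integral_distr) (auto simp: nn_integral_pmf_of_set)

lemma nn_integral_uniform_message_pair:
  assumes "finite A" "A \<noteq> {}" "prob_space M"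
    and g [measurable]: "g \<in> borel_measurable (uniform_message A \<Otimes>\<^sub>M M)"
  shows "(\<integral>\<^sup>+s. g s \<partial>(uniform_message A \<Otimes>\<^sub>M M)) = (\<Sum>a\<in>A. \<integral>\<^sup>+\<omega>. g (a, \<omega>) \<partial>M) / card A"
proof -
  interpret prob_space M by fact
  have "(\<integral>\<^sup>+s. g s \<partial>(uniform_message A \<Otimes>\<^sub>M M)) = (\<integral>\<^sup>+a. \<integral>\<^sup>+\<omega>. g (a, \<omega>) \<partial>M \<partial>uniform_message A)"
    by (rule nn_integral_fst[symmetric]) fact
  also have "\<dots> = (\<Sum>a\<in>A. \<integral>\<^sup>+\<omega>. g (a, \<omega>) \<partial>M) / card A"
    using assms(1,2)
  proof (rule nn_integral_uniform_message)
    have "(\<lambda>a. \<integral>\<^sup>+\<omega>. g (a, \<omega>) \<partial>M) \<in> borel_measurable (uniform_message A)"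
      by measurable
    then show "(\<lambda>a. \<integral>\<^sup>+\<omega>. g (a, \<omega>) \<partial>M) \<in> borel_measurable borel"
      by (simp cong: measurable_cong_sets)
  qed
  finally show ?thesis .
qed

lemma uniform_message_pair:
  fixes g :: "real \<times> 'a \<Rightarrow> real"
  assumes A: "finite A" "A \<noteq> {}" and M: "prob_space M"
    and g [measurable]: "g \<in> borel_measurable (uniform_message A \<Otimes>\<^sub>M M)"
    and int: "\<And>a. a \<in> A \<Longrightarrow> integrable M (\<lambda>\<omega>. g (a, \<omega>))"
  shows "integrable (uniform_message A \<Otimes>\<^sub>M M) g"
    and "(\<integral>s. g s \<partial>(uniform_message A \<Otimes>\<^sub>M M)) = (\<Sum>a\<in>A. \<integral>\<omega>. g (a, \<omega>) \<partial>M) / card A"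
proof -
  interpret M: prob_space M by fact
  interpret U: prob_space "uniform_message A" by (rule prob_space_uniform_message)
  interpret P: pair_sigma_finite "uniform_message A" M ..
  have c: "card A > 0" using A by (simp add: card_gt_0_iff)
  have "(\<integral>\<^sup>+s. norm (g s) \<partial>(uniform_message A \<Otimes>\<^sub>M M)) = (\<Sum>a\<in>A. \<integral>\<^sup>+\<omega>. norm (g (a, \<omega>)) \<partial>M) / card A"
    using A M by (rule nn_integral_uniform_message_pair) simp
  also have "(\<Sum>a\<in>A. \<integral>\<^sup>+\<omega>. norm (g (a, \<omega>)) \<partial>M) = ennreal (\<Sum>a\<in>A. \<integral>\<omega>. norm (g (a, \<omega>)) \<partial>M)"
  proof -
    have "(\<integral>\<^sup>+\<omega>. norm (g (a, \<omega>)) \<partial>M) = ennreal (\<integral>\<omega>. norm (g (a, \<omega>)) \<partial>M)" if "a \<in> A" for a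
      using nn_integral_eq_integral[OF integrable_norm[OF int[OF that]]] by simp
    then show ?thesis by simp
  qed
  also have "ennreal (\<Sum>a\<in>A. \<integral>\<omega>. norm (g (a, \<omega>)) \<partial>M) / card A < \<infinity>"
    using c by (simp add: ennreal_of_nat_eq_real_of_nat divide_ennreal sum_nonneg)
  finally show I: "integrable (uniform_message A \<Otimes>\<^sub>M M) g"
    by (simp add: integrable_iff_bounded)
  have "(\<integral>s. g s \<partial>(uniform_message A \<Otimes>\<^sub>M M)) = (\<integral>a. \<integral>\<omega>. g (a, \<omega>) \<partial>M \<partial>uniform_message A)"
    using I by (rule P.integral_fst'[symmetric])
  also have "\<dots> = (\<integral>a. \<integral>\<omega>. g (a, \<omega>) \<partial>M \<partial>measure_pmf (pmf_of_set A))"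
    unfolding uniform_message_def
  proof (rule integral_distr)
    have "(\<lambda>a. \<integral>\<omega>. g (a, \<omega>) \<partial>M) \<in> borel_measurable (uniform_message A)"
      by measurable
    then show "(\<lambda>a. \<integral>\<omega>. g (a, \<omega>) \<partial>M) \<in> borel_measurable borel"
      by (simp cong: measurable_cong_sets)
  qed simp
  also have "\<dots> = (\<Sum>a\<in>A. \<integral>\<omega>. g (a, \<omega>) \<partial>M) / card A"
    by (rule integral_pmf_of_set[OF A(2) A(1)])
  finally show "(\<integral>s. g s \<partial>(uniform_message A \<Otimes>\<^sub>M M)) = (\<Sum>a\<in>A. \<integral>\<omega>. g (a, \<omega>) \<partial>M) / card A" .
qed

lemma uniform_message_integral:
  assumes A: "finite A" "A \<noteq> {}"
  shows "integrable (uniform_message A) (\<lambda>m. m)" "(\<integral>m. m \<partial>uniform_message A) = (\<Sum>a\<in>A. a) / card A"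
  unfolding uniform_message_def using A
  by (simp_all add: integrable_distr_eq integral_distr integral_pmf_of_set integrable_measure_pmf_finite)

text \<open>On the set where \<open>f\<close> exceeds \<open>c\<close> the nonnegative function
  \<open>f - c\<close> has integral at most 0. This turns a comparison of measures into a bound of a
  Radon-Nikodym derivative.\<close>

lemma AE_le_of_set_integral_le:
  fixes f :: "'b \<Rightarrow> real"
  assumes "finite_measure Q" and f: "integrable Q f" 
    and le: "\<And>E. E \<in> sets Q \<Longrightarrow> (\<integral>x. indicator E x * f x \<partial>Q) \<le> c * measure Q E"
  shows "AE x in Q. f x \<le> c"
proof -
  interpret finite_measure Q by fact
  have [measurable]: "f \<in> borel_measurable Q" using f by auto
  define E where "E = {x \<in> space Q. f x > c}"
  have E [measurable]: "E \<in> sets Q" unfolding E_def by measurable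
  have i1: "integrable Q (\<lambda>x. indicator E x * f x)"
    using integrable_mult_indicator[OF E f] by simp
  have i2: "integrable Q (\<lambda>x. indicator E x * c)"
    using integrable_mult_indicator[OF E, of "\<lambda>_. c"] by simp
  have i: "integrable Q (\<lambda>x. indicator E x * (f x - c))"
    using Bochner_Integration.integrable_diff[OF i1 i2] by (simp add: algebra_simps)
  have "(\<integral>x. indicator E x * (f x - c) \<partial>Q) = (\<integral>x. indicator E x * f x \<partial>Q) - c * measure Q E"
    using Bochner_Integration.integral_diff[OF i1 i2] E by (simp add: algebra_simps)
  with le[OF E] have "(\<integral>x. indicator E x * (f x - c) \<partial>Q) \<le> 0" by simp
  moreover have "(\<integral>x. indicator E x * (f x - c) \<partial>Q) \<ge> 0"
    by (rule integral_nonneg_AE) (auto simp: E_def indicator_def)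
  ultimately have "(\<integral>x. indicator E x * (f x - c) \<partial>Q) = 0" by simp
  then have "AE x in Q. indicator E x * (f x - c) = 0"
    by (subst (asm) integral_nonneg_eq_0_iff_AE[OF i]) (auto simp: E_def indicator_def)
  then show ?thesis
  proof (rule AE_mp, intro AE_I2 impI)
    fix x assume "x \<in> space Q" "indicator E x * (f x - c) = 0"
    then show "f x \<le> c" by (auto simp: E_def indicator_def split: if_splits)
  qed
qed

text \<open>This is \<open>ln x \<le> x - 1\<close> at \<open>x = q / f\<close>, cleared of the
  fraction. Integrated against densities \<open>f\<close> and \<open>q\<close> it becomes Gibbs'
  inequality.\<close>

lemma mult_log_ge:
  fixes f q :: real
  assumes "f \<ge> 0" "q > 0"
  shows "f * log 2 f \<ge> f * log 2 q + (f - q) / ln 2"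
proof (cases "f = 0")
  case False
  with assms have f: "f > 0" by simp
  have "ln (q / f) \<le> q / f - 1" using f assms by (intro ln_le_minus_one) simp
  then have "f * ln (q / f) \<le> q - f" using f by (simp add: field_simps)
  then have "f * ln q - f * ln f \<le> q - f" using f assms by (simp add: ln_div algebra_simps)
  then have "f * ln f \<ge> f * ln q + (f - q)" by simp
  then show ?thesis using divide_right_mono[of "f * ln q + (f-q)" "f * ln f" "ln 2"]
    by (simp add: log_def add_divide_distrib)
qed (use assms in \<open>simp add: divide_nonpos_pos\<close>)

text \<open>The joint law has density at most \<open>card A\<close> with respect to the product of its marginals, so
  all integrals below exist; the weights \<open>2 powr - d a y / C\<close> play the part of the posterior.\<close>

lemma mutual_information_uniform_message_ge:
  fixes Y :: "real \<times> 'a \<Rightarrow> 'b" and d :: "real \<Rightarrow> 'b \<Rightarrow> real"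
  assumes A: "finite A" "A \<noteq> {}" and M: "prob_space M"
    and Y [measurable]: "Y \<in> measurable (uniform_message A \<Otimes>\<^sub>M M) T"
    and d: "\<And>a. a \<in> A \<Longrightarrow> d a \<in> borel_measurable T"
    and C: "\<And>y. y \<in> space T \<Longrightarrow> (\<Sum>a\<in>A. 2 powr (- d a y)) \<le> C" "C > 0"
    and int: "\<And>a. a \<in> A \<Longrightarrow> integrable M (\<lambda>\<omega>. d a (Y (a, \<omega>)))"
  shows "prob_space.mutual_information (uniform_message A \<Otimes>\<^sub>M M) 2 borel T fst Y
           \<ge> log 2 (card A) - log 2 C - (\<Sum>a\<in>A. \<integral>\<omega>. d a (Y (a, \<omega>)) \<partial>M) / card A"
proof -
  interpret M: prob_space M by fact
  let ?U = "uniform_message A"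
  interpret U: prob_space ?U by (rule prob_space_uniform_message)
  interpret P: pair_prob_space ?U M ..
  interpret P: information_space "?U \<Otimes>\<^sub>M M" 2 by standard simp
  define N where "N = distr (?U \<Otimes>\<^sub>M M) T Y"
  interpret N: prob_space N unfolding N_def by (rule P.prob_space_distr) simp
  have [measurable_cong]: "sets N = sets T" by (simp add: N_def)
  have spN: "space N = space T" by (simp add: N_def)
  define Q where "Q = ?U \<Otimes>\<^sub>M N"
  interpret Q: pair_prob_space ?U N ..
  interpret Q: prob_space Q unfolding Q_def by unfold_locales
  define J where "J = distr (?U \<Otimes>\<^sub>M M) (borel \<Otimes>\<^sub>M T) (\<lambda>s. (fst s, Y s))"
  have [measurable_cong]: "sets Q = sets (borel \<Otimes>\<^sub>M T)" "sets J = sets (borel \<Otimes>\<^sub>M T)"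
    by (simp_all add: Q_def J_def sets_pair_measure_cong[OF sets_uniform_message \<open>sets N = sets T\<close>])
  interpret J: prob_space J unfolding J_def by (rule P.prob_space_distr) simp
  have Q_eq: "Q = distr (?U \<Otimes>\<^sub>M M) borel fst \<Otimes>\<^sub>M distr (?U \<Otimes>\<^sub>M M) T Y"
  proof -
    have "distr (?U \<Otimes>\<^sub>M M) borel fst = ?U"
      using M.distr_pair_fst[of ?U] by (simp cong: distr_cong)
    then show ?thesis by (simp add: Q_def N_def)
  qed
  have MI: "P.mutual_information 2 borel T fst Y = KL_divergence 2 Q J"
    unfolding P.mutual_information_def Q_eq J_def ..
  let ?c = "real (card A)"
  have c: "?c \<ge> 1" using A by (simp add: Suc_leI card_gt_0_iff)
  then have c0: "?c > 0" by linarith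
  have sect [measurable]: "(\<lambda>\<omega>. Y (a, \<omega>)) \<in> measurable M T" for a
    by measurable
  \<comment> \<open>The output law \<open>N\<close> is the average of the conditional laws given the
    messages, so each conditional law is at most \<open>card A\<close> times \<open>N\<close>;
    averaging over the messages gives the same bound for the joint law.\<close>
  have J_le: "emeasure J E \<le> ennreal ?c * emeasure Q E" if E [measurable]: "E \<in> sets Q" for E
  proof -
    have E' [measurable]: "E \<in> sets (borel \<Otimes>\<^sub>M T)" using E by (simp add: \<open>sets Q = _\<close>)
    have N_ge: "emeasure M {\<omega>\<in>space M. (a, Y (a, \<omega>)) \<in> E} \<le> ennreal ?c * emeasure N {y\<in>space T. (a, y) \<in> E}" if "a \<in> A" for a
    proof -
      let ?B = "{y\<in>space T. (a, y) \<in> E}"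
      have B [measurable]: "?B \<in> sets T" by measurable
      have "emeasure N ?B = (\<integral>\<^sup>+s. indicator ?B (Y s) \<partial>(?U \<Otimes>\<^sub>M M))"
        unfolding N_def by (subst nn_integral_indicator[symmetric], simp, subst nn_integral_distr) auto
      also have "\<dots> = (\<Sum>b\<in>A. \<integral>\<^sup>+\<omega>. indicator ?B (Y (b, \<omega>)) \<partial>M) / ?c"
        using A M by (subst nn_integral_uniform_message_pair) (auto simp: ennreal_of_nat_eq_real_of_nat)
      finally have "ennreal ?c * emeasure N ?B = (\<Sum>b\<in>A. \<integral>\<^sup>+\<omega>. indicator ?B (Y (b, \<omega>)) \<partial>M)"
        using c0 by (simp add: ennreal_times_divide mult.commute[of "ennreal _"] mult_divide_eq_ennreal)
      moreover have "(\<integral>\<^sup>+\<omega>. indicator ?B (Y (a, \<omega>)) \<partial>M) \<le> (\<Sum>b\<in>A. \<integral>\<^sup>+\<omega>. indicator ?B (Y (b, \<omega>)) \<partial>M)"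
        using A that by (intro member_le_sum) auto
      moreover have "(\<integral>\<^sup>+\<omega>. indicator ?B (Y (a, \<omega>)) \<partial>M) = emeasure M {\<omega>\<in>space M. (a, Y (a, \<omega>)) \<in> E}"
      proof -
        have "(\<integral>\<^sup>+\<omega>. indicator ?B (Y (a, \<omega>)) \<partial>M) = (\<integral>\<^sup>+\<omega>. indicator {\<omega>\<in>space M. (a, Y (a, \<omega>)) \<in> E} \<omega> \<partial>M)"
          using measurable_space[OF sect[of a]] by (intro nn_integral_cong) (auto simp: indicator_def)
        then show ?thesis by simp
      qed
      ultimately show ?thesis by simp
    qed
    have "emeasure J E = (\<integral>\<^sup>+s. indicator E (fst s, Y s) \<partial>(?U \<Otimes>\<^sub>M M))"
      unfolding J_def by (subst nn_integral_indicator[symmetric], simp, subst nn_integral_distr) auto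
    also have "\<dots> = (\<Sum>a\<in>A. \<integral>\<^sup>+\<omega>. indicator E (a, Y (a, \<omega>)) \<partial>M) / ?c"
      using A M by (subst nn_integral_uniform_message_pair) (auto simp: ennreal_of_nat_eq_real_of_nat)
    also have "\<dots> = (\<Sum>a\<in>A. emeasure M {\<omega>\<in>space M. (a, Y (a, \<omega>)) \<in> E}) / ?c"
    proof -
      have "(\<integral>\<^sup>+\<omega>. indicator E (a, Y (a, \<omega>)) \<partial>M) = (\<integral>\<^sup>+\<omega>. indicator {\<omega>\<in>space M. (a, Y (a, \<omega>)) \<in> E} \<omega> \<partial>M)" for a
        by (intro nn_integral_cong) (auto simp: indicator_def)
      then show ?thesis by simp
    qed
    also have "\<dots> \<le> (\<Sum>a\<in>A. ennreal ?c * emeasure N {y\<in>space T. (a, y) \<in> E}) / ?c"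
      by (intro divide_right_mono_ennreal sum_mono N_ge)
    also have "\<dots> = ennreal ?c * ((\<Sum>a\<in>A. emeasure N {y\<in>space T. (a, y) \<in> E}) / ?c)"
      by (simp add: sum_distrib_left[symmetric] ennreal_times_divide)
    also have "(\<Sum>a\<in>A. emeasure N {y\<in>space T. (a, y) \<in> E}) / ?c = (\<Sum>a\<in>A. \<integral>\<^sup>+y. indicator E (a, y) \<partial>N) / ?c"
    proof -
      have "(\<integral>\<^sup>+y. indicator E (a, y) \<partial>N) = (\<integral>\<^sup>+y. indicator {y\<in>space T. (a, y) \<in> E} y \<partial>N)" for a
        by (intro nn_integral_cong) (auto simp: indicator_def spN)
      then show ?thesis by simp
    qed
    also have "\<dots> = (\<integral>\<^sup>+s. indicator E s \<partial>Q)"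
      unfolding Q_def using A N.prob_space_axioms
      by (subst nn_integral_uniform_message_pair) (auto simp: ennreal_of_nat_eq_real_of_nat)
    also have "\<dots> = emeasure Q E" by simp
    finally show ?thesis .
  qed
  have ac: "absolutely_continuous Q J"
  proof (unfold absolutely_continuous_def, rule subsetI)
    fix E assume E: "E \<in> null_sets Q"
    then have "emeasure J E \<le> ennreal ?c * 0" using J_le[of E] by (auto simp: null_sets_def)
    then show "E \<in> null_sets J" using E by (auto simp: null_sets_def \<open>sets J = _\<close> \<open>sets Q = _\<close>)
  qed
  have sets_JQ: "sets J = sets Q" by (simp add: \<open>sets J = _\<close> \<open>sets Q = _\<close>)
  define f where "f x = enn2real (RN_deriv Q J x)" for x
  have f [measurable]: "f \<in> borel_measurable Q" unfolding f_def by measurable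
  have f0: "f x \<ge> 0" for x by (simp add: f_def)
  have J_dens: "density Q f = J"
  proof -
    have "AE x in Q. RN_deriv Q J x \<noteq> \<infinity>"
      using Q.RN_deriv_finite[OF J.sigma_finite_measure_axioms ac sets_JQ] .
    then have "AE x in Q. ennreal (f x) = RN_deriv Q J x"
      by (rule AE_mp) (auto simp: f_def top.not_eq_extremum)
    then have "density Q f = density Q (RN_deriv Q J)"
      by (intro density_cong) auto
    also have "\<dots> = J" using Q.density_RN_deriv[OF ac sets_JQ] .
    finally show ?thesis .
  qed
  have nnf: "(\<integral>\<^sup>+x. ennreal (f x) \<partial>Q) = 1"
  proof -
    have "emeasure J (space Q) = (\<integral>\<^sup>+x. ennreal (f x) \<partial>Q)"
      unfolding J_dens[symmetric] by (subst emeasure_density) (auto intro!: nn_integral_cong)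
    moreover have "space Q = space J" using sets_eq_imp_space_eq[OF sets_JQ] ..
    ultimately show ?thesis using J.emeasure_space_1 by simp
  qed
  have f_int: "integrable Q f"
    by (rule integrableI_nn_integral_finite[where x=1]) (auto simp: nnf f0)
  have f_1: "(\<integral>x. f x \<partial>Q) = 1"
    using nn_integral_eq_integral[OF f_int] f0 nnf by (auto simp: ennreal_eq_1)
  have f_le: "AE x in Q. f x \<le> ?c"
  proof (rule AE_le_of_set_integral_le[OF Q.finite_measure_axioms f_int])
    fix E assume E [measurable]: "E \<in> sets Q"
    have ii: "integrable Q (\<lambda>x. indicator E x * f x)"
      using integrable_mult_indicator[OF E f_int] by simp
    have "ennreal (\<integral>x. indicator E x * f x \<partial>Q) = (\<integral>\<^sup>+x. ennreal (indicator E x * f x) \<partial>Q)"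
      using nn_integral_eq_integral[OF ii] f0 by simp
    also have "\<dots> = (\<integral>\<^sup>+x. ennreal (f x) * indicator E x \<partial>Q)"
      by (intro nn_integral_cong) (auto simp: indicator_def)
    also have "\<dots> = emeasure J E"
      unfolding J_dens[symmetric] by (subst emeasure_density) auto
    also have "\<dots> \<le> ennreal (?c * measure Q E)"
      using J_le[OF E] by (simp add: Q.emeasure_eq_measure ennreal_mult)
    finally show "(\<integral>x. indicator E x * f x \<partial>Q) \<le> ?c * measure Q E"
      by (simp add: ennreal_le_iff)
  qed
  have KL: "KL_divergence 2 Q J = (\<integral>x. f x * log 2 (f x) \<partial>Q)"
    unfolding J_dens[symmetric] by (rule Q.KL_density) (auto simp: f0)
  \<comment> \<open>The density with respect to \<open>Q\<close> that the weights propose for the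
    joint law; its mass is at most 1 by the choice of \<open>C\<close>. The value 1 keeps
    \<open>q\<close> positive off \<open>A\<close>, a null set.\<close>
  define q where "q x = (if fst x \<in> A then ?c * (2 powr (- d (fst x) (snd x)) / C) else 1)" for x
  \<comment> \<open>\<open>d\<close> is measurable in the output for one message at a time; the
    finite sum over indicators is jointly measurable and agrees with \<open>d\<close> on
    \<open>A\<close>.\<close>
  define D where "D x = (\<Sum>a\<in>A. indicator {a} (fst x) * d a (snd x))" for x :: "real \<times> 'b"
  have dm [measurable]: "a \<in> A \<Longrightarrow> d a \<in> borel_measurable T" for a by (rule d)
  have D_eq: "D (a, y) = d a y" if "a \<in> A" for a y
  proof -
    have "D (a, y) = (\<Sum>b\<in>A. if b = a then d a y else 0)"
      unfolding D_def by (intro sum.cong) (auto simp: indicator_def)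
    also have "\<dots> = d a y" using A that by simp
    finally show ?thesis .
  qed
  have [measurable]: "D \<in> borel_measurable (borel \<Otimes>\<^sub>M T)"
    unfolding D_def by measurable
  have fin_sets: "A \<in> sets borel" using A by (simp add: borel_closed finite_imp_closed)
  have q_eq: "q x = (if fst x \<in> A then ?c * (2 powr (- D x) / C) else 1)" for x
    unfolding q_def by (cases x) (auto simp: D_eq)
  have q0: "q x > 0" for x using c0 C by (auto simp: q_def)
  have q [measurable]: "q \<in> borel_measurable Q"
    unfolding q_eq[abs_def] using fin_sets by measurable
  have AQ: "AE x in Q. fst x \<in> A"
  proof -
    have "(\<integral>\<^sup>+x. indicator (- A) (fst x) \<partial>Q) = (\<Sum>a\<in>A. \<integral>\<^sup>+y. indicator (- A) a \<partial>N) / ?c"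
      unfolding Q_def using A N.prob_space_axioms fin_sets
      by (subst nn_integral_uniform_message_pair) (auto simp: ennreal_of_nat_eq_real_of_nat)
    also have "\<dots> = 0" by (simp add: indicator_def)
    finally show ?thesis using fin_sets
      by (subst (asm) nn_integral_0_iff_AE) (auto simp: indicator_def)
  qed
  have nnq: "(\<integral>\<^sup>+x. ennreal (q x) \<partial>Q) \<le> 1"
  proof -
    have "(\<integral>\<^sup>+x. ennreal (q x) \<partial>Q) = (\<Sum>a\<in>A. \<integral>\<^sup>+y. ennreal (q (a, y)) \<partial>N) / ?c"
      unfolding Q_def using A N.prob_space_axioms q
      by (subst nn_integral_uniform_message_pair) (auto simp: ennreal_of_nat_eq_real_of_nat Q_def)
    moreover have "(\<Sum>a\<in>A. \<integral>\<^sup>+y. ennreal (q (a, y)) \<partial>N) \<le> ennreal ?c"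
    proof -
    have "(\<Sum>a\<in>A. \<integral>\<^sup>+y. ennreal (q (a, y)) \<partial>N) = (\<integral>\<^sup>+y. (\<Sum>a\<in>A. ennreal (q (a, y))) \<partial>N)"
      by (rule nn_integral_sum[symmetric]) (simp add: q_def)
    also have "\<dots> \<le> (\<integral>\<^sup>+y. ennreal ?c \<partial>N)"
    proof (rule nn_integral_mono)
      fix y assume "y \<in> space N"
      then have y: "(\<Sum>a\<in>A. 2 powr (- d a y)) \<le> C" using C spN by simp
      have "(\<Sum>a\<in>A. ennreal (q (a, y))) = ennreal (\<Sum>a\<in>A. q (a, y))"
        by (rule sum_ennreal) (simp add: less_imp_le[OF q0])
      also have "(\<Sum>a\<in>A. q (a, y)) = ?c * ((\<Sum>a\<in>A. 2 powr (- d a y)) / C)"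
        by (simp add: q_def sum_distrib_left sum_divide_distrib)
      also have "\<dots> \<le> ?c * 1" using y C c0 by (intro mult_left_mono) auto
      finally show "(\<Sum>a\<in>A. ennreal (q (a, y))) \<le> ennreal ?c" by (simp add: ennreal_leI)
    qed
    also have "\<dots> = ennreal ?c" by (simp add: N.emeasure_space_1)
    finally show ?thesis .
    qed
    ultimately have "(\<integral>\<^sup>+x. ennreal (q x) \<partial>Q) \<le> ennreal ?c / ennreal ?c"
      by (simp add: divide_right_mono_ennreal)
    also have "\<dots> = 1" using c0 by simp
    finally show ?thesis .
  qed
  have q_int: "integrable Q q"
    by (rule integrableI_bounded) (use nnq q0 in \<open>auto simp: less_imp_le abs_of_pos intro: le_less_trans\<close>)
  have q_1: "(\<integral>x. q x \<partial>Q) \<le> 1"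
  proof -
    have "ennreal (\<integral>x. q x \<partial>Q) \<le> 1"
      using nn_integral_eq_integral[OF q_int] q0 nnq by (simp add: less_imp_le)
    then show ?thesis by (simp add: ennreal_le_1)
  qed
  have DY: "integrable (?U \<Otimes>\<^sub>M M) (\<lambda>s. D (fst s, Y s))"
    "(\<integral>s. D (fst s, Y s) \<partial>(?U \<Otimes>\<^sub>M M)) = (\<Sum>a\<in>A. \<integral>\<omega>. d a (Y (a, \<omega>)) \<partial>M) / ?c"
    using uniform_message_pair[OF A M, of "\<lambda>s. D (fst s, Y s)"] int
    by (simp_all add: D_eq)
  have D_J: "integrable J D" "(\<integral>x. D x \<partial>J) = (\<Sum>a\<in>A. \<integral>\<omega>. d a (Y (a, \<omega>)) \<partial>M) / ?c"
    unfolding J_def using DY by (simp_all add: integrable_distr_eq integral_distr)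
  have D_Q: "integrable Q (\<lambda>x. f x * D x)" "(\<integral>x. f x * D x \<partial>Q) = (\<integral>x. D x \<partial>J)"
    using D_J(1) f0 unfolding J_dens[symmetric] by (simp_all add: integrable_real_density integral_real_density)
  let ?L = "log 2 ?c - log 2 C"
  \<comment> \<open>The right-hand side of \<open>mult_log_ge\<close> with
    \<open>log 2 (q x)\<close> written out. Its integral is the claimed bound plus a nonnegative
    multiple of one minus the mass of \<open>q\<close>.\<close>
  define g where "g x = f x * ?L - f x * D x + (f x - q x) / ln 2" for x
  have g_int: "integrable Q g"
    unfolding g_def using f_int q_int D_Q(1) by simp
  have "AE x in Q. g x \<le> f x * log 2 (f x)"
    using AQ
  proof (rule AE_mp, intro AE_I2 impI)
    fix x :: "real \<times> 'b" assume "fst x \<in> A"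
    then have lq: "log 2 (q x) = ?L - D x"
      unfolding q_eq using c0 C by (simp add: log_mult log_divide)
    have "g x = f x * log 2 (q x) + (f x - q x) / ln 2"
      unfolding g_def lq by (simp add: algebra_simps)
    then show "g x \<le> f x * log 2 (f x)"
      using mult_log_ge[OF f0 q0, of x x] by simp
  qed
  \<comment> \<open>\<open>t * log 2 t\<close> is at least \<open>- 1 / ln 2\<close> by
    \<open>mult_log_ge\<close> at 1, and at most \<open>card A * log 2 (card A)\<close> for
    \<open>0 \<le> t \<le> card A\<close>.\<close>
  moreover have "integrable Q (\<lambda>x. f x * log 2 (f x))"
  proof (rule Q.integrable_const_bound[where B = "?c * log 2 ?c + 1 / ln 2"])
    show "AE x in Q. norm (f x * log 2 (f x)) \<le> ?c * log 2 ?c + 1 / ln 2"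
      using f_le
    proof (rule AE_mp, intro AE_I2 impI)
      fix x :: "real \<times> 'b" assume fx: "f x \<le> ?c"
      have lc: "log 2 ?c \<ge> 0" using c by simp
      have "f x * log 2 (f x) \<ge> - (1 / ln 2)"
      proof -
        have "(f x - 1) / ln 2 \<ge> (0 - 1) / ln 2"
          using f0[of x] by (intro divide_right_mono) auto
        then show ?thesis using mult_log_ge[OF f0[of x], of 1] by simp
      qed
      moreover have "f x * log 2 (f x) \<le> ?c * log 2 ?c"
      proof (cases "f x = 0")
        case False
        then have fp: "f x > 0" using f0[of x] by simp
        have "f x * log 2 (f x) \<le> f x * log 2 ?c" using fp fx by (intro mult_left_mono) auto
        also have "\<dots> \<le> ?c * log 2 ?c" using lc fx by (intro mult_right_mono)
        finally show ?thesis .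
      qed (use lc c0 in simp)
      moreover have "1 / ln 2 \<ge> (0::real)" "?c * log 2 ?c \<ge> 0" using lc c0 by simp_all
      ultimately show "norm (f x * log 2 (f x)) \<le> ?c * log 2 ?c + 1 / ln 2"
        unfolding real_norm_def abs_le_iff by linarith
    qed
  qed measurable
  ultimately have "(\<integral>x. g x \<partial>Q) \<le> (\<integral>x. f x * log 2 (f x) \<partial>Q)"
    using g_int by (intro integral_mono_AE)
  moreover have "(\<integral>x. g x \<partial>Q) = ?L - (\<Sum>a\<in>A. \<integral>\<omega>. d a (Y (a, \<omega>)) \<partial>M) / ?c + (1 - (\<integral>x. q x \<partial>Q)) / ln 2"
    unfolding g_def using f_int q_int D_Q D_J f_1 by simp
  moreover have "(1 - (\<integral>x. q x \<partial>Q)) / ln 2 \<ge> 0" using q_1 by simp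
  ultimately show ?thesis unfolding MI KL by linarith
qed

section \<open>Linear feedback encoders\<close>

lemma sum_powr_grid_le:
  fixes x :: real
  shows "(\<Sum>g<N. 2 powr (- (x - real g)\<^sup>2)) \<le> 22"
proof -
  define n where "n = \<lfloor>x\<rfloor>"
  let ?p = "\<lambda>i. (1/4 :: real) ^ i"
  \<comment> \<open>With \<open>t = \<bar>x - g\<bar>\<close>, the inequalities
    \<open>t\<^sup>2 \<ge> 2 * t - 1\<close> and \<open>\<bar>n - g\<bar> \<le> t + 1\<close> bound
    the exponent by \<open>3 - 2 * \<bar>n - g\<bar>\<close>: a geometric series of ratio 1/4 on
    either side of \<open>n\<close>. The total is \<open>8 * (4/3 + 4/3) = 64/3\<close>, hence the
    constant 22.\<close>
  have term_le: "2 powr (- (x - real g)\<^sup>2) \<le> 8 * ?p (nat \<bar>n - int g\<bar>)" for g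
  proof -
    let ?t = "\<bar>x - real g\<bar>"
    have "0 \<le> (?t - 1)\<^sup>2" by simp
    then have 1: "(x - real g)\<^sup>2 \<ge> 2 * ?t - 1" by (simp add: power2_diff)
    have "\<bar>real_of_int n - real g\<bar> \<le> ?t + 1" unfolding n_def by linarith
    have "\<And>a b t :: real. a \<ge> 2 * t - 1 \<Longrightarrow> b \<le> t + 1 \<Longrightarrow> - a \<le> 3 - 2 * b" by simp
    from this[OF 1 \<open>\<bar>real_of_int n - real g\<bar> \<le> ?t + 1\<close>]
    have "- (x - real g)\<^sup>2 \<le> 3 - 2 * \<bar>real_of_int n - real g\<bar>" .
    then have "2 powr (- (x - real g)\<^sup>2) \<le> 2 powr (3 - 2 * \<bar>real_of_int n - real g\<bar>)"
      by simp
    also have "2 * \<bar>real_of_int n - real g\<bar> = real (2 * nat \<bar>n - int g\<bar>)"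
      by simp
    also have "2 powr (3 - real (2 * nat \<bar>n - int g\<bar>)) = 8 / 2 ^ (2 * nat \<bar>n - int g\<bar>)"
      by (simp add: powr_diff powr_realpow del: of_nat_mult of_nat_nat)
    also have "\<dots> = 8 * ?p (nat \<bar>n - int g\<bar>)" by (simp add: power_mult power_divide)
    finally show ?thesis .
  qed
  have geo: "sum ?p I \<le> 4/3" if "finite I" for I
  proof -
    have "sum ?p I \<le> suminf ?p" using that by (intro sum_le_suminf summable_geometric) auto
    also have "\<dots> = 4/3" by (subst suminf_geometric) auto
    finally show ?thesis .
  qed
  have half: "(\<Sum>g\<in>I. ?p (nat \<bar>n - int g\<bar>)) \<le> 4/3"
    if "finite I" "inj_on (\<lambda>g. nat \<bar>n - int g\<bar>) I" for I
    using geo[of "(\<lambda>g. nat \<bar>n - int g\<bar>) ` I"] that by (simp add: sum.reindex)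
  let ?I = "{g\<in>{..<N}. int g \<le> n}" and ?J = "{g\<in>{..<N}. \<not> int g \<le> n}"
  have "(\<Sum>g<N. 2 powr (- (x - real g)\<^sup>2)) \<le> (\<Sum>g<N. 8 * ?p (nat \<bar>n - int g\<bar>))"
    by (intro sum_mono term_le)
  also have "\<dots> = 8 * (\<Sum>g\<in>?I \<union> ?J. ?p (nat \<bar>n - int g\<bar>))"
    by (subst sum_distrib_left, intro sum.cong) auto
  also have "(\<Sum>g\<in>?I \<union> ?J. ?p (nat \<bar>n - int g\<bar>)) = (\<Sum>g\<in>?I. ?p (nat \<bar>n - int g\<bar>)) + (\<Sum>g\<in>?J. ?p (nat \<bar>n - int g\<bar>))"
    by (rule sum.union_disjoint) auto
  also have "\<dots> \<le> 4/3 + 4/3"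
    by (intro add_mono half) (auto simp: inj_on_def)
  finally show ?thesis by simp
qed

text \<open>The weights factor over the coordinates. The bound is independent of the grid sizes, so
  its logarithm disappears after division by the block length.\<close>

lemma sum_PiE_powr_le:
  fixes x :: "'i \<Rightarrow> real" and N :: "'i \<Rightarrow> nat"
  assumes "finite W"
  shows "(\<Sum>g\<in>Pi\<^sub>E W (\<lambda>w. {..<N w}). 2 powr (- (\<Sum>w\<in>W. (x w - real (g w))\<^sup>2))) \<le> 22 ^ card W"
proof -
  have "2 powr (- (\<Sum>w\<in>W. (x w - real (g w))\<^sup>2)) = (\<Prod>w\<in>W. 2 powr (- (x w - real (g w))\<^sup>2))" for g
    using assms by (induction W rule: finite_induct) (auto simp: powr_add powr_minus divide_inverse powr_diff)
  then have "(\<Sum>g\<in>Pi\<^sub>E W (\<lambda>w. {..<N w}). 2 powr (- (\<Sum>w\<in>W. (x w - real (g w))\<^sup>2)))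
     = (\<Prod>w\<in>W. \<Sum>j<N w. 2 powr (- (x w - real j)\<^sup>2))"
    by (simp add: prod_sum_PiE[OF assms])
  also have "\<dots> \<le> (\<Prod>w\<in>W. 22)"
    by (intro prod_mono conjI sum_powr_grid_le sum_nonneg) auto
  finally show ?thesis by simp
qed

text \<open>Reflecting the grid, \<open>j \<mapsto> N - 1 - j\<close> in each coordinate, permutes
  it and changes the sign of the summand. This makes the mean of every channel input zero.\<close>

lemma sum_centered_grid_PiE:
  fixes N :: "'i \<Rightarrow> nat"
  assumes "finite W" "w \<in> W"
  shows "(\<Sum>g\<in>Pi\<^sub>E W (\<lambda>w. {..<N w}). (2 * real (g w) - (real (N w) - 1)) / real (N w)) = 0"
proof -
  let ?S = "Pi\<^sub>E W (\<lambda>w. {..<N w})" and ?h = "\<lambda>g. (2 * real (g w) - (real (N w) - 1)) / real (N w)"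
  define flip where "flip g = (\<lambda>v\<in>W. N v - 1 - g v)" for g :: "'i \<Rightarrow> nat"
  have "bij_betw flip ?S ?S"
  proof (rule bij_betwI[where g = flip])
    show "flip \<in> ?S \<rightarrow> ?S"
    proof
      fix g assume g: "g \<in> ?S"
      have "N v - 1 - g v < N v" if "v \<in> W" for v
        using PiE_mem[OF g that] by auto
      then show "flip g \<in> ?S" by (auto simp: flip_def)
    qed
    then show "flip \<in> ?S \<rightarrow> ?S" .
    show "flip (flip g) = g" if "g \<in> ?S" for g
    proof
      fix v show "flip (flip g) v = g v"
        using that by (cases "v \<in> W") (auto simp: flip_def PiE_def extensional_def Pi_iff intro!: diff_diff_cancel dest!: bspec[of _ _ v])
    qed
    then show "flip (flip g) = g" if "g \<in> ?S" for g using that .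
  qed
  then have "sum ?h ?S = (\<Sum>g\<in>?S. ?h (flip g))"
    by (rule sum.reindex_bij_betw[symmetric])
  also have "\<dots> = (\<Sum>g\<in>?S. - ?h g)"
  proof (rule sum.cong)
    fix g assume "g \<in> ?S"
    then have "g w < N w" using assms by auto
    then show "?h (flip g) = - ?h g"
      using assms by (simp add: flip_def of_nat_diff minus_divide_left[symmetric] field_simps)
  qed simp
  also have "\<dots> = - sum ?h ?S" by (rule sum_negf)
  finally show ?thesis by simp
qed

section \<open>Real signals with prescribed values on a conjugation-closed set\<close>

lemma poly_interpolation:
  fixes s :: "complex \<Rightarrow> complex"
  assumes "finite W" "0 \<notin> W"
  shows "\<exists>p. coeff p 0 = 0 \<and> (\<forall>w\<in>W. poly p w = s w)"
proof -
  \<comment> \<open>Lagrange interpolation with an extra factor \<open>X\<close>: it removes the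
    constant coefficient, as transmission starts at time 1, and \<open>0 \<notin> W\<close> keeps
    the denominators nonzero.\<close>
  let ?q = "\<lambda>w. [:0, 1:] * (\<Prod>v\<in>W - {w}. [:- v, 1:])"
  let ?p = "\<Sum>w\<in>W. smult (s w / poly (?q w) w) (?q w)"
  have q0: "poly (?q w) w \<noteq> 0" if "w \<in> W" for w
    using that assms by (auto simp: poly_prod)
  have q1: "poly (?q v) w = 0" if "w \<in> W" "v \<in> W" "v \<noteq> w" for v w
    using that assms by (auto simp: poly_prod intro!: bexI[of _ w])
  have "poly ?p w = s w" if w: "w \<in> W" for w
  proof -
    have "poly ?p w = (\<Sum>v\<in>W. s v / poly (?q v) v * poly (?q v) w)"
      by (simp only: poly_sum poly_smult)
    also have "\<dots> = (\<Sum>v\<in>W. if v = w then s w else 0)"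
      using q0 q1 w by (intro sum.cong) auto
    also have "\<dots> = s w" using assms w by simp
    finally show ?thesis .
  qed
  moreover have "coeff ?p 0 = 0"
    by (simp add: coeff_sum coeff_mult)
  ultimately show ?thesis by blast
qed

text \<open>The real coordinate of a conjugation-symmetric family \<open>s\<close> stored at the index \<open>w\<close>: real
  part above and on the real axis, imaginary part of the conjugate entry below it.\<close>

definition real_coord :: "complex \<Rightarrow> complex \<Rightarrow> real" where
  "real_coord w s = (if Im w \<ge> 0 then Re s else - Im s)"

lemma real_coord_simps:
  "real_coord w (a + b) = real_coord w a + real_coord w b"
  "real_coord w (of_real t * a) = t * real_coord w a"
  "real_coord w 0 = 0"
  by (auto simp: real_coord_def)

lemma real_coord_sum: "real_coord w (\<Sum>i\<in>I. a i) = (\<Sum>i\<in>I. real_coord w (a i))"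
  by (induction I rule: infinite_finite_induct) (auto simp: real_coord_simps)

lemma real_coord_measurable [measurable]: "real_coord w \<in> borel_measurable borel"
  unfolding real_coord_def by measurable

lemma abs_real_coord_le: "\<bar>real_coord w a\<bar> \<le> cmod a"
  by (auto simp: real_coord_def abs_Re_le_cmod abs_Im_le_cmod)

text \<open>The target values satisfy \<open>s v (cnj w) = cnj (s v w)\<close>, so averaging the
  interpolating polynomial with its conjugate makes the coefficients real and keeps the values. A
  conjugate pair thus carries two independent real symbols, one in the real and one in the imaginary
  part, so that every element of \<open>W\<close> counts once in the rate.\<close>

lemma real_signals:
  assumes W: "finite W" "0 \<notin> W" "\<And>w. w \<in> W \<Longrightarrow> cnj w \<in> W"
  shows "\<exists>(L :: complex \<Rightarrow> nat \<Rightarrow> real) n. (\<forall>v. \<forall>i>n. L v i = 0) \<and>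
    (\<forall>v\<in>W. \<forall>w\<in>W. \<forall>k\<ge>n.
       real_coord w (\<Sum>i=1..k. of_real (L v i) * w ^ i) = (if v = w then 1 else 0))"
proof -
  define s :: "complex \<Rightarrow> complex \<Rightarrow> complex" where
    "s v w = (if Im w = 0 then of_bool (v = w)
       else if Im w > 0 then of_bool (v = w) + \<i> * of_bool (v = cnj w)
       else of_bool (v = cnj w) - \<i> * of_bool (v = w))" for v w
  have s_cnj: "cnj (s v (cnj w)) = s v w" for v w
    by (auto simp: s_def complex_eq_iff)
  have s_coord: "real_coord w (s v w) = (if v = w then 1 else 0)" for v w
    by (auto simp: s_def real_coord_def)
  have "\<forall>v. \<exists>p. coeff p 0 = 0 \<and> (\<forall>w\<in>W. poly p w = s v w)"
    using poly_interpolation[OF W(1,2)] by blast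
  then obtain p where p: "\<And>v. coeff (p v) 0 = 0" "\<And>v w. w \<in> W \<Longrightarrow> poly (p v) w = s v w"
    by metis
  define n where "n = (\<Sum>v\<in>W. degree (p v))"
  define L where "L v i = (if v \<in> W then Re (coeff (p v) i) else 0)" for v i
  have deg: "degree (p v) \<le> n" if "v \<in> W" for v
    unfolding n_def using that W by (intro member_le_sum) auto
  show ?thesis
  proof (intro exI conjI ballI allI impI)
    show "L v i = 0" if "i > n" for v i
      using deg[of v] that by (auto simp: L_def coeff_eq_0)
    fix v w k assume vw: "v \<in> W" "w \<in> W" and k: "n \<le> k"
    have poly_eq: "poly (p v) x = (\<Sum>i=1..k. coeff (p v) i * x ^ i)" for x
    proof -
      have "poly (p v) x = (\<Sum>i\<le>k. coeff (p v) i * x ^ i)"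
        unfolding poly_altdef using deg[OF vw(1)] k
        by (intro sum.mono_neutral_left) (auto simp: coeff_eq_0)
      also have "\<dots> = (\<Sum>i=1..k. coeff (p v) i * x ^ i)"
        by (intro sum.mono_neutral_right) (auto simp: p not_less_eq_eq)
      finally show ?thesis .
    qed
    have "(\<Sum>i=1..k. of_real (L v i) * w ^ i) = (\<Sum>i=1..k. (coeff (p v) i * w ^ i + cnj (coeff (p v) i * cnj w ^ i)) / 2)"
    proof (intro sum.cong refl)
      fix i
      have re: "of_real (Re c) = (c + cnj c) / 2" for c by (simp add: complex_add_cnj)
      show "of_real (L v i) * w ^ i = (coeff (p v) i * w ^ i + cnj (coeff (p v) i * cnj w ^ i)) / 2"
        using vw by (simp add: L_def re distrib_right)
    qed
    also have "\<dots> = (poly (p v) w + cnj (poly (p v) (cnj w))) / 2"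
      unfolding poly_eq by (simp add: sum.distrib sum_divide_distrib[symmetric])
    also have "\<dots> = s v w"
      using p(2)[OF vw(2)] p(2)[OF W(3)[OF vw(2)]] by (simp add: s_cnj)
    finally show "real_coord w (\<Sum>i=1..k. of_real (L v i) * w ^ i) = (if v = w then 1 else 0)"
      by (simp add: s_coord)
  qed
qed

text \<open>Used with \<open>L = G / H\<close> for \<open>H = F + G\<close>: the output without its
  message part is \<open>H u\<close>, so applying \<open>L\<close> to it recovers the feedback
  \<open>G u\<close> from what the encoder has seen. The sum starts at 1 because this
  \<open>L\<close>, like \<open>G\<close>, has no constant coefficient.\<close>

definition feedback_encoder :: "(real \<Rightarrow> nat \<Rightarrow> real) \<Rightarrow> real fps \<Rightarrow> encoder" where
  "feedback_encoder V L i = (\<lambda>(m, y). V m i + (\<Sum>j=1..<i. fps_nth L j * (y (i - j) - V m (i - j))))"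

text \<open>The noise from time 1 on, whitened by \<open>inverse F\<close> as if it had vanished before.\<close>

definition innovation :: "real fps \<Rightarrow> (nat \<Rightarrow> real) \<Rightarrow> real fps" where
  "innovation F z = inverse F * Abs_fps (\<lambda>i. if i = 0 then 0 else z i)"

lemma innovation_nth_0 [simp]: "fps_nth (innovation F z) 0 = 0"
  by (simp add: innovation_def)

text \<open>Strong induction on time: if the earlier outputs have the claimed form,
  \<open>G / H\<close> applied to \<open>H u\<close> gives \<open>G u\<close>, and adding the noise
  \<open>F u\<close> gives \<open>H u\<close>. Since \<open>u\<close> starts at time 1, these are
  exact identities of formal power series.\<close>

lemma feedback_encoder_output:
  fixes F G :: "real fps" and V :: "real \<Rightarrow> nat \<Rightarrow> real"
  assumes F0: "fps_nth F 0 = 1" and G0: "fps_nth G 0 = 0"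
  defines "x \<equiv> feedback_encoder V (G * inverse (F + G))"
  shows "k \<ge> 1 \<Longrightarrow> channel_output x m z k = V m k + fps_nth ((F + G) * innovation F z) k" (is "_ \<Longrightarrow> ?out k")
    and "k \<ge> 1 \<Longrightarrow> channel_input x m z k = V m k + fps_nth (G * innovation F z) k" (is "_ \<Longrightarrow> ?in k")
proof -
  let ?H = "F + G" and ?L = "G * inverse (F + G)" and ?U = "innovation F z"
  have LH: "?L * (?H * ?U) = G * ?U"
  proof -
    have "inverse ?H * ?H = 1" using F0 G0 by (intro inverse_mult_eq_1) simp
    moreover have "?L * (?H * ?U) = G * (inverse ?H * ?H) * ?U" by (simp only: mult.assoc)
    ultimately show ?thesis by simp
  qed
  have FU: "fps_nth (F * ?U) k = z k" if "k \<ge> 1" for k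
    using that F0 inverse_mult_eq_1'[of F] by (simp add: innovation_def mult.assoc[symmetric])
  have x_eq: "x k (m, y) = V m k + (\<Sum>j=1..<k. fps_nth ?L j * (y (k - j) - V m (k - j)))" for k y
    by (simp add: x_def feedback_encoder_def)
  have step: "?in k" if k: "k \<ge> 1" and IH: "\<And>i. 1 \<le> i \<Longrightarrow> i < k \<Longrightarrow> ?out i" for k
  proof -
    have "channel_input x m z k = V m k + (\<Sum>j=1..<k. fps_nth ?L j * fps_nth (?H * ?U) (k - j))"
      unfolding channel_input_def x_eq using IH by (auto intro!: sum.cong)
    also have "(\<Sum>j=1..<k. fps_nth ?L j * fps_nth (?H * ?U) (k - j)) = fps_nth (?L * (?H * ?U)) k"
    proof -
      have "fps_nth (?L * (?H * ?U)) k = (\<Sum>j=0..k. fps_nth ?L j * fps_nth (?H * ?U) (k - j))"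
        by (rule fps_mult_nth)
      also have "\<dots> = (\<Sum>j=1..<k. fps_nth ?L j * fps_nth (?H * ?U) (k - j))"
      proof (rule sum.mono_neutral_right)
        show "\<forall>i\<in>{0..k} - {1..<k}. fps_nth ?L i * fps_nth (?H * ?U) (k - i) = 0"
        proof
          fix i assume "i \<in> {0..k} - {1..<k}"
          then have "i = 0 \<or> i = k" by auto
          then show "fps_nth ?L i * fps_nth (?H * ?U) (k - i) = 0" using G0 by auto
        qed
      qed auto
      finally show ?thesis ..
    qed
    finally show ?thesis unfolding LH .
  qed
  have out: "?out k" if "k \<ge> 1" for k
    using that
  proof (induction k rule: less_induct)
    case (less k)
    have "channel_output x m z k = channel_input x m z k + z k" by (rule channel_output_eq)
    also have "channel_input x m z k = V m k + fps_nth (G * ?U) k" using less by (intro step) auto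
    finally show ?case using FU[OF less.prems] by (simp add: distrib_right)
  qed
  then show "k \<ge> 1 \<Longrightarrow> ?out k" .
  show "k \<ge> 1 \<Longrightarrow> ?in k" using step out by blast
qed

lemma feedback_encoder_measurable:
  assumes [measurable]: "\<And>i. (\<lambda>m. V m i) \<in> borel_measurable borel"
  shows "feedback_encoder V L i \<in> borel_measurable (borel \<Otimes>\<^sub>M Pi\<^sub>M {1..<i} (\<lambda>_. borel))"
proof -
  have [measurable]: "(\<lambda>y. y (i - j)) \<in> borel_measurable (Pi\<^sub>M {1..<i} (\<lambda>_. borel))" if "j \<in> {1..<i}" for j
    using that by (intro measurable_component_singleton) auto
  show ?thesis unfolding feedback_encoder_def by measurable
qed

lemma fps_mult_innovation_measurable:
  fixes z :: "nat \<Rightarrow> 'a \<Rightarrow> real"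
  assumes [measurable]: "\<And>i. i \<ge> 1 \<Longrightarrow> z i \<in> borel_measurable M"
  shows "(\<lambda>\<omega>. fps_nth (B * innovation F (\<lambda>i. z i \<omega>)) k) \<in> borel_measurable M"
proof -
  have [measurable]: "(\<lambda>\<omega>. fps_nth (Abs_fps (\<lambda>i. if i = 0 then 0 else z i \<omega>)) j) \<in> borel_measurable M" for j
    by (cases "j = 0") auto
  show ?thesis unfolding innovation_def mult.assoc[symmetric] fps_mult_nth[of "B * _"] by measurable
qed

section \<open>Coding over noise that can be whitened\<close>

text \<open>Cauchy-Schwarz after splitting \<open>c\<close> into \<open>sqrt \<bar>c\<bar>\<close>
  and \<open>sgn c * sqrt \<bar>c\<bar>\<close>. It bounds the energy of a filtered signal through
  the absolute sum of the filter coefficients.\<close>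

lemma weighted_Cauchy_Schwarz:
  fixes c x :: "'i \<Rightarrow> real"
  shows "(\<Sum>i\<in>I. c i * x i)\<^sup>2 \<le> (\<Sum>i\<in>I. \<bar>c i\<bar>) * (\<Sum>i\<in>I. \<bar>c i\<bar> * (x i)\<^sup>2)"
proof -
  have "(\<Sum>i\<in>I. c i * x i) = (\<Sum>i\<in>I. sqrt \<bar>c i\<bar> * (sgn (c i) * sqrt \<bar>c i\<bar> * x i))"
    by (intro sum.cong refl) (auto simp: sgn_if algebra_simps)
  also have "\<dots>\<^sup>2 \<le> (\<Sum>i\<in>I. (sqrt \<bar>c i\<bar>)\<^sup>2) * (\<Sum>i\<in>I. (sgn (c i) * sqrt \<bar>c i\<bar> * x i)\<^sup>2)"
    by (rule Cauchy_Schwarz_ineq_sum)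
  also have "\<dots> = (\<Sum>i\<in>I. \<bar>c i\<bar>) * (\<Sum>i\<in>I. \<bar>c i\<bar> * (x i)\<^sup>2)"
    by (intro arg_cong2[where f="(*)"] sum.cong refl) (auto simp: power_mult_distrib sgn_if)
  finally show ?thesis .
qed

lemma power2_sum_le_card:
  fixes x :: "'i \<Rightarrow> real"
  shows "(\<Sum>i\<in>I. x i)\<^sup>2 \<le> card I * (\<Sum>i\<in>I. (x i)\<^sup>2)"
  using weighted_Cauchy_Schwarz[of "\<lambda>_. 1" x I] by simp

text \<open>Young's inequality for summable sequences: after exchanging the sums, each
  \<open>c j\<close> multiplies a shifted piece of the sum of \<open>\<rho>\<close>.\<close>

lemma convolution_sum_le:
  fixes c \<rho> :: "nat \<Rightarrow> real"
  assumes "\<And>j. c j \<ge> 0" "\<And>j. \<rho> j \<ge> 0"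
  shows "(\<Sum>i=1..k. \<Sum>j<i. c j * \<rho> (i - j)) \<le> (\<Sum>j<k. c j) * (\<Sum>l=1..k. \<rho> l)"
proof -
  have "(\<Sum>i=1..k. \<Sum>j<i. c j * \<rho> (i - j)) = (\<Sum>i=1..k. \<Sum>j<k. if j < i then c j * \<rho> (i - j) else 0)"
    by (intro sum.cong refl sum.mono_neutral_cong_left) auto
  also have "\<dots> = (\<Sum>j<k. \<Sum>i=1..k. if j < i then c j * \<rho> (i - j) else 0)"
    by (rule sum.swap)
  also have "\<dots> \<le> (\<Sum>j<k. c j * (\<Sum>l=1..k. \<rho> l))"
  proof (rule sum_mono)
    fix j
    have "(\<Sum>i=1..k. if j < i then c j * \<rho> (i - j) else 0) = (\<Sum>i\<in>{i\<in>{1..k}. j < i}. c j * \<rho> (i - j))"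
      by (intro sum.mono_neutral_cong_right) auto
    also have "\<dots> = c j * (\<Sum>l\<in>(\<lambda>i. i - j) ` {i\<in>{1..k}. j < i}. \<rho> l)"
      by (subst sum.reindex) (auto simp: inj_on_def sum_distrib_left)
    also have "\<dots> \<le> c j * (\<Sum>l=1..k. \<rho> l)"
      using assms by (intro mult_left_mono sum_mono2) auto
    finally show "(\<Sum>i=1..k. if j < i then c j * \<rho> (i - j) else 0) \<le> c j * (\<Sum>l=1..k. \<rho> l)" .
  qed
  finally show ?thesis by (simp add: sum_distrib_right)
qed

text \<open>A power series that vanishes at \<open>w\<close> equals minus its own tail there.\<close>

lemma cmod_partial_sum_le:
  fixes a :: "nat \<Rightarrow> real" and w :: complex
  assumes a: "summable (\<lambda>m. \<bar>a m\<bar>)" and w: "cmod w \<le> 1" and zero: "(\<lambda>m. of_real (a m) * w ^ m) sums 0"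
  shows "cmod (\<Sum>m\<le>n. of_real (a m) * w ^ m) \<le> cmod w ^ n * (\<Sum>m. \<bar>a m\<bar>)"
proof -
  let ?f = "\<lambda>m. of_real (a m) * w ^ m"
  have "summable ?f" "suminf ?f = 0" using zero by (auto simp: sums_iff)
  then have split: "(\<Sum>m<Suc n. ?f m) = - (\<Sum>m. ?f (m + Suc n))"
    using suminf_split_initial_segment[of ?f "Suc n"] by (simp add: eq_neg_iff_add_eq_0 add.commute)
  have le: "norm (?f (m + Suc n)) \<le> cmod w ^ n * \<bar>a (m + Suc n)\<bar>" for m
    using mult_left_mono[OF power_decreasing[of n "m + Suc n" "cmod w"], of "\<bar>a (m + Suc n)\<bar>"] w
    by (simp add: norm_mult norm_power mult.commute del: power_Suc)
  have s: "summable (\<lambda>m. cmod w ^ n * \<bar>a (m + Suc n)\<bar>)"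
    using summable_ignore_initial_segment[OF a, of "Suc n"] by (rule summable_mult)
  have "cmod (\<Sum>m\<le>n. ?f m) = cmod (\<Sum>m. ?f (m + Suc n))"
    using split by (simp only: lessThan_Suc_atMost norm_minus_cancel)
  also have "\<dots> \<le> (\<Sum>m. cmod w ^ n * \<bar>a (m + Suc n)\<bar>)"
    by (rule norm_suminf_le[OF le s])
  also have "\<dots> = cmod w ^ n * (\<Sum>m. \<bar>a (m + Suc n)\<bar>)"
    using summable_ignore_initial_segment[OF a, of "Suc n"] by (rule suminf_mult)
  also have "(\<Sum>m. \<bar>a (m + Suc n)\<bar>) \<le> (\<Sum>m. \<bar>a m\<bar>)"
    using suminf_split_initial_segment[OF a, of "Suc n"] by (simp add: sum_nonneg del: sum.lessThan_Suc)
  finally show ?thesis by (simp add: mult_left_mono)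
qed

text \<open>Collect the terms containing \<open>u l\<close>: they are \<open>w ^ l\<close> times the
  partial sum up to \<open>k - l\<close> of a series that vanishes at \<open>w\<close>, which is of
  order \<open>cmod w ^ (k - l)\<close>. The two powers multiply to \<open>cmod w ^ k\<close>,
  whatever \<open>l\<close> is.\<close>

lemma cmod_filtered_sum_le:
  fixes a :: "nat \<Rightarrow> real" and u :: "nat \<Rightarrow> real" and w :: complex
  assumes a: "summable (\<lambda>m. \<bar>a m\<bar>)" and w: "cmod w \<le> 1" and zero: "(\<lambda>m. of_real (a m) * w ^ m) sums 0"
  shows "cmod (\<Sum>i=1..k. of_real (\<Sum>j<i. a j * u (i - j)) * w ^ i) \<le> cmod w ^ k * (\<Sum>m. \<bar>a m\<bar>) * (\<Sum>l=1..k. \<bar>u l\<bar>)"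
proof -
  have "(\<Sum>i=1..k. of_real (\<Sum>j<i. a j * u (i - j)) * w ^ i) = (\<Sum>i=1..k. \<Sum>l=1..i. of_real (u l) * w ^ l * (of_real (a (i - l)) * w ^ (i - l)))"
  proof (intro sum.cong refl)
    fix i
    have "of_real (\<Sum>j<i. a j * u (i - j)) * w ^ i = (\<Sum>j<i. of_real (a j * u (i - j)) * w ^ i)"
      by (simp add: sum_distrib_right)
    also have "\<dots> = (\<Sum>l=1..i. of_real (a (i - l) * u l) * w ^ i)"
      by (rule sum.reindex_bij_witness[of _ "\<lambda>l. i - l" "\<lambda>j. i - j"]) auto
    also have "\<dots> = (\<Sum>l=1..i. of_real (u l) * w ^ l * (of_real (a (i - l)) * w ^ (i - l)))"
    proof (intro sum.cong refl)
      fix l assume "l \<in> {1..i}"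
      then have "w ^ i = w ^ l * w ^ (i - l)" by (simp add: power_add[symmetric])
      then show "of_real (a (i - l) * u l) * w ^ i = of_real (u l) * w ^ l * (of_real (a (i - l)) * w ^ (i - l))"
        by simp
    qed
    finally show "of_real (\<Sum>j<i. a j * u (i - j)) * w ^ i = (\<Sum>l=1..i. of_real (u l) * w ^ l * (of_real (a (i - l)) * w ^ (i - l)))" .
  qed
  also have "\<dots> = (\<Sum>l=1..k. \<Sum>i=l..k. of_real (u l) * w ^ l * (of_real (a (i - l)) * w ^ (i - l)))"
    by (subst sum.Sigma, simp, simp, subst sum.Sigma, simp, simp,
        rule sum.reindex_bij_witness[of _ "\<lambda>(l, i). (i, l)" "\<lambda>(i, l). (l, i)"]) auto
  also have "\<dots> = (\<Sum>l=1..k. of_real (u l) * w ^ l * (\<Sum>m\<le>k - l. of_real (a m) * w ^ m))"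
  proof (intro sum.cong refl)
    fix l assume "l \<in> {1..k}"
    then have "(\<Sum>i=l..k. of_real (a (i - l)) * w ^ (i - l)) = (\<Sum>m\<le>k - l. of_real (a m) * w ^ m)"
      by (intro sum.reindex_bij_witness[of _ "\<lambda>m. m + l" "\<lambda>i. i - l"]) auto
    then show "(\<Sum>i=l..k. of_real (u l) * w ^ l * (of_real (a (i - l)) * w ^ (i - l))) = of_real (u l) * w ^ l * (\<Sum>m\<le>k - l. of_real (a m) * w ^ m)"
      by (simp only: sum_distrib_left[symmetric])
  qed
  also have "cmod \<dots> \<le> (\<Sum>l=1..k. cmod (of_real (u l) * w ^ l * (\<Sum>m\<le>k - l. of_real (a m) * w ^ m)))"
    by (rule norm_sum)
  also have "\<dots> \<le> (\<Sum>l=1..k. cmod w ^ k * (\<Sum>m. \<bar>a m\<bar>) * \<bar>u l\<bar>)"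
  proof (rule sum_mono)
    fix l assume l: "l \<in> {1..k}"
    have "cmod (of_real (u l) * w ^ l * (\<Sum>m\<le>k - l. of_real (a m) * w ^ m)) = \<bar>u l\<bar> * cmod w ^ l * cmod (\<Sum>m\<le>k - l. of_real (a m) * w ^ m)"
      by (simp add: norm_mult norm_power)
    also have "\<dots> \<le> \<bar>u l\<bar> * cmod w ^ l * (cmod w ^ (k - l) * (\<Sum>m. \<bar>a m\<bar>))"
      by (intro mult_left_mono cmod_partial_sum_le assms) auto
    also have "\<dots> = (cmod w ^ l * cmod w ^ (k - l)) * (\<Sum>m. \<bar>a m\<bar>) * \<bar>u l\<bar>" by simp
    also have "cmod w ^ l * cmod w ^ (k - l) = cmod w ^ k" using l by (simp add: power_add[symmetric])
    finally show "cmod (of_real (u l) * w ^ l * (\<Sum>m\<le>k - l. of_real (a m) * w ^ m)) \<le> cmod w ^ k * (\<Sum>m. \<bar>a m\<bar>) * \<bar>u l\<bar>" .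
  qed
  finally show ?thesis by (simp add: sum_distrib_left)
qed

lemma fps_mult_innovation_nth:
  "fps_nth (B * innovation F z) k = (\<Sum>j<k. fps_nth B j * fps_nth (innovation F z) (k - j))"
  unfolding fps_mult_nth by (rule sum.mono_neutral_right) (auto simp: not_less)

section \<open>Second moments of the whitened noise and of its filtered versions\<close>

context prob_space
begin

lemma square_integrable_sum:
  fixes f :: "'i \<Rightarrow> 'a \<Rightarrow> real"
  assumes "\<And>i. i \<in> I \<Longrightarrow> f i \<in> borel_measurable M" "\<And>i. i \<in> I \<Longrightarrow> integrable M (\<lambda>\<omega>. (f i \<omega>)\<^sup>2)"
  shows "integrable M (\<lambda>\<omega>. (\<Sum>i\<in>I. c i * f i \<omega>)\<^sup>2)"
proof (rule Bochner_Integration.integrable_bound)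
  show "integrable M (\<lambda>\<omega>. (\<Sum>i\<in>I. \<bar>c i\<bar>) * (\<Sum>i\<in>I. \<bar>c i\<bar> * (f i \<omega>)\<^sup>2))"
    using assms by auto
  show "(\<lambda>\<omega>. (\<Sum>i\<in>I. c i * f i \<omega>)\<^sup>2) \<in> borel_measurable M"
    using assms(1) by measurable
  show "AE \<omega> in M. norm ((\<Sum>i\<in>I. c i * f i \<omega>)\<^sup>2) \<le> norm ((\<Sum>i\<in>I. \<bar>c i\<bar>) * (\<Sum>i\<in>I. \<bar>c i\<bar> * (f i \<omega>)\<^sup>2))"
    using weighted_Cauchy_Schwarz[of c] by (auto intro!: AE_I2 simp: sum_nonneg)
qed

lemma square_integrable_add:
  fixes f g :: "'a \<Rightarrow> real"
  assumes "f \<in> borel_measurable M" "g \<in> borel_measurable M"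
    "integrable M (\<lambda>\<omega>. (f \<omega>)\<^sup>2)" "integrable M (\<lambda>\<omega>. (g \<omega>)\<^sup>2)"
  shows "integrable M (\<lambda>\<omega>. (f \<omega> + g \<omega>)\<^sup>2)"
  using square_integrable_sum[of "UNIV :: bool set" "\<lambda>b. if b then f else g" "\<lambda>_. 1"] assms
  by (simp add: UNIV_bool add.commute)

end

text \<open>\<open>z\<close> is the noise as seen from time 1, \<open>e\<close> its true innovations
  and \<open>r\<close> the error of whitening from zero initial state. \<open>K\<close> bounds the
  energy of \<open>r\<close> summed over all times, so that \<open>r\<close> is negligible on
  average over a long block.\<close>

locale whitened_noise = prob_space M for M :: "'a measure" +
  fixes z e r :: "nat \<Rightarrow> 'a \<Rightarrow> real" and F :: "real fps" and \<sigma> K :: real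
  assumes z_measurable [measurable]: "\<And>i. i \<ge> 1 \<Longrightarrow> z i \<in> borel_measurable M"
    and z_square: "\<And>i. i \<ge> 1 \<Longrightarrow> integrable M (\<lambda>\<omega>. (z i \<omega>)\<^sup>2)"
    and z_mean: "\<And>i. i \<ge> 1 \<Longrightarrow> expectation (z i) = 0"
    and e_measurable [measurable]: "\<And>i. e i \<in> borel_measurable M"
    and e_integrable: "\<And>i j. integrable M (\<lambda>\<omega>. e i \<omega> * e j \<omega>)"
    and e_white: "\<And>i j. expectation (\<lambda>\<omega>. e i \<omega> * e j \<omega>) = (if i = j then \<sigma>\<^sup>2 else 0)"
    and r_measurable [measurable]: "\<And>i. r i \<in> borel_measurable M"
    and r_square: "\<And>i. integrable M (\<lambda>\<omega>. (r i \<omega>)\<^sup>2)"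
    and r_sum: "\<And>k. (\<Sum>i=1..k. expectation (\<lambda>\<omega>. (r i \<omega>)\<^sup>2)) \<le> K"
    and F0: "fps_nth F 0 = 1"
    and innovation_eq: "\<And>i. i \<ge> 1 \<Longrightarrow> AE \<omega> in M. fps_nth (innovation F (\<lambda>i. z i \<omega>)) i = e i \<omega> + r i \<omega>"
begin

definition filtered :: "real fps \<Rightarrow> nat \<Rightarrow> 'a \<Rightarrow> real" where
  "filtered B i \<omega> = fps_nth (B * innovation F (\<lambda>i. z i \<omega>)) i"

lemma K_nonneg: "K \<ge> 0"
  using r_sum[of 0] by simp

lemma filtered_measurable [measurable]: "filtered B i \<in> borel_measurable M"
  unfolding filtered_def[abs_def] by (rule fps_mult_innovation_measurable) (rule z_measurable)

lemma filtered_eq_z: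
  "filtered B i \<omega> = (\<Sum>j<i. fps_nth (B * inverse F) j * z (i - j) \<omega>)"
proof -
  have "filtered B i \<omega> = (\<Sum>j=0..i. fps_nth (B * inverse F) j * (if i - j = 0 then 0 else z (i - j) \<omega>))"
    unfolding filtered_def innovation_def mult.assoc[symmetric] fps_mult_nth[of "B * _"] by simp
  also have "\<dots> = (\<Sum>j<i. fps_nth (B * inverse F) j * z (i - j) \<omega>)"
    by (rule sum.mono_neutral_cong_right) auto
  finally show ?thesis .
qed

lemma filtered_square: "integrable M (\<lambda>\<omega>. (filtered B i \<omega>)\<^sup>2)"
  unfolding filtered_eq_z using z_square by (intro square_integrable_sum) auto

lemma filtered_integrable: "integrable M (filtered B i)"
  by (rule square_integrable_imp_integrable) (auto simp: filtered_square)

lemma filtered_mean: "expectation (filtered B i) = 0"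
proof -
  have "integrable M (z j)" if "j \<ge> 1" for j
    by (rule square_integrable_imp_integrable[OF z_measurable[OF that] z_square[OF that]])
  then show ?thesis
    unfolding filtered_eq_z[abs_def] using z_mean by (subst Bochner_Integration.integral_sum) auto
qed

lemma white_filtered:
  fixes c :: "nat \<Rightarrow> real"
  shows "integrable M (\<lambda>\<omega>. (\<Sum>j<i. c j * e (i - j) \<omega>)\<^sup>2)"
    and "expectation (\<lambda>\<omega>. (\<Sum>j<i. c j * e (i - j) \<omega>)\<^sup>2) = \<sigma>\<^sup>2 * (\<Sum>j<i. (c j)\<^sup>2)"
proof -
  have eq: "(\<Sum>j<i. c j * e (i - j) \<omega>)\<^sup>2 = (\<Sum>j<i. \<Sum>l<i. c j * c l * (e (i - j) \<omega> * e (i - l) \<omega>))" for \<omega>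
    by (simp add: power2_eq_square sum_product algebra_simps)
  show "integrable M (\<lambda>\<omega>. (\<Sum>j<i. c j * e (i - j) \<omega>)\<^sup>2)"
    unfolding eq using e_integrable by auto
  have "expectation (\<lambda>\<omega>. (\<Sum>j<i. c j * e (i - j) \<omega>)\<^sup>2) = (\<Sum>j<i. \<Sum>l<i. c j * c l * (if i - j = i - l then \<sigma>\<^sup>2 else 0))"
    unfolding eq using e_integrable by (simp add: Bochner_Integration.integral_sum e_white)
  also have "\<dots> = (\<Sum>j<i. \<Sum>l<i. if l = j then c j * c l * \<sigma>\<^sup>2 else 0)"
    by (intro sum.cong refl) auto
  also have "\<dots> = \<sigma>\<^sup>2 * (\<Sum>j<i. (c j)\<^sup>2)"
    by (simp add: sum_distrib_left power2_eq_square algebra_simps)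
  finally show "expectation (\<lambda>\<omega>. (\<Sum>j<i. c j * e (i - j) \<omega>)\<^sup>2) = \<sigma>\<^sup>2 * (\<Sum>j<i. (c j)\<^sup>2)" .
qed

text \<open>Cauchy-Schwarz followed by Young's inequality. The bound does not grow with
  \<open>k\<close>, so the filtered residual adds nothing to the limiting average power.\<close>

lemma residual_filtered:
  fixes c :: "nat \<Rightarrow> real"
  assumes c: "summable (\<lambda>j. \<bar>c j\<bar>)"
  shows "integrable M (\<lambda>\<omega>. (\<Sum>j<i. c j * r (i - j) \<omega>)\<^sup>2)"
    and "(\<Sum>i=1..k. expectation (\<lambda>\<omega>. (\<Sum>j<i. c j * r (i - j) \<omega>)\<^sup>2)) \<le> (\<Sum>j. \<bar>c j\<bar>)\<^sup>2 * K"
proof -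
  let ?S = "\<Sum>j. \<bar>c j\<bar>" and ?\<rho> = "\<lambda>i. expectation (\<lambda>\<omega>. (r i \<omega>)\<^sup>2)"
  have S: "?S \<ge> 0" using c by (rule suminf_nonneg) simp
  have S_le: "(\<Sum>j<i. \<bar>c j\<bar>) \<le> ?S" for i by (rule sum_le_suminf[OF c]) auto
  show int: "integrable M (\<lambda>\<omega>. (\<Sum>j<i. c j * r (i - j) \<omega>)\<^sup>2)" for i
    by (intro square_integrable_sum) (auto simp: r_square)
  have each: "expectation (\<lambda>\<omega>. (\<Sum>j<i. c j * r (i - j) \<omega>)\<^sup>2) \<le> ?S * (\<Sum>j<i. \<bar>c j\<bar> * ?\<rho> (i - j))" for i
  proof -
    have "expectation (\<lambda>\<omega>. (\<Sum>j<i. c j * r (i - j) \<omega>)\<^sup>2) \<le> expectation (\<lambda>\<omega>. ?S * (\<Sum>j<i. \<bar>c j\<bar> * (r (i - j) \<omega>)\<^sup>2))"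
    proof (rule integral_mono[OF int])
      show "integrable M (\<lambda>\<omega>. ?S * (\<Sum>j<i. \<bar>c j\<bar> * (r (i - j) \<omega>)\<^sup>2))" using r_square by auto
      fix \<omega>
      have "(\<Sum>j<i. c j * r (i - j) \<omega>)\<^sup>2 \<le> (\<Sum>j<i. \<bar>c j\<bar>) * (\<Sum>j<i. \<bar>c j\<bar> * (r (i - j) \<omega>)\<^sup>2)"
        by (rule weighted_Cauchy_Schwarz)
      also have "\<dots> \<le> ?S * (\<Sum>j<i. \<bar>c j\<bar> * (r (i - j) \<omega>)\<^sup>2)"
        by (intro mult_right_mono S_le sum_nonneg) auto
      finally show "(\<Sum>j<i. c j * r (i - j) \<omega>)\<^sup>2 \<le> ?S * (\<Sum>j<i. \<bar>c j\<bar> * (r (i - j) \<omega>)\<^sup>2)" .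
    qed
    also have "\<dots> = ?S * (\<Sum>j<i. \<bar>c j\<bar> * ?\<rho> (i - j))"
      using r_square by (simp add: Bochner_Integration.integral_sum)
    finally show ?thesis .
  qed
  have "(\<Sum>i=1..k. expectation (\<lambda>\<omega>. (\<Sum>j<i. c j * r (i - j) \<omega>)\<^sup>2)) \<le> (\<Sum>i=1..k. ?S * (\<Sum>j<i. \<bar>c j\<bar> * ?\<rho> (i - j)))"
    by (rule sum_mono) (rule each)
  also have "\<dots> = ?S * (\<Sum>i=1..k. \<Sum>j<i. \<bar>c j\<bar> * ?\<rho> (i - j))" by (simp add: sum_distrib_left)
  also have "\<dots> \<le> ?S * ((\<Sum>j<k. \<bar>c j\<bar>) * (\<Sum>l=1..k. ?\<rho> l))"
    by (intro mult_left_mono convolution_sum_le S) auto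
  also have "\<dots> \<le> ?S * (?S * K)"
    using S_le r_sum S by (intro mult_left_mono mult_mono sum_nonneg) auto
  finally show "(\<Sum>i=1..k. expectation (\<lambda>\<omega>. (\<Sum>j<i. c j * r (i - j) \<omega>)\<^sup>2)) \<le> ?S\<^sup>2 * K"
    by (simp add: power2_eq_square mult.assoc)
qed

lemma input_square: "integrable M (\<lambda>\<omega>. (V + filtered G i \<omega>)\<^sup>2)"
  using square_integrable_add[of "\<lambda>_. V" "filtered G i"] filtered_square by simp

text \<open>\<open>(a + x)\<^sup>2 \<le> (1 + t) * a\<^sup>2 + (1 + 1 / t) * x\<^sup>2\<close> puts
  the large factor on the message and the residual. Only the white part \<open>a\<close>, of power
  at most \<open>P0\<close> per step, then has a cost proportional to \<open>k\<close>.\<close>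

lemma input_power:
  fixes V :: "nat \<Rightarrow> real"
  assumes G: "summable (\<lambda>j. \<bar>fps_nth G j\<bar>)" and t: "t > 0" and G2: "\<And>i. \<sigma>\<^sup>2 * (\<Sum>j<i. (fps_nth G j)\<^sup>2) \<le> P0"
  shows "(\<Sum>i=1..k. expectation (\<lambda>\<omega>. (V i + filtered G i \<omega>)\<^sup>2))
     \<le> real k * ((1 + t) * P0) + (1 + 1 / t) * (2 * (\<Sum>i=1..k. (V i)\<^sup>2) + 2 * ((\<Sum>j. \<bar>fps_nth G j\<bar>)\<^sup>2 * K))"
proof -
  let ?a = "\<lambda>i \<omega>. \<Sum>j<i. fps_nth G j * e (i - j) \<omega>" and ?b = "\<lambda>i \<omega>. \<Sum>j<i. fps_nth G j * r (i - j) \<omega>"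
  have AE_eq: "AE \<omega> in M. filtered G i \<omega> = ?a i \<omega> + ?b i \<omega>" for i
  proof -
    have "AE \<omega> in M. \<forall>l\<in>{1..i}. fps_nth (innovation F (\<lambda>i. z i \<omega>)) l = e l \<omega> + r l \<omega>"
      using innovation_eq by (subst AE_finite_all) auto
    then show ?thesis
    proof eventually_elim
      case (elim \<omega>)
      have "filtered G i \<omega> = (\<Sum>j<i. fps_nth G j * (e (i - j) \<omega> + r (i - j) \<omega>))"
        unfolding filtered_def fps_mult_innovation_nth by (intro sum.cong refl arg_cong2[where f="(*)"]) (use elim in auto)
      then show ?case by (simp add: sum.distrib distrib_left)
    qed
  qed
  have pt: "(v + (a + b))\<^sup>2 \<le> (1 + t) * a\<^sup>2 + (1 + 1 / t) * (2 * v\<^sup>2 + 2 * b\<^sup>2)" for v a b :: real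
  proof -
    have "(1 + t) * a\<^sup>2 + (1 + 1 / t) * (v + b)\<^sup>2 - (v + (a + b))\<^sup>2 = (t * a - (v + b))\<^sup>2 / t"
      using t by (simp add: field_simps power2_eq_square)
    also have "\<dots> \<ge> 0" using t by simp
    finally have "(v + (a + b))\<^sup>2 \<le> (1 + t) * a\<^sup>2 + (1 + 1 / t) * (v + b)\<^sup>2" by simp
    also have "(v + b)\<^sup>2 \<le> 2 * v\<^sup>2 + 2 * b\<^sup>2"
      using zero_le_power2[of "v - b"] by (simp add: power2_sum power2_diff)
    finally show ?thesis using t by (simp add: mult_left_mono)
  qed
  have "expectation (\<lambda>\<omega>. (V i + filtered G i \<omega>)\<^sup>2)
     \<le> (1 + t) * P0 + (1 + 1 / t) * (2 * (V i)\<^sup>2 + 2 * expectation (\<lambda>\<omega>. (?b i \<omega>)\<^sup>2))" for i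
  proof -
    have ib: "integrable M (\<lambda>\<omega>. (?b i \<omega>)\<^sup>2)" using residual_filtered(1)[OF G] .
    have "expectation (\<lambda>\<omega>. (V i + filtered G i \<omega>)\<^sup>2)
       \<le> expectation (\<lambda>\<omega>. (1 + t) * (?a i \<omega>)\<^sup>2 + (1 + 1 / t) * (2 * (V i)\<^sup>2 + 2 * (?b i \<omega>)\<^sup>2))"
    proof (rule integral_mono_AE[OF input_square])
      show "integrable M (\<lambda>\<omega>. (1 + t) * (?a i \<omega>)\<^sup>2 + (1 + 1 / t) * (2 * (V i)\<^sup>2 + 2 * (?b i \<omega>)\<^sup>2))"
        using white_filtered(1) ib by auto
      show "AE \<omega> in M. (V i + filtered G i \<omega>)\<^sup>2 \<le> (1 + t) * (?a i \<omega>)\<^sup>2 + (1 + 1 / t) * (2 * (V i)\<^sup>2 + 2 * (?b i \<omega>)\<^sup>2)"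
        using AE_eq[of i] by eventually_elim (simp only: pt)
    qed
    also have "\<dots> = (1 + t) * (\<sigma>\<^sup>2 * (\<Sum>j<i. (fps_nth G j)\<^sup>2)) + (1 + 1 / t) * (2 * (V i)\<^sup>2 + 2 * expectation (\<lambda>\<omega>. (?b i \<omega>)\<^sup>2))"
      using white_filtered[of "fps_nth G" i] ib by (simp add: prob_space)
    also have "\<dots> \<le> (1 + t) * P0 + (1 + 1 / t) * (2 * (V i)\<^sup>2 + 2 * expectation (\<lambda>\<omega>. (?b i \<omega>)\<^sup>2))"
      using G2[of i] t by (intro add_right_mono mult_left_mono) auto
    finally show ?thesis .
  qed
  then have "(\<Sum>i=1..k. expectation (\<lambda>\<omega>. (V i + filtered G i \<omega>)\<^sup>2))
     \<le> (\<Sum>i=1..k. (1 + t) * P0 + (1 + 1 / t) * (2 * (V i)\<^sup>2 + 2 * expectation (\<lambda>\<omega>. (?b i \<omega>)\<^sup>2)))"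
    by (rule sum_mono)
  also have "\<dots> = real k * ((1 + t) * P0) + (1 + 1 / t) * (2 * (\<Sum>i=1..k. (V i)\<^sup>2) + 2 * (\<Sum>i=1..k. expectation (\<lambda>\<omega>. (?b i \<omega>)\<^sup>2)))"
    by (simp add: sum.distrib sum_distrib_left distrib_left)
  also have "\<dots> \<le> real k * ((1 + t) * P0) + (1 + 1 / t) * (2 * (\<Sum>i=1..k. (V i)\<^sup>2) + 2 * ((\<Sum>j. \<bar>fps_nth G j\<bar>)\<^sup>2 * K))"
    using residual_filtered(2)[OF G, of k] t by (intro add_left_mono mult_left_mono) auto
  finally show ?thesis .
qed

text \<open>\<open>cmod_filtered_sum_le\<close> bounds the error pointwise by
  \<open>cmod w ^ k\<close> times the absolute sum of the whitened noise. Of the two factors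
  \<open>k\<close> in the square, one comes from Cauchy-Schwarz over \<open>k\<close> terms, the
  other from adding \<open>k\<close> second moments.\<close>

lemma decoding_error:
  fixes w :: complex
  assumes H: "summable (\<lambda>m. \<bar>fps_nth H m\<bar>)" and w: "cmod w \<le> 1" and zero: "(\<lambda>m. of_real (fps_nth H m) * w ^ m) sums 0"
  shows "integrable M (\<lambda>\<omega>. (cmod (\<Sum>i=1..k. of_real (filtered H i \<omega>) * w ^ i))\<^sup>2)"
    and "expectation (\<lambda>\<omega>. (cmod (\<Sum>i=1..k. of_real (filtered H i \<omega>) * w ^ i))\<^sup>2)
           \<le> (\<Sum>m. \<bar>fps_nth H m\<bar>)\<^sup>2 * (2 * \<sigma>\<^sup>2 + 2 * K) * (real k * cmod w ^ k)\<^sup>2"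
proof -
  \<comment> \<open>\<open>filtered 1\<close> is the whitened noise itself, almost surely
    \<open>e + r\<close>.\<close>
  let ?S = "\<Sum>m. \<bar>fps_nth H m\<bar>" and ?u = "\<lambda>i \<omega>. filtered 1 i \<omega>"
  let ?E = "\<lambda>\<omega>. (cmod (\<Sum>i=1..k. of_real (filtered H i \<omega>) * w ^ i))\<^sup>2"
  have le: "?E \<omega> \<le> (cmod w ^ k * ?S)\<^sup>2 * (real k * (\<Sum>l=1..k. (?u l \<omega>)\<^sup>2))" for \<omega>
  proof -
    have "cmod (\<Sum>i=1..k. of_real (filtered H i \<omega>) * w ^ i) \<le> cmod w ^ k * ?S * (\<Sum>l=1..k. \<bar>?u l \<omega>\<bar>)"
      using cmod_filtered_sum_le[OF assms, of "\<lambda>i. ?u i \<omega>" k] unfolding filtered_def[of H] fps_mult_innovation_nth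
      by (simp add: filtered_def)
    then have "?E \<omega> \<le> (cmod w ^ k * ?S * (\<Sum>l=1..k. \<bar>?u l \<omega>\<bar>))\<^sup>2"
      by (rule power_mono) simp
    also have "\<dots> = (cmod w ^ k * ?S)\<^sup>2 * (\<Sum>l=1..k. \<bar>?u l \<omega>\<bar>)\<^sup>2" by (rule power_mult_distrib)
    also have "(\<Sum>l=1..k. \<bar>?u l \<omega>\<bar>)\<^sup>2 \<le> real k * (\<Sum>l=1..k. (?u l \<omega>)\<^sup>2)"
      using power2_sum_le_card[of "\<lambda>l. \<bar>?u l \<omega>\<bar>" "{1..k}"] by simp
    finally show ?thesis by (simp add: mult_left_mono)
  qed
  have int: "integrable M (\<lambda>\<omega>. (cmod w ^ k * ?S)\<^sup>2 * (real k * (\<Sum>l=1..k. (?u l \<omega>)\<^sup>2)))"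
    using filtered_square by auto
  show I: "integrable M ?E"
  proof (rule Bochner_Integration.integrable_bound[OF int])
    show "?E \<in> borel_measurable M" by measurable
    show "AE \<omega> in M. norm (?E \<omega>) \<le> norm ((cmod w ^ k * ?S)\<^sup>2 * (real k * (\<Sum>l=1..k. (?u l \<omega>)\<^sup>2)))"
      using le by (intro AE_I2) (auto simp: abs_of_nonneg sum_nonneg intro!: order_trans[OF le])
  qed
  have u_le: "expectation (\<lambda>\<omega>. (?u l \<omega>)\<^sup>2) \<le> 2 * \<sigma>\<^sup>2 + 2 * expectation (\<lambda>\<omega>. (r l \<omega>)\<^sup>2)" if "l \<ge> 1" for l
  proof -
    have e2: "integrable M (\<lambda>\<omega>. (e l \<omega>)\<^sup>2)" "expectation (\<lambda>\<omega>. (e l \<omega>)\<^sup>2) = \<sigma>\<^sup>2"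
      using e_integrable[of l l] e_white[of l l] by (simp_all add: power2_eq_square)
    have "expectation (\<lambda>\<omega>. (?u l \<omega>)\<^sup>2) \<le> expectation (\<lambda>\<omega>. 2 * (e l \<omega>)\<^sup>2 + 2 * (r l \<omega>)\<^sup>2)"
    proof (rule integral_mono_AE[OF filtered_square])
      show "integrable M (\<lambda>\<omega>. 2 * (e l \<omega>)\<^sup>2 + 2 * (r l \<omega>)\<^sup>2)" using e2 r_square by auto
      show "AE \<omega> in M. (?u l \<omega>)\<^sup>2 \<le> 2 * (e l \<omega>)\<^sup>2 + 2 * (r l \<omega>)\<^sup>2"
        using innovation_eq[OF that]
      proof eventually_elim
        case (elim \<omega>)
        show ?case unfolding filtered_def using elim zero_le_power2[of "e l \<omega> - r l \<omega>"]
          by (simp add: power2_sum power2_diff)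
      qed
    qed
    also have "\<dots> = 2 * \<sigma>\<^sup>2 + 2 * expectation (\<lambda>\<omega>. (r l \<omega>)\<^sup>2)" using e2 r_square by simp
    finally show ?thesis .
  qed
  have "(\<Sum>l=1..k. expectation (\<lambda>\<omega>. (?u l \<omega>)\<^sup>2)) \<le> (\<Sum>l=1..k. 2 * \<sigma>\<^sup>2 + 2 * expectation (\<lambda>\<omega>. (r l \<omega>)\<^sup>2))"
    by (rule sum_mono) (rule u_le, simp)
  also have "\<dots> \<le> real k * (2 * \<sigma>\<^sup>2) + 2 * K"
    using r_sum[of k] by (simp add: sum.distrib sum_distrib_left[symmetric])
  also have "real k * (real k * (2 * \<sigma>\<^sup>2) + 2 * K) \<le> (2 * \<sigma>\<^sup>2 + 2 * K) * (real k)\<^sup>2"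
  proof -
    have "real k \<le> (real k)\<^sup>2"
      by (cases k) (auto simp: power2_eq_square)
    then have "real k * K \<le> (real k)\<^sup>2 * K"
      using K_nonneg by (rule mult_right_mono)
    then show ?thesis by (simp add: algebra_simps power2_eq_square)
  qed
  finally have u_sum: "real k * (\<Sum>l=1..k. expectation (\<lambda>\<omega>. (?u l \<omega>)\<^sup>2)) \<le> (2 * \<sigma>\<^sup>2 + 2 * K) * (real k)\<^sup>2"
    by (simp add: mult_left_mono)
  have "expectation ?E \<le> expectation (\<lambda>\<omega>. (cmod w ^ k * ?S)\<^sup>2 * (real k * (\<Sum>l=1..k. (?u l \<omega>)\<^sup>2)))"
    by (rule integral_mono[OF I int le])
  also have "\<dots> = (cmod w ^ k * ?S)\<^sup>2 * (real k * (\<Sum>l=1..k. expectation (\<lambda>\<omega>. (?u l \<omega>)\<^sup>2)))"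
    using filtered_square by (simp add: Bochner_Integration.integral_sum)
  also have "\<dots> \<le> (cmod w ^ k * ?S)\<^sup>2 * ((2 * \<sigma>\<^sup>2 + 2 * K) * (real k)\<^sup>2)"
    using u_sum by (intro mult_left_mono) auto
  finally show "expectation ?E \<le> ?S\<^sup>2 * (2 * \<sigma>\<^sup>2 + 2 * K) * (real k * cmod w ^ k)\<^sup>2"
    by (simp add: power_mult_distrib algebra_simps)
qed

end

lemma borel_measurable_finite_support:
  fixes h :: "real \<Rightarrow> real"
  assumes "finite A"
  shows "(\<lambda>m. if m \<in> A then h m else 0) \<in> borel_measurable borel"
proof -
  have "(\<lambda>m. if m \<in> A then h m else 0) = (\<lambda>m. \<Sum>a\<in>A. h a * indicator {a} m)"
  proof
    fix m show "(if m \<in> A then h m else 0) = (\<Sum>a\<in>A. h a * indicator {a} m)"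
      using assms by (auto simp: indicator_def if_distrib[of "\<lambda>x. _ * x"] cong: if_cong)
  qed
  then show ?thesis by simp
qed

text \<open>The message only labels a codeword, but \<open>admissible_code\<close> asks for a real
  message of mean 0.\<close>

lemma centered_set_exists: "\<exists>A :: real set. finite A \<and> card A = c \<and> (\<Sum>a\<in>A. a) = 0"
proof (intro exI conjI)
  let ?h = "\<lambda>j. real j - (real c - 1) / 2"
  have inj: "inj_on ?h {..<c}" by (auto simp: inj_on_def)
  show "finite (?h ` {..<c})" by simp
  show "card (?h ` {..<c}) = c" using inj by (simp add: card_image)
  have "(\<Sum>j<c. real j) = real c * (real c - 1) / 2"
    by (induction c) (auto simp: field_simps)
  then show "(\<Sum>a\<in>?h ` {..<c}. a) = 0"
    using inj by (simp add: sum.reindex sum_subtractf)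
qed

section \<open>The code and its rate\<close>

context whitened_noise
begin

text \<open>The message selects one of \<open>N w\<close> levels in \<open>[-1, 1]\<close> for every
  \<open>w \<in> W\<close>, sent along the signals \<open>L\<close>. Evaluating the outputs at
  \<open>w\<close> returns the level plus a decoding error. The information is therefore at least
  the number of bits in the grid, less the constant of \<open>sum_PiE_powr_le\<close> and less the
  mean squared error in units of the grid spacing.\<close>

lemma block_capacity_ge:
  fixes N :: "complex \<Rightarrow> nat" and L :: "complex \<Rightarrow> nat \<Rightarrow> real"
  assumes G0: "fps_nth G 0 = 0" and G: "summable (\<lambda>j. \<bar>fps_nth G j\<bar>)"
    and t: "t > 0" and G2: "\<And>i. \<sigma>\<^sup>2 * (\<Sum>j<i. (fps_nth G j)\<^sup>2) \<le> P0"
    and H: "summable (\<lambda>j. \<bar>fps_nth (F + G) j\<bar>)"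
    and W: "finite W" "\<And>w. w \<in> W \<Longrightarrow> cmod w \<le> 1"
      "\<And>w. w \<in> W \<Longrightarrow> (\<lambda>m. of_real (fps_nth (F + G) m) * w ^ m) sums 0"
    and L: "\<And>v i. i > n \<Longrightarrow> L v i = 0"
      "\<And>v w k. v \<in> W \<Longrightarrow> w \<in> W \<Longrightarrow> k \<ge> n \<Longrightarrow>
        real_coord w (\<Sum>i=1..k. of_real (L v i) * w ^ i) = (if v = w then 1 else 0)"
    and k: "k \<ge> n" "k \<ge> 1" and N: "\<And>w. w \<in> W \<Longrightarrow> N w \<ge> 1"
    and power: "real k * ((1 + t) * P0) + (1 + 1 / t) * (2 * (\<Sum>i\<le>n. (\<Sum>v\<in>W. \<bar>L v i\<bar>)\<^sup>2) + 2 * ((\<Sum>j. \<bar>fps_nth G j\<bar>)\<^sup>2 * K)) \<le> real k * P"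
  defines "c3 \<equiv> (\<Sum>m. \<bar>fps_nth (F + G) m\<bar>)\<^sup>2 * (2 * \<sigma>\<^sup>2 + 2 * K)"
  shows "block_capacity M z P k \<ge> ereal (((\<Sum>w\<in>W. log 2 (N w)) - card W * log 2 22
           - (\<Sum>w\<in>W. (real (N w) / 2)\<^sup>2 * (c3 * (real k * cmod w ^ k)\<^sup>2))) / real k)"
proof -
  define TT where "TT = Pi\<^sub>E W (\<lambda>w. {..<N w})"
  define c where "c = card TT"
  have finTT: "finite TT" unfolding TT_def using W by (intro finite_PiE) auto
  have c_eq: "c = (\<Prod>w\<in>W. N w)" unfolding c_def TT_def using W by (simp add: card_PiE)
  have c1: "c > 0" unfolding c_eq using N W by (auto simp: Suc_le_eq intro!: prod_pos)
  obtain A :: "real set" where A: "finite A" "card A = c" "(\<Sum>a\<in>A. a) = 0"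
    using centered_set_exists by blast
  have A0: "A \<noteq> {}" using A c1 by auto
  obtain \<beta> where \<beta>: "bij_betw \<beta> A TT"
    using finite_same_card_bij[OF A(1) finTT] A c_def by blast
  have \<beta>_in: "\<beta> a w < N w" if "a \<in> A" "w \<in> W" for a w
    using bij_betwE[OF \<beta>] that by (auto simp: TT_def PiE_iff)
  \<comment> \<open>Levels of spacing \<open>2 / N w\<close>, symmetric about 0 and bounded by 1, so
    that the energy of the message signal is bounded independently of the number of levels.\<close>
  define \<theta> where "\<theta> a w = (2 * real (\<beta> a w) - (real (N w) - 1)) / real (N w)" for a w
  have \<theta>_le: "\<bar>\<theta> a w\<bar> \<le> 1" if "a \<in> A" "w \<in> W" for a w
  proof -
    have "real (\<beta> a w) \<le> real (N w) - 1" using \<beta>_in[OF that] by linarith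
    then have "\<bar>2 * real (\<beta> a w) - (real (N w) - 1)\<bar> \<le> real (N w)" by (simp add: abs_le_iff)
    then show ?thesis using N[OF that(2)] by (simp add: \<theta>_def)
  qed
  have \<theta>_sum: "(\<Sum>a\<in>A. \<theta> a w) = 0" if "w \<in> W" for w
  proof -
    have "(\<Sum>a\<in>A. \<theta> a w) = (\<Sum>g\<in>TT. (2 * real (g w) - (real (N w) - 1)) / real (N w))"
      unfolding \<theta>_def by (rule sum.reindex_bij_betw[OF \<beta>, of "\<lambda>g. (2 * real (g w) - (real (N w) - 1)) / real (N w)"])
    also have "\<dots> = 0" unfolding TT_def using W that by (intro sum_centered_grid_PiE)
    finally show ?thesis .
  qed
  define V where "V m i = (if m \<in> A then (\<Sum>v\<in>W. \<theta> m v * L v i) else 0)" for m i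
  have V_meas [measurable]: "(\<lambda>m. V m i) \<in> borel_measurable borel" for i
    unfolding V_def using A by (intro borel_measurable_finite_support)
  have V_sum: "(\<Sum>a\<in>A. V a i) = 0" for i
  proof -
    have "(\<Sum>a\<in>A. V a i) = (\<Sum>a\<in>A. \<Sum>v\<in>W. \<theta> a v * L v i)" by (simp add: V_def)
    also have "\<dots> = (\<Sum>v\<in>W. (\<Sum>a\<in>A. \<theta> a v) * L v i)"
      by (subst sum.swap) (simp add: sum_distrib_right)
    also have "\<dots> = 0" by (simp add: \<theta>_sum)
    finally show ?thesis .
  qed
  have V_sq: "(\<Sum>i=1..k. (V a i)\<^sup>2) \<le> (\<Sum>i\<le>n. (\<Sum>v\<in>W. \<bar>L v i\<bar>)\<^sup>2)" if a: "a \<in> A" for a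
  proof -
    have "(\<Sum>i=1..k. (V a i)\<^sup>2) = (\<Sum>i=1..n. (V a i)\<^sup>2)"
      using k by (intro sum.mono_neutral_right) (auto simp: V_def L)
    also have "\<dots> \<le> (\<Sum>i\<le>n. (V a i)\<^sup>2)" by (intro sum_mono2) auto
    also have "\<dots> \<le> (\<Sum>i\<le>n. (\<Sum>v\<in>W. \<bar>L v i\<bar>)\<^sup>2)"
    proof (rule sum_mono)
      fix i
      have "\<bar>V a i\<bar> \<le> (\<Sum>v\<in>W. \<bar>\<theta> a v * L v i\<bar>)" using a by (simp add: V_def)
      also have "\<dots> \<le> (\<Sum>v\<in>W. \<bar>L v i\<bar>)"
        using \<theta>_le[OF a] by (intro sum_mono) (auto simp: abs_mult mult_left_le_one_le)
      finally show "(V a i)\<^sup>2 \<le> (\<Sum>v\<in>W. \<bar>L v i\<bar>)\<^sup>2"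
        by (metis abs_ge_zero power2_abs power_mono)
    qed
    finally show ?thesis .
  qed
  define x where "x = feedback_encoder V (G * inverse (F + G))"
  have in_eq: "input_rv x z i (m, \<omega>) = V m i + filtered G i \<omega>" if "i \<ge> 1" for i m \<omega>
    using feedback_encoder_output(2)[OF F0 G0 that] by (simp add: input_rv_def x_def filtered_def)
  have out_eq: "output_rv x z i (m, \<omega>) = V m i + filtered (F + G) i \<omega>" if "i \<ge> 1" for i m \<omega>
    using feedback_encoder_output(1)[OF F0 G0 that] by (simp add: output_rv_def x_def filtered_def)
  have in_meas [measurable]: "input_rv x z i \<in> borel_measurable (uniform_message A \<Otimes>\<^sub>M M)" if "i \<ge> 1" for i
  proof -
    have "input_rv x z i = (\<lambda>s. V (fst s) i + filtered G i (snd s))"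
      using in_eq[OF that] by (auto simp: fun_eq_iff)
    then show ?thesis by simp
  qed
  have out_meas [measurable]: "output_rv x z i \<in> borel_measurable (uniform_message A \<Otimes>\<^sub>M M)" if "i \<ge> 1" for i
  proof -
    have "output_rv x z i = (\<lambda>s. V (fst s) i + filtered (F + G) i (snd s))"
      using out_eq[OF that] by (auto simp: fun_eq_iff)
    then show ?thesis by simp
  qed
  have adm: "admissible_code M z P k (uniform_message A) x"
    unfolding admissible_code_def
  proof (intro conjI ballI)
    show "prob_space (uniform_message A)" by (rule prob_space_uniform_message)
    show "sets (uniform_message A) = sets borel" by simp
    show "integrable (uniform_message A) (\<lambda>m. m)" "(\<integral>m. m \<partial>uniform_message A) = 0"
      using uniform_message_integral[OF A(1) A0] A by simp_all
    show "x i \<in> borel_measurable (borel \<Otimes>\<^sub>M Pi\<^sub>M {1..<i} (\<lambda>_. borel))" for i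
      unfolding x_def by (rule feedback_encoder_measurable) simp
    have sq: "integrable (uniform_message A \<Otimes>\<^sub>M M) (\<lambda>s. (input_rv x z i s)\<^sup>2)"
      "(\<integral>s. (input_rv x z i s)\<^sup>2 \<partial>(uniform_message A \<Otimes>\<^sub>M M)) = (\<Sum>a\<in>A. expectation (\<lambda>\<omega>. (V a i + filtered G i \<omega>)\<^sup>2)) / c"
      if "i \<in> {1..k}" for i
    proof -
      have i: "i \<ge> 1" using that by simp
      have meas: "(\<lambda>s. (input_rv x z i s)\<^sup>2) \<in> borel_measurable (uniform_message A \<Otimes>\<^sub>M M)"
        by (intro borel_measurable_power in_meas i)
      have int: "integrable M (\<lambda>\<omega>. (input_rv x z i (a, \<omega>))\<^sup>2)" for a
        unfolding in_eq[OF i] by (rule input_square)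
      show "integrable (uniform_message A \<Otimes>\<^sub>M M) (\<lambda>s. (input_rv x z i s)\<^sup>2)"
        by (rule uniform_message_pair(1)[OF A(1) A0 prob_space_axioms meas int])
      show "(\<integral>s. (input_rv x z i s)\<^sup>2 \<partial>(uniform_message A \<Otimes>\<^sub>M M)) = (\<Sum>a\<in>A. expectation (\<lambda>\<omega>. (V a i + filtered G i \<omega>)\<^sup>2)) / c"
        unfolding uniform_message_pair(2)[OF A(1) A0 prob_space_axioms meas int] in_eq[OF i] A(2) ..
    qed
    then show "integrable (uniform_message A \<Otimes>\<^sub>M M) (\<lambda>s. (input_rv x z i s)\<^sup>2)" if "i \<in> {1..k}" for i
      using that by blast
    show "(\<integral>s. input_rv x z i s \<partial>(uniform_message A \<Otimes>\<^sub>M M)) = 0" if "i \<in> {1..k}" for i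
    proof -
      have "(\<integral>s. input_rv x z i s \<partial>(uniform_message A \<Otimes>\<^sub>M M)) = (\<Sum>a\<in>A. expectation (\<lambda>\<omega>. V a i + filtered G i \<omega>)) / c"
      proof -
        have i: "i \<ge> 1" using that by simp
        have int: "integrable M (\<lambda>\<omega>. input_rv x z i (a, \<omega>))" for a
          unfolding in_eq[OF i] using filtered_integrable by simp
        show ?thesis
          unfolding uniform_message_pair(2)[OF A(1) A0 prob_space_axioms in_meas[OF i] int] in_eq[OF i] A(2) ..
      qed
      also have "(\<Sum>a\<in>A. expectation (\<lambda>\<omega>. V a i + filtered G i \<omega>)) = (\<Sum>a\<in>A. V a i)"
        using filtered_integrable filtered_mean by (simp add: prob_space)
      finally show ?thesis by (simp add: V_sum)
    qed
    have "(\<Sum>i=1..k. \<integral>s. (input_rv x z i s)\<^sup>2 \<partial>(uniform_message A \<Otimes>\<^sub>M M))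
        = (\<Sum>i=1..k. (\<Sum>a\<in>A. expectation (\<lambda>\<omega>. (V a i + filtered G i \<omega>)\<^sup>2)) / c)"
      by (intro sum.cong refl sq)
    also have "\<dots> = (\<Sum>a\<in>A. \<Sum>i=1..k. expectation (\<lambda>\<omega>. (V a i + filtered G i \<omega>)\<^sup>2)) / c"
      by (subst sum.swap) (simp add: sum_divide_distrib[symmetric])
    also have "\<dots> \<le> (\<Sum>a\<in>A. real k * P) / c"
    proof (intro divide_right_mono sum_mono)
      fix a assume a: "a \<in> A"
      have "(\<Sum>i=1..k. expectation (\<lambda>\<omega>. (V a i + filtered G i \<omega>)\<^sup>2)) \<le> real k * ((1 + t) * P0) + (1 + 1 / t) * (2 * (\<Sum>i=1..k. (V a i)\<^sup>2) + 2 * ((\<Sum>j. \<bar>fps_nth G j\<bar>)\<^sup>2 * K))"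
        by (rule input_power[OF G t G2])
      also have "\<dots> \<le> real k * ((1 + t) * P0) + (1 + 1 / t) * (2 * (\<Sum>i\<le>n. (\<Sum>v\<in>W. \<bar>L v i\<bar>)\<^sup>2) + 2 * ((\<Sum>j. \<bar>fps_nth G j\<bar>)\<^sup>2 * K))"
        using V_sq[OF a] t by (intro add_left_mono mult_left_mono add_mono) auto
      also have "\<dots> \<le> real k * P" by (rule power)
      finally show "(\<Sum>i=1..k. expectation (\<lambda>\<omega>. (V a i + filtered G i \<omega>)\<^sup>2)) \<le> real k * P" .
    qed simp
    also have "\<dots> = real k * P" using A c1 by simp
    finally show "(\<Sum>i=1..k. \<integral>s. (input_rv x z i s)\<^sup>2 \<partial>(uniform_message A \<Otimes>\<^sub>M M)) / real k \<le> P"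
      using k by (simp add: divide_le_eq mult.commute)
  qed
  define Y where "Y = (\<lambda>s. \<lambda>i\<in>{1..k}. output_rv x z i s)"
  have Y_meas: "Y \<in> measurable (uniform_message A \<Otimes>\<^sub>M M) (Pi\<^sub>M {1..k} (\<lambda>_. borel))"
    unfolding Y_def by (rule measurable_restrict) (use out_meas in auto)
  \<comment> \<open>The affine inverse of \<open>\<theta>\<close>: it turns a decoded level back
    into a grid coordinate and multiplies the error by \<open>N w / 2\<close>.\<close>
  define est where "est w y = (real_coord w (\<Sum>i=1..k. of_real (y i) * w ^ i) * real (N w) + (real (N w) - 1)) / 2" for w and y :: "nat \<Rightarrow> real"
  \<comment> \<open>The squared distance on the grid; by \<open>sum_PiE_powr_le\<close> the weights
    \<open>2 powr (- d a y)\<close> have a bounded total whatever the output \<open>y\<close>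
    is.\<close>
  define d where "d a y = (\<Sum>w\<in>W. (est w y - real (\<beta> a w))\<^sup>2)" for a y
  let ?err = "\<lambda>w \<omega>. \<Sum>i=1..k. of_real (filtered (F + G) i \<omega>) * w ^ i"
  have d_eq: "d a (Y (a, \<omega>)) = (\<Sum>w\<in>W. (real (N w) / 2 * real_coord w (?err w \<omega>))\<^sup>2)" if a: "a \<in> A" for a \<omega>
    unfolding d_def
  proof (intro sum.cong refl arg_cong[where f = "\<lambda>x. x\<^sup>2"])
    fix w assume w: "w \<in> W"
    have "(\<Sum>i=1..k. of_real (Y (a, \<omega>) i) * w ^ i) = (\<Sum>i=1..k. \<Sum>v\<in>W. of_real (\<theta> a v) * (of_real (L v i) * w ^ i)) + ?err w \<omega>"
      unfolding sum.distrib[symmetric]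
      by (intro sum.cong refl) (simp add: Y_def out_eq V_def a sum_distrib_right distrib_right mult.assoc)
    also have "(\<Sum>i=1..k. \<Sum>v\<in>W. of_real (\<theta> a v) * (of_real (L v i) * w ^ i)) = (\<Sum>v\<in>W. of_real (\<theta> a v) * (\<Sum>i=1..k. of_real (L v i) * w ^ i))"
      by (subst sum.swap) (simp add: sum_distrib_left)
    finally have "real_coord w (\<Sum>i=1..k. of_real (Y (a, \<omega>) i) * w ^ i) = (\<Sum>v\<in>W. \<theta> a v * (if v = w then 1 else 0)) + real_coord w (?err w \<omega>)"
      using L(2)[OF _ w k(1)] by (simp add: real_coord_simps real_coord_sum)
    also have "(\<Sum>v\<in>W. \<theta> a v * (if v = w then 1 else 0)) = \<theta> a w"
      using W w by (simp add: if_distrib[of "\<lambda>x. _ * x"] cong: if_cong)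
    finally show "est w (Y (a, \<omega>)) - real (\<beta> a w) = real (N w) / 2 * real_coord w (?err w \<omega>)"
      using N[OF w] by (simp add: est_def \<theta>_def field_simps)
  qed
  have term_int: "integrable M (\<lambda>\<omega>. (real (N w) / 2 * real_coord w (?err w \<omega>))\<^sup>2)"
    and term_le: "expectation (\<lambda>\<omega>. (real (N w) / 2 * real_coord w (?err w \<omega>))\<^sup>2) \<le> (real (N w) / 2)\<^sup>2 * (c3 * (real k * cmod w ^ k)\<^sup>2)"
    if w: "w \<in> W" for w
  proof -
    note err = decoding_error[OF H W(2,3)[OF w], of k]
    have le: "(real (N w) / 2 * real_coord w (?err w \<omega>))\<^sup>2 \<le> (real (N w) / 2)\<^sup>2 * (cmod (?err w \<omega>))\<^sup>2" for \<omega>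
    proof -
      have "(real_coord w (?err w \<omega>))\<^sup>2 \<le> (cmod (?err w \<omega>))\<^sup>2"
        using power_mono[OF abs_real_coord_le abs_ge_zero, of w "?err w \<omega>" 2] by simp
      then show ?thesis unfolding power_mult_distrib by (rule mult_left_mono) simp
    qed
    show int: "integrable M (\<lambda>\<omega>. (real (N w) / 2 * real_coord w (?err w \<omega>))\<^sup>2)"
    proof (rule Bochner_Integration.integrable_bound)
      show "integrable M (\<lambda>\<omega>. (real (N w) / 2)\<^sup>2 * (cmod (?err w \<omega>))\<^sup>2)" using err(1) by simp
      show "(\<lambda>\<omega>. (real (N w) / 2 * real_coord w (?err w \<omega>))\<^sup>2) \<in> borel_measurable M" by measurable
      show "AE \<omega> in M. norm ((real (N w) / 2 * real_coord w (?err w \<omega>))\<^sup>2) \<le> norm ((real (N w) / 2)\<^sup>2 * (cmod (?err w \<omega>))\<^sup>2)"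
        using le by (intro AE_I2) (simp add: abs_mult)
    qed
    have "expectation (\<lambda>\<omega>. (real (N w) / 2 * real_coord w (?err w \<omega>))\<^sup>2) \<le> expectation (\<lambda>\<omega>. (real (N w) / 2)\<^sup>2 * (cmod (?err w \<omega>))\<^sup>2)"
      using int err(1) le by (intro integral_mono) auto
    also have "\<dots> = (real (N w) / 2)\<^sup>2 * expectation (\<lambda>\<omega>. (cmod (?err w \<omega>))\<^sup>2)" by simp
    also have "\<dots> \<le> (real (N w) / 2)\<^sup>2 * (c3 * (real k * cmod w ^ k)\<^sup>2)"
      unfolding c3_def by (intro mult_left_mono err(2)) simp
    finally show "expectation (\<lambda>\<omega>. (real (N w) / 2 * real_coord w (?err w \<omega>))\<^sup>2) \<le> (real (N w) / 2)\<^sup>2 * (c3 * (real k * cmod w ^ k)\<^sup>2)" .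
  qed
  have info: "log 2 (card A) - log 2 (22 ^ card W) - (\<Sum>a\<in>A. expectation (\<lambda>\<omega>. d a (Y (a, \<omega>)))) / card A
       \<le> code_information M z k (uniform_message A) x"
    unfolding code_information_def Y_def[symmetric]
  proof (rule mutual_information_uniform_message_ge[OF A(1) A0 prob_space_axioms Y_meas])
    show "d a \<in> borel_measurable (Pi\<^sub>M {1..k} (\<lambda>_. borel))" for a
    proof -
      have [measurable]: "(\<lambda>y. y i) \<in> borel_measurable (Pi\<^sub>M {1..k} (\<lambda>_. borel))" if "i \<in> {1..k}" for i
        using that by (rule measurable_component_singleton)
      show ?thesis unfolding d_def est_def by measurable
    qed
    show "(22::real) ^ card W > 0" by simp
    show "(\<Sum>a\<in>A. 2 powr (- d a y)) \<le> 22 ^ card W" for y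
    proof -
      have "(\<Sum>a\<in>A. 2 powr (- d a y)) = (\<Sum>g\<in>TT. 2 powr (- (\<Sum>w\<in>W. (est w y - real (g w))\<^sup>2)))"
        unfolding d_def by (rule sum.reindex_bij_betw[OF \<beta>, of "\<lambda>g. 2 powr (- (\<Sum>w\<in>W. (est w y - real (g w))\<^sup>2))"])
      also have "\<dots> \<le> 22 ^ card W" unfolding TT_def by (rule sum_PiE_powr_le[OF W(1)])
      finally show ?thesis .
    qed
    show "integrable M (\<lambda>\<omega>. d a (Y (a, \<omega>)))" if "a \<in> A" for a
      unfolding d_eq[OF that] using term_int by auto
  qed
  let ?D = "\<Sum>w\<in>W. (real (N w) / 2)\<^sup>2 * (c3 * (real k * cmod w ^ k)\<^sup>2)"
  have "(\<Sum>a\<in>A. expectation (\<lambda>\<omega>. d a (Y (a, \<omega>)))) / card A \<le> (\<Sum>a\<in>A. ?D) / card A"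
  proof (intro divide_right_mono sum_mono)
    fix a assume "a \<in> A"
    have "expectation (\<lambda>\<omega>. d a (Y (a, \<omega>))) = (\<Sum>w\<in>W. expectation (\<lambda>\<omega>. (real (N w) / 2 * real_coord w (?err w \<omega>))\<^sup>2))"
      unfolding d_eq[OF \<open>a \<in> A\<close>] using term_int by (rule Bochner_Integration.integral_sum)
    also have "\<dots> \<le> ?D" by (intro sum_mono term_le)
    finally show "expectation (\<lambda>\<omega>. d a (Y (a, \<omega>))) \<le> ?D" .
  qed simp
  also have "\<dots> = ?D" using A c1 by simp
  finally have D_le: "(\<Sum>a\<in>A. expectation (\<lambda>\<omega>. d a (Y (a, \<omega>)))) / card A \<le> ?D" .
  have "log 2 (card A) = (\<Sum>w\<in>W. log 2 (N w))"
  proof -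
    have "log 2 (card A) = ln (\<Prod>w\<in>W. real (N w)) / ln 2" by (simp add: A c_eq log_def)
    also have "ln (\<Prod>w\<in>W. real (N w)) = (\<Sum>w\<in>W. ln (real (N w)))"
      using W N by (intro ln_prod) (auto simp: Suc_le_eq)
    finally show ?thesis by (simp add: log_def sum_divide_distrib)
  qed
  moreover have "log 2 (22 ^ card W) = card W * log 2 22" by (simp add: log_nat_power)
  ultimately have "(\<Sum>w\<in>W. log 2 (N w)) - card W * log 2 22 - ?D \<le> code_information M z k (uniform_message A) x"
    using info D_le by linarith
  then have rate: "((\<Sum>w\<in>W. log 2 (N w)) - card W * log 2 22 - ?D) / real k \<le> code_information M z k (uniform_message A) x / real k"
    by (intro divide_right_mono) auto
  have "ereal (code_information M z k (uniform_message A) x / real k) \<le> block_capacity M z P k"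
    unfolding block_capacity_def by (rule SUP_upper2[of "(uniform_message A, x)"]) (use adm in auto)
  from order_trans[OF _ this] show ?thesis using rate by (simp only: ereal_less_eq(3))
qed

theorem feedback_capacity_ge:
  assumes G0: "fps_nth G 0 = 0" and G: "summable (\<lambda>j. \<bar>fps_nth G j\<bar>)"
    and G2: "\<And>i. \<sigma>\<^sup>2 * (\<Sum>j<i. (fps_nth G j)\<^sup>2) \<le> P0" "P0 < P"
    and H: "summable (\<lambda>j. \<bar>fps_nth (F + G) j\<bar>)"
    and W: "finite W" "\<And>w. w \<in> W \<Longrightarrow> cnj w \<in> W" "\<And>w. w \<in> W \<Longrightarrow> 0 < cmod w \<and> cmod w < 1"
      "\<And>w. w \<in> W \<Longrightarrow> (\<lambda>m. of_real (fps_nth (F + G) m) * w ^ m) sums 0"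
  shows "feedback_capacity M z P \<ge> ereal (\<Sum>w\<in>W. log 2 (1 / cmod w))"
proof -
  have "0 \<notin> W" using W(3) by force
  obtain L :: "complex \<Rightarrow> nat \<Rightarrow> real" and n where
    L: "\<And>v i. i > n \<Longrightarrow> L v i = 0"
      "\<And>v w k. v \<in> W \<Longrightarrow> w \<in> W \<Longrightarrow> k \<ge> n \<Longrightarrow>
        real_coord w (\<Sum>i=1..k. of_real (L v i) * w ^ i) = (if v = w then 1 else 0)"
    using real_signals[OF W(1) \<open>0 \<notin> W\<close> W(2)] by metis
  have P0: "P0 \<ge> 0" using G2(1)[of 0] by simp
  \<comment> \<open>Chosen so that \<open>t * P0\<close> uses at most half of the slack
    \<open>P - P0\<close>; the added 1 covers \<open>P0 = 0\<close>.\<close>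
  define t where "t = (P - P0) / (2 * (P0 + 1))"
  have t: "t > 0" using P0 G2 by (simp add: t_def)
  have "t * P0 \<le> t * (P0 + 1)" using t by simp
  also have "\<dots> = (P - P0) / 2" using P0 by (simp add: t_def field_simps)
  also have "\<dots> < P - P0" using G2(2) by simp
  finally have slack: "(1 + t) * P0 < P" by (simp add: algebra_simps)
  define B where "B = (1 + 1 / t) * (2 * (\<Sum>i\<le>n. (\<Sum>v\<in>W. \<bar>L v i\<bar>)\<^sup>2) + 2 * ((\<Sum>j. \<bar>fps_nth G j\<bar>)\<^sup>2 * K))"
  define c3 where "c3 = (\<Sum>m. \<bar>fps_nth (F + G) m\<bar>)\<^sup>2 * (2 * \<sigma>\<^sup>2 + 2 * K)"
  have c3: "c3 \<ge> 0" unfolding c3_def using K_nonneg by simp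
  \<comment> \<open>Dividing by \<open>k\<close> compensates the factor \<open>k\<close> in the
    decoding error, which then stays bounded in units of the grid spacing. The rate loses only
    \<open>log 2 k / k\<close> per point of \<open>W\<close>.\<close>
  define N where "N k w = nat \<lceil>(1 / cmod w) ^ k / real k\<rceil>" for k w
  define R where "R = (\<Sum>w\<in>W. log 2 (1 / cmod w))"
  define low where "low k = R - (card W * log 2 (real k) + (card W * log 2 22 + card W * c3)) / real k" for k
  have ev: "eventually (\<lambda>k. block_capacity M z P k \<ge> ereal (low k)) sequentially"
  proof -
    \<comment> \<open>Rounding up adds at most one level; under this bound it adds at most 1 to
      \<open>N k w * (k * cmod w ^ k)\<close>, which is then at most 2.\<close>
    have "eventually (\<lambda>k. \<forall>w\<in>W. real k * cmod w ^ k \<le> 1) sequentially"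
    proof (intro eventually_ball_finite ballI W(1))
      fix w assume "w \<in> W"
      then have "(\<lambda>k. real k * cmod w ^ k) \<longlonglongrightarrow> 0"
        using W(3) by (intro powser_times_n_limit_0) auto
      from order_tendstoD(2)[OF this, of 1] show "eventually (\<lambda>k. real k * cmod w ^ k \<le> 1) sequentially"
        by (auto elim: eventually_mono)
    qed
    moreover have "eventually (\<lambda>k. k \<ge> max (max 1 n) (nat \<lceil>B / (P - (1 + t) * P0)\<rceil>)) sequentially"
      by (rule eventually_ge_at_top)
    ultimately show ?thesis
    proof eventually_elim
      case (elim k)
      then have k: "k \<ge> n" "k \<ge> 1" and "nat \<lceil>B / (P - (1 + t) * P0)\<rceil> \<le> k" by simp_all
      then have kB: "real k \<ge> B / (P - (1 + t) * P0)" by (simp add: nat_le_iff ceiling_le_iff)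
      have k0: "real k > 0" using k by simp
      have power: "real k * ((1 + t) * P0) + B \<le> real k * P"
      proof -
        have "B \<le> real k * (P - (1 + t) * P0)" using kB slack by (simp add: pos_divide_le_eq)
        then show ?thesis by (simp add: algebra_simps)
      qed
      have pos: "(1 / cmod w) ^ k / real k > 0" if "w \<in> W" for w
        using W(3)[OF that] k0 by simp
      have N_ge: "real (N k w) \<ge> (1 / cmod w) ^ k / real k" and N_le: "real (N k w) \<le> (1 / cmod w) ^ k / real k + 1"
        and N1: "N k w \<ge> 1" if "w \<in> W" for w
        using pos[OF that] unfolding N_def by (linarith, linarith, simp add: Suc_le_eq)
      have "block_capacity M z P k \<ge> ereal (((\<Sum>w\<in>W. log 2 (N k w)) - card W * log 2 22
           - (\<Sum>w\<in>W. (real (N k w) / 2)\<^sup>2 * (c3 * (real k * cmod w ^ k)\<^sup>2))) / real k)"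
        unfolding c3_def
        by (rule block_capacity_ge[OF G0 G t G2(1) H W(1) _ W(4) L k N1 power[unfolded B_def]])
           (use W(3) in \<open>auto simp: less_imp_le\<close>)
      note block = this
      have low: "low k \<le> ((\<Sum>w\<in>W. log 2 (N k w)) - card W * log 2 22
           - (\<Sum>w\<in>W. (real (N k w) / 2)\<^sup>2 * (c3 * (real k * cmod w ^ k)\<^sup>2))) / real k"
      proof -
        have "(\<Sum>w\<in>W. (real (N k w) / 2)\<^sup>2 * (c3 * (real k * cmod w ^ k)\<^sup>2)) \<le> (\<Sum>w\<in>W. c3)"
        proof (rule sum_mono)
          fix w assume w: "w \<in> W"
          let ?q = "real k * cmod w ^ k"
          have "real (N k w) * ?q \<le> ((1 / cmod w) ^ k / real k + 1) * ?q"
            using N_le[OF w] by (intro mult_right_mono) auto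
          also have "\<dots> = 1 + ?q"
            using W(3)[OF w] k0 by (simp add: field_simps power_divide)
          also have "\<dots> \<le> 2" using elim w by auto
          finally have "real (N k w) / 2 * ?q \<le> 1" by simp
          then have "(real (N k w) / 2 * ?q)\<^sup>2 \<le> 1" by (intro power_le_one) auto
          then have "c3 * (real (N k w) / 2 * ?q)\<^sup>2 \<le> c3 * 1" using c3 by (rule mult_left_mono)
          moreover have "a\<^sup>2 * (c * q\<^sup>2) = c * (a * q)\<^sup>2" for a c q :: real by (simp add: power_mult_distrib)
          ultimately show "(real (N k w) / 2)\<^sup>2 * (c3 * ?q\<^sup>2) \<le> c3" by (simp only: mult_1_right)
        qed
        moreover have "(\<Sum>w\<in>W. log 2 (N k w)) \<ge> (\<Sum>w\<in>W. real k * log 2 (1 / cmod w) - log 2 (real k))"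
        proof (rule sum_mono)
          fix w assume w: "w \<in> W"
          have "real k * log 2 (1 / cmod w) - log 2 (real k) = log 2 ((1 / cmod w) ^ k / real k)"
            using W(3)[OF w] k0 by (subst log_divide) (auto simp: log_nat_power)
          also have "\<dots> \<le> log 2 (N k w)" using N_ge[OF w] pos[OF w] by (intro log_mono) auto
          finally show "real k * log 2 (1 / cmod w) - log 2 (real k) \<le> log 2 (N k w)" .
        qed
        moreover have "(\<Sum>w\<in>W. real k * log 2 (1 / cmod w) - log 2 (real k)) = real k * R - card W * log 2 (real k)"
          by (simp add: R_def sum_subtractf sum_distrib_left)
        ultimately have "real k * R - card W * log 2 (real k) - card W * log 2 22 - card W * c3 \<le>
           (\<Sum>w\<in>W. log 2 (N k w)) - card W * log 2 22 - (\<Sum>w\<in>W. (real (N k w) / 2)\<^sup>2 * (c3 * (real k * cmod w ^ k)\<^sup>2))"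
          by simp
        then have "(real k * R - card W * log 2 (real k) - card W * log 2 22 - card W * c3) / real k \<le>
           ((\<Sum>w\<in>W. log 2 (N k w)) - card W * log 2 22 - (\<Sum>w\<in>W. (real (N k w) / 2)\<^sup>2 * (c3 * (real k * cmod w ^ k)\<^sup>2))) / real k"
          using k0 by (intro divide_right_mono) auto
        moreover have "(real k * R - card W * log 2 (real k) - card W * log 2 22 - card W * c3) / real k = low k"
          using k0 by (simp add: low_def field_simps)
        ultimately show ?thesis by simp
      qed
      show ?case by (rule order_trans[OF _ block]) (simp only: ereal_less_eq(3) low)
    qed
  qed
  have "low \<longlonglongrightarrow> R"
  proof -
    have ln: "(\<lambda>k. ln (real k) / real k) \<longlonglongrightarrow> 0" using lim_ln_over_n by simp
    have "(\<lambda>k. R - (card W / ln 2 * (ln (real k) / real k) + (card W * log 2 22 + card W * c3) * (1 / real k))) \<longlonglongrightarrow> R - (card W / ln 2 * 0 + (card W * log 2 22 + card W * c3) * 0)"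
      by (intro tendsto_intros ln lim_1_over_n)
    then show ?thesis
      by (simp add: low_def[abs_def] log_def add_divide_distrib)
  qed
  then have "(\<lambda>k. ereal (low k)) \<longlonglongrightarrow> ereal R" by simp
  then have "ereal R = liminf (\<lambda>k. ereal (low k))" by (intro lim_imp_Liminf[symmetric]) auto
  also have "\<dots> \<le> feedback_capacity M z P"
    unfolding feedback_capacity_def by (rule Liminf_mono[OF ev])
  finally show ?thesis by (simp add: R_def)
qed

end

section \<open>Blaschke products and the feedback filter\<close>

definition summable_fps :: "'a::real_normed_algebra_1 fps \<Rightarrow> bool" where
  "summable_fps A \<longleftrightarrow> summable (\<lambda>n. norm (fps_nth A n))"

lemma summable_fps_add: "summable_fps A \<Longrightarrow> summable_fps B \<Longrightarrow> summable_fps (A + B)"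
  unfolding summable_fps_def
  by (rule summable_comparison_test'[OF summable_add, where N = 0])
     (assumption+, simp add: norm_triangle_ineq)

lemma summable_fps_mult:
  fixes A B :: "'a::{real_normed_algebra_1,banach} fps"
  assumes "summable_fps A" "summable_fps B"
  shows "summable_fps (A * B)"
  unfolding summable_fps_def
proof (rule summable_comparison_test')
  show "summable (\<lambda>n. \<Sum>i\<le>n. norm (fps_nth A i) * norm (fps_nth B (n - i)))"
    using assms unfolding summable_fps_def by (intro summable_Cauchy_product) auto
  show "norm (norm (fps_nth (A * B) n)) \<le> (\<Sum>i\<le>n. norm (fps_nth A i) * norm (fps_nth B (n - i)))" if "n \<ge> 0" for n
    unfolding fps_mult_nth atLeast0AtMost real_norm_def abs_norm_cancel
    by (rule order_trans[OF norm_sum]) (intro sum_mono norm_mult_ineq)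
qed

lemma summable_fps_const: "summable_fps (fps_const c)"
  unfolding summable_fps_def by (rule summable_finite[of "{0}"]) auto

lemma summable_fps_of_poly: "summable_fps (fps_of_poly p)"
  unfolding summable_fps_def by (rule summable_finite[of "{..degree p}"]) (auto simp: coeff_eq_0)

lemma summable_fps_conv_radius:
  fixes A :: "'a::{banach,real_normed_field} fps"
  assumes "summable_fps A"
  shows "fps_conv_radius A \<ge> 1"
proof -
  have "summable (\<lambda>n. fps_nth A n * 1 ^ n)"
    using summable_norm_cancel[of "fps_nth A"] assms by (simp add: summable_fps_def)
  then have "conv_radius (fps_nth A) \<ge> norm (1 :: 'a)" by (rule conv_radius_geI)
  then show ?thesis by (simp add: fps_conv_radius_def one_ereal_def)
qed

lemma summable_fps_norm_less:
  fixes A :: "'a::{banach,real_normed_field} fps"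
  assumes "summable_fps A" "norm w < 1"
  shows "ereal (norm w) < fps_conv_radius A"
  using summable_fps_conv_radius[OF assms(1)] assms(2)
  by (metis ereal_less(3) order_less_le_trans)

text \<open>Geometric series: \<open>1 / (X - x)\<close> has the coefficients
  \<open>- 1 / x ^ (n + 1)\<close>.\<close>

lemma inverse_linear_fps:
  fixes x :: "'a::{banach,real_normed_field}"
  assumes x: "norm x > 1"
  shows "summable_fps (inverse (fps_of_poly [:- x, 1:]))"
proof -
  have x0: "x \<noteq> 0" using x by auto
  define B where "B = Abs_fps (\<lambda>n. - ((1 / x) ^ Suc n))"
  have "fps_of_poly [:- x, 1:] * B = 1"
  proof (rule fps_ext)
    fix n
    have eq: "fps_of_poly [:- x, 1:] * B = fps_X * B - fps_const x * B"
      by (simp add: fps_of_poly_pCons algebra_simps flip: fps_const_neg)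
    show "fps_nth (fps_of_poly [:- x, 1:] * B) n = fps_nth 1 n"
      unfolding eq using x0 by (cases n) (auto simp: B_def field_simps)
  qed
  then have "inverse (fps_of_poly [:- x, 1:]) = B" by (rule fps_inverse_unique)
  moreover have "norm (norm (1 / x)) < 1" using x by (simp add: norm_divide divide_less_eq)
  then have "summable (\<lambda>n. norm (1 / x) ^ Suc n)"
    by (subst summable_Suc_iff) (rule summable_geometric)
  then have "summable_fps B" unfolding summable_fps_def B_def by (simp add: norm_power norm_mult norm_divide power_divide)
  ultimately show ?thesis by simp
qed

text \<open>Each root has modulus greater than 1, so each linear factor has a summable inverse, and
  products of summable series are summable.\<close>

lemma summable_fps_inverse_poly:
  fixes p :: "complex poly"
  assumes "\<And>w. cmod w \<le> 1 \<Longrightarrow> poly p w \<noteq> 0"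
  shows "summable_fps (inverse (fps_of_poly p))"
proof -
  have p0: "p \<noteq> 0" using assms[of 0] by auto
  obtain A where A: "p = smult (lead_coeff p) (\<Prod>x\<in>#A. [:-x, 1:])"
    using alg_closed_imp_factorization[OF p0] by blast
  have "norm x > 1" if "x \<in># A" for x
  proof (rule ccontr)
    assume "\<not> norm x > 1"
    moreover have "poly p x = 0"
      using that by (subst A) (auto simp: poly_prod_mset intro!: image_eqI[of _ _ x])
    ultimately show False using assms[of x] by simp
  qed
  then have "summable_fps (inverse (fps_of_poly (\<Prod>x\<in>#A. [:-x, 1:])))"
  proof (induction A)
    case empty
    then show ?case using summable_fps_const[of 1] by simp
  next
    case (add x A)
    have "inverse (fps_of_poly (\<Prod>x\<in>#add_mset x A. [:-x, 1:])) = inverse (fps_of_poly [:-x, 1:]) * inverse (fps_of_poly (\<Prod>x\<in>#A. [:-x, 1:]))"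
      by (simp only: image_mset_add_mset prod_mset.add_mset fps_of_poly_mult fps_inverse_mult)
    moreover have "summable_fps (inverse (fps_of_poly [:-x, 1:]) * inverse (fps_of_poly (\<Prod>x\<in>#A. [:-x, 1:])))"
      using add by (intro summable_fps_mult inverse_linear_fps) auto
    ultimately show ?case by (simp only:)
  qed
  then have "summable_fps (fps_const (inverse (lead_coeff p)) * inverse (fps_of_poly (\<Prod>x\<in>#A. [:-x, 1:])))"
    by (intro summable_fps_mult summable_fps_const)
  also have "fps_const (inverse (lead_coeff p)) * inverse (fps_of_poly (\<Prod>x\<in>#A. [:-x, 1:])) = inverse (fps_of_poly p)"
    by (subst (2) A) (simp add: fps_of_poly_smult fps_inverse_mult fps_const_inverse)
  finally show ?thesis .
qed

section \<open>Complex coefficients and Blaschke products\<close>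

definition fps_cpx :: "real fps \<Rightarrow> complex fps" where
  "fps_cpx A = Abs_fps (\<lambda>n. of_real (fps_nth A n))"

lemma fps_cpx_nth [simp]: "fps_nth (fps_cpx A) n = of_real (fps_nth A n)"
  by (simp add: fps_cpx_def)

lemma fps_cpx_mult: "fps_cpx (A * B) = fps_cpx A * fps_cpx B"
  by (rule fps_ext) (simp add: fps_mult_nth)

lemma fps_cpx_inverse: "fps_nth A 0 \<noteq> 0 \<Longrightarrow> fps_cpx (inverse A) = inverse (fps_cpx A)"
proof -
  assume "fps_nth A 0 \<noteq> 0"
  then have "fps_cpx A * fps_cpx (inverse A) = fps_cpx 1"
    by (simp add: fps_cpx_mult[symmetric] inverse_mult_eq_1')
  also have "fps_cpx 1 = 1" by (rule fps_ext) simp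
  finally show "fps_cpx (inverse A) = inverse (fps_cpx A)" by (rule fps_inverse_unique[symmetric])
qed

lemma summable_fps_cpx: "summable_fps (fps_cpx A) \<longleftrightarrow> summable_fps A"
  by (simp add: summable_fps_def)

text \<open>Exchanging \<open>X - w\<close> for \<open>1 - cnj w X\<close> changes the partial energies by a telescoping sum.\<close>

lemma blaschke_factor_energy:
  fixes A :: "complex fps"
  shows "(\<Sum>m<n. (cmod (fps_nth (fps_of_poly [:- w, 1:] * A) m))\<^sup>2)
       = (\<Sum>m<n. (cmod (fps_nth (fps_of_poly [:1, - cnj w:] * A) m))\<^sup>2)
         - (1 - (cmod w)\<^sup>2) * (if n = 0 then 0 else (cmod (fps_nth A (n - 1)))\<^sup>2)"
proof -
  let ?a = "\<lambda>m. if m = 0 then 0 else fps_nth A (m - 1)"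
  have 1: "fps_nth (fps_of_poly [:- w, 1:] * A) m = ?a m - w * fps_nth A m" for m
  proof -
    have "fps_of_poly [:- w, 1:] * A = fps_X * A - fps_const w * A"
      by (simp add: fps_of_poly_pCons algebra_simps flip: fps_const_neg)
    then show ?thesis by simp
  qed
  have 2: "fps_nth (fps_of_poly [:1, - cnj w:] * A) m = fps_nth A m - cnj w * ?a m" for m
  proof -
    have "fps_of_poly [:1, - cnj w:] * A = A - fps_const (cnj w) * (fps_X * A)"
      by (simp add: fps_of_poly_pCons algebra_simps flip: fps_const_neg)
    then show ?thesis by simp
  qed
  have id: "(cmod (x - w * y))\<^sup>2 = (cmod (y - cnj w * x))\<^sup>2 + (1 - (cmod w)\<^sup>2) * ((cmod x)\<^sup>2 - (cmod y)\<^sup>2)" for x y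
    unfolding cmod_power2 by (simp add: algebra_simps power2_eq_square)
  have "(\<Sum>m<n. (cmod (?a m - w * fps_nth A m))\<^sup>2)
     = (\<Sum>m<n. (cmod (fps_nth A m - cnj w * ?a m))\<^sup>2) - (1 - (cmod w)\<^sup>2) * (cmod (?a n))\<^sup>2"
    by (induction n) (auto simp: id algebra_simps)
  then show ?thesis unfolding 1 2 by simp
qed

lemma blaschke_factor_energy_le:
  fixes A :: "complex fps"
  assumes "cmod w < 1"
  shows "(\<Sum>m<n. (cmod (fps_nth (fps_of_poly [:- w, 1:] * A) m))\<^sup>2)
       \<le> (\<Sum>m<n. (cmod (fps_nth (fps_of_poly [:1, - cnj w:] * A) m))\<^sup>2)"
  unfolding blaschke_factor_energy using assms by (simp add: power_le_one)

text \<open>Each \<open>w\<close> contributes a factor \<open>(X - w) / (1 - cnj w * X)\<close>,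
  which does not increase partial energies. Rescaling it by \<open>- 1 / w\<close> keeps the
  constant coefficient 1 and costs the factor \<open>1 / (cmod w)\<^sup>2\<close>.\<close>

lemma blaschke_product_exists:
  assumes "finite W" "\<And>w. w \<in> W \<Longrightarrow> 0 < cmod w \<and> cmod w < 1"
  shows "\<exists>Q. summable_fps Q \<and> fps_nth Q 0 = 1 \<and> (\<forall>w\<in>W. eval_fps Q w = 0) \<and>
    (\<forall>n. (\<Sum>m<n. (cmod (fps_nth Q m))\<^sup>2) \<le> (\<Prod>w\<in>W. 1 / (cmod w)\<^sup>2))"
  using assms
proof (induction W rule: finite_induct)
  case empty
  have "(\<Sum>m<n. (cmod (fps_nth 1 m))\<^sup>2) \<le> 1" for n
    by (cases n) (auto simp: sum.lessThan_Suc_shift simp del: sum.lessThan_Suc)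
  then show ?case using summable_fps_const[of "1::complex"] by (intro exI[of _ 1]) auto
next
  case (insert w W)
  then obtain Q where Q: "summable_fps Q" "fps_nth Q 0 = 1" "\<And>v. v \<in> W \<Longrightarrow> eval_fps Q v = 0"
    "\<And>n. (\<Sum>m<n. (cmod (fps_nth Q m))\<^sup>2) \<le> (\<Prod>w\<in>W. 1 / (cmod w)\<^sup>2)"
    by auto
  have w: "0 < cmod w" "cmod w < 1" using insert by auto
  let ?I = "inverse (fps_of_poly [:1, - cnj w:])"
  define A where "A = ?I * Q"
  have I: "summable_fps ?I"
  proof (rule summable_fps_inverse_poly)
    fix z assume "cmod z \<le> 1"
    then have "cmod (cnj w * z) < 1"
      using w mult_strict_mono'[of "cmod w" 1 "cmod z"] by (simp add: norm_mult) (metis mult_le_one mult_less_le_imp_less mult_right_le_one_le norm_ge_zero order_le_less_trans)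
    then show "poly [:1, - cnj w:] z \<noteq> 0"
      by (auto simp: algebra_simps)
  qed
  have sA: "summable_fps A" unfolding A_def by (intro summable_fps_mult I Q)
  have QA: "fps_of_poly [:1, - cnj w:] * A = Q"
    unfolding A_def mult.assoc[symmetric] by (subst inverse_mult_eq_1') auto
  have A0: "fps_nth A 0 = 1" using arg_cong[OF QA, of "\<lambda>x. fps_nth x 0"] Q(2) by simp
  define Q' where "Q' = fps_const (- 1 / w) * (fps_of_poly [:- w, 1:] * A)"
  have sp: "summable_fps (fps_of_poly [:- w, 1:] * A)"
    by (intro summable_fps_mult summable_fps_of_poly sA)
  have ev: "eval_fps Q' v = (- 1 / w) * ((v - w) * (eval_fps ?I v * eval_fps Q v))" if "cmod v < 1" for v
    unfolding Q'_def A_def using that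
    by (simp add: eval_fps_mult summable_fps_norm_less summable_fps_mult summable_fps_const summable_fps_of_poly I Q(1)
        del: fps_of_poly_pCons)
  have "summable_fps Q'" unfolding Q'_def by (intro summable_fps_mult summable_fps_const sp)
  moreover have "fps_nth Q' 0 = 1" using w A0 by (simp add: Q'_def)
  moreover have "\<forall>v\<in>insert w W. eval_fps Q' v = 0"
    using ev insert.prems Q(3) by auto
  moreover have "(\<Sum>m<n. (cmod (fps_nth Q' m))\<^sup>2) \<le> (\<Prod>w\<in>insert w W. 1 / (cmod w)\<^sup>2)" for n
  proof -
    have "(\<Sum>m<n. (cmod (fps_nth Q' m))\<^sup>2) = 1 / (cmod w)\<^sup>2 * (\<Sum>m<n. (cmod (fps_nth (fps_of_poly [:- w, 1:] * A) m))\<^sup>2)"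
      unfolding Q'_def sum_distrib_left
      by (intro sum.cong refl) (simp add: norm_mult norm_divide power_mult_distrib power_divide del: fps_of_poly_pCons)
    also have "\<dots> \<le> 1 / (cmod w)\<^sup>2 * (\<Prod>w\<in>W. 1 / (cmod w)\<^sup>2)"
      using order_trans[OF blaschke_factor_energy_le[OF w(2)] Q(4)[unfolded QA[symmetric]]]
      by (intro mult_left_mono) auto
    finally show ?thesis using insert by simp
  qed
  ultimately show ?case by blast
qed

text \<open>On the roots the noise filter \<open>N / D\<close> takes the constant value
  \<open>1 / \<zeta>\<close>. Replacing the coefficients of the Blaschke product by their real parts keeps the
  zeros and only lowers the energy.\<close>

lemma feedback_filter_exists:
  fixes N D :: "real fps" and Np Dp :: "complex poly" and \<zeta> :: real
  assumes N: "fps_cpx N = fps_of_poly Np" and D: "fps_cpx D = fps_of_poly Dp" "fps_nth D 0 = 1"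
    and Dp: "\<And>w. cmod w \<le> 1 \<Longrightarrow> poly Dp w \<noteq> 0"
    and \<zeta>: "\<zeta> \<noteq> 0"
    and W: "finite W" "\<And>w. w \<in> W \<Longrightarrow> cnj w \<in> W" "\<And>w. w \<in> W \<Longrightarrow> 0 < cmod w \<and> cmod w < 1"
      "\<And>w. w \<in> W \<Longrightarrow> poly Dp w = of_real \<zeta> * poly Np w"
  defines "F \<equiv> N * inverse D"
  obtains G where "fps_nth G 0 = 0" "summable_fps G" "summable_fps (F + G)"
    "\<And>w. w \<in> W \<Longrightarrow> (\<lambda>m. of_real (fps_nth (F + G) m) * w ^ m) sums 0"
    "\<And>i. (\<Sum>j<i. (fps_nth G j)\<^sup>2) \<le> ((\<Prod>w\<in>W. 1 / (cmod w)\<^sup>2) - 1) / \<zeta>\<^sup>2"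
proof -
  obtain Q where Q: "summable_fps Q" "fps_nth Q 0 = 1" "\<And>w. w \<in> W \<Longrightarrow> eval_fps Q w = 0"
    "\<And>n. (\<Sum>m<n. (cmod (fps_nth Q m))\<^sup>2) \<le> (\<Prod>w\<in>W. 1 / (cmod w)\<^sup>2)"
    using blaschke_product_exists[OF W(1,3)] by auto
  define Qr where "Qr = Abs_fps (\<lambda>n. Re (fps_nth Q n))"
  have Qr: "summable_fps Qr"
    unfolding summable_fps_def
    by (rule summable_comparison_test'[OF Q(1)[unfolded summable_fps_def]]) (auto simp: Qr_def abs_Re_le_cmod)
  have Q_sums: "(\<lambda>m. fps_nth Q m * w ^ m) sums 0" if "w \<in> W" for w
    using sums_eval_fps[OF summable_fps_norm_less[OF Q(1), of w]] Q(3)[OF that] W(3)[OF that] by simp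
  have Qr_sums: "(\<lambda>m. of_real (fps_nth Qr m) * w ^ m) sums 0" if w: "w \<in> W" for w
  proof -
    have "(\<lambda>m. cnj (fps_nth Q m * cnj w ^ m)) sums cnj 0"
      using Q_sums[OF W(2)[OF w]] by (simp only: sums_cnj)
    from sums_divide[OF sums_add[OF Q_sums[OF w] this], of 2]
    have "(\<lambda>m. (fps_nth Q m * w ^ m + cnj (fps_nth Q m * cnj w ^ m)) / 2) sums 0" by simp
    moreover have "(fps_nth Q m * w ^ m + cnj (fps_nth Q m * cnj w ^ m)) / 2 = of_real (fps_nth Qr m) * w ^ m" for m
    proof -
      have re: "of_real (Re c) = (c + cnj c) / 2" for c by (simp add: complex_add_cnj)
      show ?thesis by (simp add: Qr_def re distrib_right)
    qed
    ultimately show ?thesis by simp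
  qed
  have DN0: "fps_nth (fps_of_poly Dp) 0 \<noteq> 0" using Dp[of 0] by (simp add: poly_0_coeff_0)
  have iD: "summable_fps (inverse (fps_of_poly Dp))" by (rule summable_fps_inverse_poly) (rule Dp)
  have F_cpx: "fps_cpx F = fps_of_poly Np * inverse (fps_of_poly Dp)"
    unfolding F_def fps_cpx_mult using D N by (simp add: fps_cpx_inverse)
  have F: "summable_fps F"
    unfolding summable_fps_cpx[symmetric] F_cpx by (intro summable_fps_mult summable_fps_of_poly iD)
  have F_sums: "(\<lambda>m. of_real (fps_nth F m) * w ^ m) sums of_real (1 / \<zeta>)" if w: "w \<in> W" for w
  proof -
    have w1: "cmod w < 1" using W(3)[OF w] by simp
    have "eval_fps (fps_of_poly Dp * inverse (fps_of_poly Dp)) w = 1"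
      using inverse_mult_eq_1'[OF DN0] by simp
    then have "poly Dp w * eval_fps (inverse (fps_of_poly Dp)) w = 1"
      using w1 by (simp add: eval_fps_mult summable_fps_norm_less iD)
    moreover have "eval_fps (fps_cpx F) w = poly Np w * eval_fps (inverse (fps_of_poly Dp)) w"
      unfolding F_cpx using w1 by (simp add: eval_fps_mult summable_fps_norm_less iD)
    ultimately have "eval_fps (fps_cpx F) w = of_real (1 / \<zeta>)"
      using \<zeta> by (simp add: W(4)[OF w] field_simps)
    then show ?thesis
      using sums_eval_fps[OF summable_fps_norm_less[of "fps_cpx F" w]] F w1 by (simp add: summable_fps_cpx)
  qed
  \<comment> \<open>At a root \<open>F\<close> is \<open>1 / \<zeta>\<close> and \<open>Qr\<close>
    is 0, so \<open>F + G\<close> vanishes there; the constant coefficient 1 of \<open>Qr\<close>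
    makes \<open>G\<close> strictly causal.\<close>
  define G where "G = fps_const (- 1 / \<zeta>) * (1 - Qr)"
  have G_nth: "fps_nth G m = - 1 / \<zeta> * (of_bool (m = 0) - fps_nth Qr m)" for m
    by (simp add: G_def)
  have Qr0: "fps_nth Qr 0 = 1" using Q(2) by (simp add: Qr_def)
  have "summable_fps (1 - Qr)"
    using summable_fps_add[OF summable_fps_const[of 1] summable_fps_mult[OF summable_fps_const[of "-1"] Qr]]
    by (simp flip: fps_const_neg)
  then have G: "summable_fps G" unfolding G_def by (intro summable_fps_mult summable_fps_const)
  have Q_sq: "(\<Sum>m<n. (fps_nth Qr m)\<^sup>2) \<le> (\<Prod>w\<in>W. 1 / (cmod w)\<^sup>2)" for n
  proof -
    have "(\<Sum>m<n. (fps_nth Qr m)\<^sup>2) \<le> (\<Sum>m<n. (cmod (fps_nth Q m))\<^sup>2)"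
      by (intro sum_mono) (simp add: Qr_def cmod_power2)
    then show ?thesis using Q(4) order_trans by blast
  qed
  show ?thesis
  proof (rule that[of G])
    show "fps_nth G 0 = 0" by (simp add: G_nth Qr0)
    show "summable_fps G" "summable_fps (F + G)" by (intro G F summable_fps_add)+
    show "(\<lambda>m. of_real (fps_nth (F + G) m) * w ^ m) sums 0" if w: "w \<in> W" for w
    proof -
      have "(\<lambda>m. of_bool (m = 0) * w ^ m) sums (1::complex)"
        using sums_single[of 0 "\<lambda>m. w ^ m"] by (simp add: of_bool_def if_distrib[of "\<lambda>x. x * _"] cong: if_cong)
      from sums_add[OF F_sums[OF w] sums_mult[OF sums_diff[OF this Qr_sums[OF w]], of "of_real (- 1 / \<zeta>)"]]
      moreover have "complex_of_real (of_bool b) = of_bool b" for b by (cases b) simp_all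
      ultimately show ?thesis by (simp add: G_nth algebra_simps diff_divide_distrib add_divide_distrib)
    qed
    \<comment> \<open>Up to the factor \<open>1 / \<zeta>\<^sup>2\<close>, the energy of
      \<open>G\<close> is that of \<open>Qr\<close> without its constant coefficient 1. For
      \<open>i = 0\<close> the claim is that the product is at least 1, which is the energy bound
      for a single coefficient.\<close>
    show "(\<Sum>j<i. (fps_nth G j)\<^sup>2) \<le> ((\<Prod>w\<in>W. 1 / (cmod w)\<^sup>2) - 1) / \<zeta>\<^sup>2" for i
    proof (cases i)
      case 0
      then show ?thesis using Q_sq[of 1] by (simp add: Qr0)
    next
      case (Suc n)
      have "(\<Sum>j<i. (fps_nth G j)\<^sup>2) = (\<Sum>j<n. (fps_nth Qr (Suc j))\<^sup>2) / \<zeta>\<^sup>2"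
        unfolding Suc sum.lessThan_Suc_shift by (simp add: G_nth Qr0 power_divide sum_divide_distrib)
      also have "(\<Sum>j<n. (fps_nth Qr (Suc j))\<^sup>2) = (\<Sum>j<i. (fps_nth Qr j)\<^sup>2) - 1"
        unfolding Suc sum.lessThan_Suc_shift by (simp add: Qr0)
      also have "\<dots> / \<zeta>\<^sup>2 \<le> ((\<Prod>w\<in>W. 1 / (cmod w)\<^sup>2) - 1) / \<zeta>\<^sup>2"
        using Q_sq[of i] by (intro divide_right_mono) auto
      finally show ?thesis .
    qed
  qed
qed

section \<open>Continuity of the Mahler measure\<close>

declare mult_pCons_left [simp del] mult_pCons_right [simp del]

text \<open>The geometric mean of \<open>cmod p\<close> over the unit circle, in the form given by
  Jensen's formula. For \<open>poly p 0 \<noteq> 0\<close>, dividing it by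
  \<open>cmod (poly p 0)\<close> leaves the product of \<open>1 / cmod w\<close> over the roots in
  the disc, with multiplicity: the quantity that governs both rate and power.\<close>

definition mahler :: "complex poly \<Rightarrow> real" where
  "mahler p = cmod (lead_coeff p) * (\<Prod>x\<in>#proots p. max 1 (cmod x))"

lemma mahler_mult: "p \<noteq> 0 \<Longrightarrow> q \<noteq> 0 \<Longrightarrow> mahler (p * q) = mahler p * mahler q"
  by (simp add: mahler_def lead_coeff_mult proots_mult norm_mult)

lemma mahler_smult: "mahler (smult c p) = cmod c * mahler p"
  by (cases "c = 0") (auto simp: mahler_def norm_mult)

lemma mahler_1: "mahler 1 = 1"
  by (simp add: mahler_def)

lemma mahler_linear: "mahler [:- x, 1:] = max 1 (cmod x)"
  by (simp add: mahler_def)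

lemma mahler_prod_mset:
  assumes "\<And>x. x \<in># A \<Longrightarrow> f x \<noteq> 0"
  shows "mahler (\<Prod>x\<in>#A. f x) = (\<Prod>x\<in>#A. mahler (f x))"
  using assms
proof (induction A)
  case (add x A)
  have "(\<Prod>x\<in>#A. f x) \<noteq> 0" using add.prems by (auto simp: prod_mset_zero_iff)
  then show ?case using add by (simp add: mahler_mult)
qed (simp add: mahler_1)

lemma mahler_pos:
  assumes "p \<noteq> 0"
  shows "mahler p > 0"
proof -
  have "(\<Prod>x\<in>#A. max 1 (cmod x)) > 0" for A by (induction A) auto
  then show ?thesis using assms by (simp add: mahler_def)
qed

lemma complex_poly_factorization:
  fixes p :: "complex poly"
  assumes "p \<noteq> 0"
  shows "\<exists>c A. c \<noteq> 0 \<and> p = smult c (\<Prod>x\<in>#A. [:- x, 1:]) \<and> mahler p = cmod c * (\<Prod>x\<in>#A. max 1 (cmod x))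
    \<and> (\<forall>x\<in>#A. poly p x = 0) \<and> size A = degree p"
proof -
  obtain A where A: "size A = degree p" "p = smult (lead_coeff p) (\<Prod>x\<in>#A. [:- x, 1:])"
    using alg_closed_imp_factorization[OF assms] by blast
  have "mahler p = cmod (lead_coeff p) * (\<Prod>x\<in>#A. max 1 (cmod x))"
    by (subst A(2)) (simp add: mahler_smult mahler_prod_mset mahler_linear)
  moreover have "poly p x = 0" if "x \<in># A" for x
    using that by (subst A(2)) (auto simp: poly_prod_mset intro!: image_eqI[of _ _ x])
  ultimately show ?thesis using assms A by (intro exI[of _ "lead_coeff p"] exI[of _ A]) auto
qed

lemma poly_0_le_mahler:
  shows "cmod (poly p 0) \<le> mahler p"
proof (cases "p = 0")
  case False
  then obtain c A where A: "c \<noteq> 0" "p = smult c (\<Prod>x\<in>#A. [:- x, 1:])" "mahler p = cmod c * (\<Prod>x\<in>#A. max 1 (cmod x))"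
    using complex_poly_factorization[OF False] by blast
  have "cmod (poly (\<Prod>x\<in>#A. [:- x, 1:]) 0) \<le> (\<Prod>x\<in>#A. max 1 (cmod x)) \<and> 0 \<le> (\<Prod>x\<in>#A. max 1 (cmod x))"
    by (induction A) (auto simp: norm_mult intro!: mult_mono)
  then show ?thesis unfolding A(3) by (subst A(2)) (simp add: norm_mult mult_left_mono)
qed (simp add: mahler_def)

lemma mahler_eq_poly_0:
  assumes p: "p \<noteq> 0" and no: "\<And>x. cmod x < 1 \<Longrightarrow> poly p x \<noteq> 0"
  shows "mahler p = cmod (poly p 0)"
proof -
  obtain c A where A: "c \<noteq> 0" "p = smult c (\<Prod>x\<in>#A. [:- x, 1:])" "mahler p = cmod c * (\<Prod>x\<in>#A. max 1 (cmod x))"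
    "\<And>x. x \<in># A \<Longrightarrow> poly p x = 0"
    using complex_poly_factorization[OF p] by blast
  have "x \<in># A \<Longrightarrow> cmod x \<ge> 1" for x using A(4) no by (meson not_less)
  then have "cmod (poly (\<Prod>x\<in>#A. [:- x, 1:]) 0) = (\<Prod>x\<in>#A. max 1 (cmod x))"
    by (induction A) (auto simp: norm_mult)
  then show ?thesis unfolding A(3) by (subst A(2)) (simp add: norm_mult)
qed

lemma roots_factor:
  fixes p :: "complex poly"
  assumes "finite S" "\<And>w. w \<in> S \<Longrightarrow> poly p w = 0"
  shows "\<exists>r. p = (\<Prod>w\<in>S. [:- w, 1:]) * r"
  using assms
proof (induction S rule: finite_induct)
  case (insert w S)
  then obtain r where r: "p = (\<Prod>w\<in>S. [:- w, 1:]) * r" by auto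
  have "poly (\<Prod>w\<in>S. [:- w, 1:]) w \<noteq> 0" using insert by (auto simp: poly_prod)
  then have "poly r w = 0" using insert.prems[of w] r by auto
  then obtain r' where "r = [:- w, 1:] * r'" by (metis poly_eq_0_iff_dvd dvd_def)
  then have "p = (\<Prod>w\<in>insert w S. [:- w, 1:]) * r'" using r insert by (simp add: mult.assoc mult.left_commute)
  then show ?case by blast
qed auto

lemma mahler_roots_factor:
  assumes "finite S" "\<And>w. w \<in> S \<Longrightarrow> cmod w \<le> 1" "r \<noteq> 0"
  shows "mahler ((\<Prod>w\<in>S. [:- w, 1:]) * r) = mahler r"
proof -
  have "mahler (\<Prod>w\<in>S. [:- w, 1:]) = 1 \<and> (\<Prod>w\<in>S. [:- w, 1:]) \<noteq> 0"
    using assms(1,2) by (induction S rule: finite_induct) (auto simp: mahler_1 mahler_mult mahler_linear)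
  then show ?thesis using assms by (simp add: mahler_mult)
qed

text \<open>Dividing out roots in the closed disc leaves the Mahler measure unchanged and takes
  their moduli out of the value at 0; the cofactor obeys \<open>poly_0_le_mahler\<close>. This is
  Jensen's formula as an inequality, for any selection of such roots.\<close>

lemma mahler_ge_roots:
  assumes "p \<noteq> 0" "finite S" "\<And>w. w \<in> S \<Longrightarrow> cmod w \<le> 1 \<and> poly p w = 0"
  shows "cmod (poly p 0) \<le> mahler p * (\<Prod>w\<in>S. cmod w)"
proof -
  obtain r where r: "p = (\<Prod>w\<in>S. [:- w, 1:]) * r"
    using roots_factor[OF assms(2)] assms(3) by blast
  then have r0: "r \<noteq> 0" using assms by auto
  have "cmod (poly p 0) = (\<Prod>w\<in>S. cmod w) * cmod (poly r 0)"
    unfolding r by (simp add: poly_prod norm_mult flip: prod_norm)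
  also have "\<dots> \<le> (\<Prod>w\<in>S. cmod w) * mahler r"
    by (intro mult_left_mono poly_0_le_mahler prod_nonneg) auto
  also have "mahler r = mahler p"
    using mahler_roots_factor[OF assms(2) _ r0] assms(3) unfolding r by auto
  finally show ?thesis by (simp add: mult.commute)
qed

text \<open>When all roots in the disc are divided out and they are simple, the cofactor has no root
  left there, so Jensen's inequality becomes an equality.\<close>

lemma mahler_simple_roots:
  assumes p: "p \<noteq> 0" and simple: "\<And>w. cmod w < 1 \<Longrightarrow> poly p w = 0 \<Longrightarrow> poly (pderiv p) w \<noteq> 0"
  defines "W \<equiv> {w. cmod w < 1 \<and> poly p w = 0}"
  shows "finite W" "mahler p * (\<Prod>w\<in>W. cmod w) = cmod (poly p 0)"
proof -
  show fin: "finite W"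
    unfolding W_def by (rule finite_subset[OF _ poly_roots_finite[OF p]]) auto
  obtain r where r: "p = (\<Prod>w\<in>W. [:- w, 1:]) * r"
    using roots_factor[OF fin, of p] by (auto simp: W_def)
  then have r0: "r \<noteq> 0" using p by auto
  have "poly r w \<noteq> 0" if w: "cmod w < 1" for w
  proof
    assume rw: "poly r w = 0"
    then have "poly p w = 0" by (subst r) simp
    then have wW: "w \<in> W" using w by (simp add: W_def)
    have "p = [:- w, 1:] * ((\<Prod>w\<in>W - {w}. [:- w, 1:]) * r)"
      using r fin wW by (simp add: prod.remove mult.assoc)
    then have "pderiv p = pderiv ([:- w, 1:] * ((\<Prod>w\<in>W - {w}. [:- w, 1:]) * r))" by (rule arg_cong)
    then have "poly (pderiv p) w = 0"
      by (simp only: pderiv_mult poly_add poly_mult rw) simp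
    then show False using simple[OF w \<open>poly p w = 0\<close>] by simp
  qed
  then have "mahler r = cmod (poly r 0)" by (rule mahler_eq_poly_0[OF r0])
  moreover have "mahler p = mahler r"
    using mahler_roots_factor[OF fin _ r0] unfolding r[symmetric] by (auto simp: W_def)
  moreover have "cmod (poly p 0) = (\<Prod>w\<in>W. cmod w) * cmod (poly r 0)"
    by (subst r) (simp add: poly_prod norm_mult flip: prod_norm)
  ultimately show "mahler p * (\<Prod>w\<in>W. cmod w) = cmod (poly p 0)" by simp
qed

section \<open>Comparison of the Mahler measure with the coefficient norm\<close>

lemma poly_linear_energy:
  fixes q :: "complex poly"
  assumes "Suc (degree q) < n"
  shows "(\<Sum>m<n. (cmod (coeff ([:- w, 1:] * q) m))\<^sup>2) = (\<Sum>m<n. (cmod (coeff ([:1, - cnj w:] * q) m))\<^sup>2)"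
proof -
  have "coeff q (n - 1) = 0" using assms by (intro coeff_eq_0) simp
  then show ?thesis
    using blaschke_factor_energy[of w "fps_of_poly q" n]
    by (simp del: fps_of_poly_pCons flip: fps_of_poly_mult)
qed

text \<open>Landau's argument: roots outside the disc are reflected without changing the energy.\<close>

lemma mahler_landau_aux:
  fixes q :: "complex poly"
  assumes "q \<noteq> 0" "degree q + size A < n"
  shows "(cmod (lead_coeff q) * (\<Prod>x\<in>#A. max 1 (cmod x)))\<^sup>2 \<le> (\<Sum>m<n. (cmod (coeff (q * (\<Prod>x\<in>#A. [:- x, 1:])) m))\<^sup>2)"
  using assms
proof (induction A arbitrary: q)
  case empty
  have "(cmod (coeff q (degree q)))\<^sup>2 \<le> (\<Sum>m<n. (cmod (coeff q m))\<^sup>2)"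
    using empty by (intro member_le_sum) auto
  then show ?case by simp
next
  case (add x A)
  have n0: "(\<Prod>x\<in>#A. [:- x, 1:]) \<noteq> 0" for A :: "complex multiset" by (induction A) auto
  have dA: "degree (\<Prod>x\<in>#A. [:- x, 1:]) = size A" for A :: "complex multiset"
    using n0 by (induction A) (auto simp: degree_mult_eq)
  show ?case
  proof (cases "cmod x \<le> 1")
    case True
    have "(cmod (lead_coeff ([:- x, 1:] * q)) * (\<Prod>x\<in>#A. max 1 (cmod x)))\<^sup>2 \<le> (\<Sum>m<n. (cmod (coeff ([:- x, 1:] * q * (\<Prod>x\<in>#A. [:- x, 1:])) m))\<^sup>2)"
      using add.prems by (intro add.IH) (auto simp: degree_mult_eq)
    then show ?thesis using True
      by (simp add: lead_coeff_mult max_absorb1 mult.assoc mult.left_commute)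
  next
    case False
    then have x0: "x \<noteq> 0" by auto
    let ?r = "[:1, - cnj x:]"
    have r: "degree ?r = 1" "lead_coeff ?r = - cnj x" "?r \<noteq> 0" using x0 by auto
    have "(cmod (lead_coeff (?r * q)) * (\<Prod>x\<in>#A. max 1 (cmod x)))\<^sup>2 \<le> (\<Sum>m<n. (cmod (coeff (?r * q * (\<Prod>x\<in>#A. [:- x, 1:])) m))\<^sup>2)"
      using add.prems r by (intro add.IH) (auto simp: degree_mult_eq)
    also have "\<dots> = (\<Sum>m<n. (cmod (coeff ([:- x, 1:] * (q * (\<Prod>x\<in>#A. [:- x, 1:]))) m))\<^sup>2)"
      using add.prems n0[of A] dA[of A] unfolding mult.assoc
      by (intro poly_linear_energy[symmetric]) (simp add: degree_mult_eq)
    finally show ?thesis using False r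
      by (simp add: lead_coeff_mult max_absorb2 mult.assoc mult.left_commute norm_mult del: lead_coeff_pCons)
  qed
qed

text \<open>Landau's inequality gives the Euclidean norm of the coefficients, which is at most their
  absolute sum.\<close>

lemma mahler_le_l1:
  assumes "degree p < n"
  shows "mahler p \<le> (\<Sum>m<n. cmod (coeff p m))"
proof (cases "p = 0")
  case False
  then obtain c A where A: "c \<noteq> 0" "p = smult c (\<Prod>x\<in>#A. [:- x, 1:])" "mahler p = cmod c * (\<Prod>x\<in>#A. max 1 (cmod x))"
    "size A = degree p"
    using complex_poly_factorization[OF False] by blast
  have "(mahler p)\<^sup>2 \<le> (\<Sum>m<n. (cmod (coeff p m))\<^sup>2)"
    using mahler_landau_aux[of "[:c:]" A n] A assms by (simp add: mult_pCons_left)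
  also have "\<dots> \<le> (\<Sum>m<n. cmod (coeff p m))\<^sup>2"
  proof -
    have "(\<Sum>m<n. cmod (coeff p m) * cmod (coeff p m)) \<le> (\<Sum>m<n. cmod (coeff p m) * (\<Sum>m<n. cmod (coeff p m)))"
      by (intro sum_mono mult_left_mono member_le_sum) auto
    then show ?thesis by (simp add: power2_eq_square sum_distrib_right)
  qed
  finally show ?thesis by (rule power2_le_imp_le) (simp add: sum_nonneg)
qed (simp add: mahler_def)

lemma l1_linear_le:
  fixes q :: "complex poly"
  shows "(\<Sum>m<n. cmod (coeff ([:- x, 1:] * q) m)) \<le> 2 * max 1 (cmod x) * (\<Sum>m<n. cmod (coeff q m))"
proof -
  have "coeff ([:- x, 1:] * q) m = (if m = 0 then 0 else coeff q (m - 1)) - x * coeff q m" for m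
    by (simp add: mult_pCons_left coeff_pCons split: nat.splits)
  then have "(\<Sum>m<n. cmod (coeff ([:- x, 1:] * q) m)) \<le> (\<Sum>m<n. cmod (if m = 0 then 0 else coeff q (m - 1)) + cmod x * cmod (coeff q m))"
    by (intro sum_mono) (metis norm_mult norm_triangle_ineq4)
  also have "\<dots> = (\<Sum>m<n. cmod (if m = 0 then 0 else coeff q (m - 1))) + cmod x * (\<Sum>m<n. cmod (coeff q m))"
    by (simp add: sum.distrib sum_distrib_left)
  also have "(\<Sum>m<n. cmod (if m = 0 then 0 else coeff q (m - 1))) \<le> (\<Sum>m<n. cmod (coeff q m))"
  proof (cases n)
    case (Suc k)
    have "(\<Sum>m<n. cmod (if m = 0 then 0 else coeff q (m - 1))) = (\<Sum>m<k. cmod (coeff q m))"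
      unfolding Suc by (simp add: sum.lessThan_Suc_shift del: sum.lessThan_Suc)
    then show ?thesis by (simp add: Suc)
  qed simp
  also have "(\<Sum>m<n. cmod (coeff q m)) + cmod x * (\<Sum>m<n. cmod (coeff q m)) = (1 + cmod x) * (\<Sum>m<n. cmod (coeff q m))"
    by (simp add: distrib_right)
  also have "\<dots> \<le> 2 * max 1 (cmod x) * (\<Sum>m<n. cmod (coeff q m))"
    by (intro mult_right_mono sum_nonneg) auto
  finally show ?thesis by simp
qed

text \<open>A linear factor with root \<open>x\<close> multiplies the norm by at most
  \<open>2 * max 1 (cmod x)\<close>. With \<open>mahler_le_l1\<close>, both quantities agree up to
  the factor \<open>2 ^ n\<close>, which depends only on the degree bound.\<close>

lemma l1_le_mahler:
  assumes "p \<noteq> 0" "degree p < n"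
  shows "(\<Sum>m<n. cmod (coeff p m)) \<le> 2 ^ n * mahler p"
proof -
  obtain c A where A: "c \<noteq> 0" "p = smult c (\<Prod>x\<in>#A. [:- x, 1:])" "mahler p = cmod c * (\<Prod>x\<in>#A. max 1 (cmod x))"
    "size A = degree p"
    using complex_poly_factorization[OF assms(1)] by blast
  have 1: "(\<Sum>m<n. cmod (coeff (\<Prod>x\<in>#A. [:- x, 1:]) m)) \<le> 2 ^ size A * (\<Prod>x\<in>#A. max 1 (cmod x))"
  proof (induction A)
    case empty
    have "(\<Sum>m<n. cmod (coeff 1 m)) = (\<Sum>m<n. if m = 0 then 1 else 0)"
      by (intro sum.cong) auto
    then show ?case by simp
  next
    case (add x A)
    have "(\<Sum>m<n. cmod (coeff ([:- x, 1:] * (\<Prod>x\<in>#A. [:- x, 1:])) m)) \<le> 2 * max 1 (cmod x) * (\<Sum>m<n. cmod (coeff (\<Prod>x\<in>#A. [:- x, 1:]) m))"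
      by (rule l1_linear_le)
    also have "\<dots> \<le> 2 * max 1 (cmod x) * (2 ^ size A * (\<Prod>x\<in>#A. max 1 (cmod x)))"
      using add by (intro mult_left_mono) auto
    finally show ?case by (simp add: algebra_simps)
  qed
  have "(\<Sum>m<n. cmod (coeff p m)) = cmod c * (\<Sum>m<n. cmod (coeff (\<Prod>x\<in>#A. [:- x, 1:]) m))"
    by (subst A(2)) (simp add: norm_mult sum_distrib_left)
  also have "\<dots> \<le> cmod c * (2 ^ size A * (\<Prod>x\<in>#A. max 1 (cmod x)))"
    using 1 by (intro mult_left_mono) auto
  also have "\<dots> = 2 ^ size A * mahler p" unfolding A(3) by simp
  also have "\<dots> \<le> 2 ^ n * mahler p"
    using A(4) assms mahler_pos[OF assms(1)] by (intro mult_right_mono power_increasing) auto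
  finally show ?thesis .
qed

text \<open>Graeffe's transformation squares the roots.\<close>

definition graeffe :: "complex poly \<Rightarrow> complex poly" where
  "graeffe p = Poly (map (\<lambda>m. coeff (p * pcompose p [:0, -1:]) (2 * m)) [0..<Suc (degree p)])"

lemma coeff_graeffe: "coeff (graeffe p) m = coeff (p * pcompose p [:0, -1:]) (2 * m)"
proof (cases "m \<le> degree p")
  case False
  have "degree (p * pcompose p [:0, -1:]) \<le> degree p + degree p"
    by (rule order_trans[OF degree_mult_le]) (simp add: degree_pcompose)
  then have "coeff (p * pcompose p [:0, -1:]) (2 * m) = 0"
    using False by (intro coeff_eq_0) simp
  then show ?thesis using False by (simp add: graeffe_def nth_default_def del: upt_Suc)
qed (simp add: graeffe_def nth_default_def del: upt_Suc)

lemma degree_graeffe: "degree (graeffe p) \<le> degree p"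
  by (rule degree_le) (auto simp: graeffe_def nth_default_def simp del: upt_Suc)

lemma coeff_pcompose_square: "coeff (pcompose r (monom 1 2)) (2 * m) = coeff r m" for r :: "complex poly"
proof (induction r arbitrary: m)
  case (pCons a r)
  show ?case
  proof (cases m)
    case (Suc k)
    have "coeff (monom 1 2 * pcompose r (monom 1 2)) (2 * Suc k) = coeff (pcompose r (monom 1 2)) (2 * k)"
      by (subst coeff_monom_mult) simp
    then show ?thesis using pCons Suc by (simp add: pcompose_pCons)
  qed (simp add: pcompose_pCons coeff_monom_mult)
qed simp

text \<open>Factor by factor, \<open>(X - x) * (- X - x) = - (X\<^sup>2 - x\<^sup>2)\<close>. So the
  product of \<open>p\<close> with its reflection is a polynomial in \<open>X\<^sup>2\<close> whose
  roots are the squares \<open>x\<^sup>2\<close>, and \<open>max 1\<close> commutes with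
  squaring.\<close>

lemma mahler_graeffe:
  assumes "p \<noteq> 0"
  shows "mahler (graeffe p) = (mahler p)\<^sup>2" "graeffe p \<noteq> 0"
proof -
  obtain c A where A: "c \<noteq> 0" "p = smult c (\<Prod>x\<in>#A. [:- x, 1:])" "mahler p = cmod c * (\<Prod>x\<in>#A. max 1 (cmod x))"
    using complex_poly_factorization[OF assms] by blast
  let ?P = "\<Prod>x\<in>#A. [:- x, 1:]" and ?R = "\<Prod>x\<in>#A. smult (-1) [:- x\<^sup>2, 1:]"
  have lin: "[:- x, 1:] * pcompose [:- x, 1:] [:0, -1:] = pcompose (smult (-1) [:- x\<^sup>2, 1:]) (monom 1 2)" for x :: complex
    by (simp add: pcompose_pCons monom_altdef power2_eq_square mult_pCons_left mult_pCons_right)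
  have "?P * pcompose ?P [:0, -1:] = pcompose ?R (monom 1 2)"
  proof (induction A)
    case (add x A)
    let ?PA = "\<Prod>x\<in>#A. [:- x, 1:]"
    have "[:- x, 1:] * ?PA * pcompose ([:- x, 1:] * ?PA) [:0, -1:]
       = ([:- x, 1:] * pcompose [:- x, 1:] [:0, -1:]) * (?PA * pcompose ?PA [:0, -1:])"
      by (simp only: pcompose_mult mult_ac)
    then show ?case
      by (simp only: lin add.IH image_mset_add_mset prod_mset.add_mset pcompose_mult)
  qed (simp add: pcompose_1)
  then have "p * pcompose p [:0, -1:] = pcompose (smult (c\<^sup>2) ?R) (monom 1 2)"
    by (subst (1 2) A(2)) (simp add: pcompose_smult power2_eq_square)
  then have g: "graeffe p = smult (c\<^sup>2) ?R"
    by (intro poly_eqI) (simp only: coeff_graeffe coeff_pcompose_square)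
  have m: "mahler (smult (-1) [:- x\<^sup>2, 1:]) = (max 1 (cmod x))\<^sup>2" for x
  proof (cases "cmod x \<le> 1")
    case True
    then have "(cmod x)\<^sup>2 \<le> 1" by (intro power_le_one) auto
    then show ?thesis using True unfolding mahler_smult mahler_linear by (simp add: norm_power max_absorb1)
  next
    case False
    then have "(cmod x)\<^sup>2 \<ge> 1" by (intro one_le_power) auto
    then show ?thesis using False unfolding mahler_smult mahler_linear by (simp add: norm_power max_absorb2)
  qed
  have nz: "smult (-1) [:- x\<^sup>2, 1:] \<noteq> 0" for x :: complex by simp
  have "mahler ?R = (\<Prod>x\<in>#A. (max 1 (cmod x))\<^sup>2)"
    using mahler_prod_mset[of A "\<lambda>x. smult (-1) [:- x\<^sup>2, 1:]", OF nz] by (simp only: m)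
  also have "\<dots> = (\<Prod>x\<in>#A. max 1 (cmod x))\<^sup>2"
    by (induction A) (auto simp: power_mult_distrib)
  finally show "mahler (graeffe p) = (mahler p)\<^sup>2"
    by (simp add: g A(3) mahler_smult norm_power power_mult_distrib)
  have "?R \<noteq> 0" using nz by (auto simp: prod_mset_zero_iff)
  then show "graeffe p \<noteq> 0" using A(1) by (simp add: g)
qed

lemma graeffe_iterate:
  assumes "p \<noteq> 0"
  shows "(graeffe ^^ k) p \<noteq> 0 \<and> mahler ((graeffe ^^ k) p) = mahler p ^ 2 ^ k \<and> degree ((graeffe ^^ k) p) \<le> degree p"
  using assms
proof (induction k)
  case (Suc k)
  then show ?case
    using mahler_graeffe[of "(graeffe ^^ k) p"] order_trans[OF degree_graeffe[of "(graeffe ^^ k) p"]]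
    by (simp add: power_mult[symmetric] mult.commute)
qed simp

text \<open>The \<open>k\<close>-th Graeffe iterate has Mahler measure
  \<open>mahler (P u) ^ 2 ^ k\<close> and still degree below \<open>n\<close>. Taking logarithms and
  dividing by \<open>2 ^ k\<close> shrinks the gap to the coefficient norm to
  \<open>n * ln 2 / 2 ^ k\<close>, uniformly in \<open>u\<close>. So
  \<open>ln (mahler (P u))\<close> is a uniform limit of continuous functions, even where the
  leading coefficient vanishes.\<close>

lemma continuous_on_mahler:
  fixes P :: "real \<Rightarrow> complex poly"
  assumes deg: "\<And>u. degree (P u) < n" and nz: "\<And>u. P u \<noteq> 0"
    and cont: "\<And>i. continuous_on UNIV (\<lambda>u. coeff (P u) i)"
  shows "continuous_on UNIV (\<lambda>u. mahler (P u))"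
proof -
  let ?N = "\<lambda>k u. \<Sum>m<n. cmod (coeff ((graeffe ^^ k) (P u)) m)"
  have c: "continuous_on UNIV (\<lambda>u. coeff ((graeffe ^^ k) (P u)) i)" for k i
  proof (induction k arbitrary: i)
    case (Suc k)
    have "coeff ((graeffe ^^ Suc k) (P u)) i = (\<Sum>j\<le>2 * i. coeff ((graeffe ^^ k) (P u)) j * ((-1) ^ (2 * i - j) * coeff ((graeffe ^^ k) (P u)) (2 * i - j)))" for u
      by (simp add: coeff_graeffe coeff_mult coeff_pcompose_linear)
    then show ?case using Suc by (auto intro!: continuous_intros)
  qed (simp add: cont)
  have bounds: "?N k u \<le> 2 ^ n * mahler (P u) ^ 2 ^ k" "mahler (P u) ^ 2 ^ k \<le> ?N k u" for k u
    using graeffe_iterate[OF nz[of u], of k] mahler_le_l1[of "(graeffe ^^ k) (P u)" n] l1_le_mahler[of "(graeffe ^^ k) (P u)" n] deg[of u]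
    by auto
  have mp: "mahler (P u) > 0" for u by (rule mahler_pos[OF nz])
  have Np: "?N k u > 0" for k u
    using bounds(2)[of u k] mp[of u] by (meson less_le_trans zero_less_power)
  have dist_le: "\<bar>ln (?N k u) / 2 ^ k - ln (mahler (P u))\<bar> \<le> real n * ln 2 / 2 ^ k" for k u
  proof -
    have l: "ln (mahler (P u) ^ 2 ^ k) = 2 ^ k * ln (mahler (P u))" using mp by (simp add: ln_realpow)
    have "ln (?N k u) \<le> ln (2 ^ n * mahler (P u) ^ 2 ^ k)" using bounds(1)[of k u] Np[of k u] mp[of u] by (subst ln_le_cancel_iff) auto
    also have "\<dots> = real n * ln 2 + 2 ^ k * ln (mahler (P u))" using mp[of u] l by (subst ln_mult) (auto simp: ln_realpow)
    finally have 1: "ln (?N k u) - 2 ^ k * ln (mahler (P u)) \<le> real n * ln 2" by simp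
    have 2: "ln (?N k u) - 2 ^ k * ln (mahler (P u)) \<ge> 0"
      using bounds(2)[of u k] Np[of k u] mp[of u] unfolding l[symmetric] by (simp add: ln_mono)
    have "ln (?N k u) / 2 ^ k - ln (mahler (P u)) = (ln (?N k u) - 2 ^ k * ln (mahler (P u))) / 2 ^ k"
      by (simp add: field_simps)
    then show ?thesis using 1 2 by (simp add: divide_right_mono)
  qed
  have "continuous_on UNIV (\<lambda>u. ln (mahler (P u)))"
  proof (rule uniform_limit_theorem)
    show "\<forall>\<^sub>F k in sequentially. continuous_on UNIV (\<lambda>u. ln (?N k u) / 2 ^ k)"
      using Np by (intro always_eventually allI continuous_intros c) (auto simp: less_imp_neq[symmetric])
    show "uniform_limit UNIV (\<lambda>k u. ln (?N k u) / 2 ^ k) (\<lambda>u. ln (mahler (P u))) sequentially"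
    proof (rule uniform_limitI)
      fix e :: real assume e: "e > 0"
      have "(\<lambda>k. real n * ln 2 * (1 / 2) ^ k) \<longlonglongrightarrow> real n * ln 2 * 0"
        by (intro tendsto_intros LIMSEQ_power_zero) auto
      then have "(\<lambda>k. real n * ln 2 / 2 ^ k) \<longlonglongrightarrow> 0" by (simp only: power_one_over times_divide_eq_right mult_1_right mult_zero_right)
      from order_tendstoD(2)[OF this e] show "\<forall>\<^sub>F k in sequentially. \<forall>u\<in>UNIV. dist (ln (?N k u) / 2 ^ k) (ln (mahler (P u))) < e"
        by eventually_elim (use dist_le in \<open>auto simp: dist_real_def intro: le_less_trans\<close>)
    qed
  qed simp
  then have "continuous_on UNIV (\<lambda>u. exp (ln (mahler (P u))))" by (rule continuous_on_exp)
  then show ?thesis using mp by simp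
qed

section \<open>Conjugation-closed root sets\<close>

text \<open>A vanishing Wronskian makes \<open>D / N\<close> a series with zero derivative, hence
  the constant 1. The Wronskian matters because it vanishes at every multiple root of a combination
  \<open>D - \<zeta> * N\<close>.\<close>

lemma wronskian_nonzero:
  fixes N D :: "complex poly"
  assumes N0: "poly N 0 = 1" and D0: "poly D 0 = 1" and neq: "D \<noteq> N"
  shows "D * pderiv N - pderiv D * N \<noteq> 0"
proof
  assume "D * pderiv N - pderiv D * N = 0"
  then have "fps_of_poly (D * pderiv N) = fps_of_poly (pderiv D * N)" by simp
  then have W: "fps_of_poly D * fps_deriv (fps_of_poly N) = fps_deriv (fps_of_poly D) * fps_of_poly N"
    by (simp add: fps_of_poly_mult fps_of_poly_pderiv)
  let ?N = "fps_of_poly N"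
  have n0: "fps_nth ?N 0 = 1" "fps_nth (fps_of_poly D) 0 = 1" using N0 D0 by (simp_all add: poly_0_coeff_0)
  then have nz: "?N \<noteq> 0" by auto
  define h where "h = fps_of_poly D * inverse ?N"
  have D: "fps_of_poly D = h * ?N" using n0 inverse_mult_eq_1[of ?N] by (simp add: h_def mult.assoc)
  have "fps_deriv h * ?N * ?N = 0"
    using W unfolding D by (simp add: algebra_simps)
  then have "fps_deriv h = 0" using nz by simp
  then have "h = fps_const (fps_nth h 0)" by simp
  moreover have "fps_nth h 0 = 1" using n0 by (simp add: h_def)
  ultimately have "h = 1" by simp
  then show False using D neq fps_of_poly_eq_iff[of D N] by simp
qed

text \<open>The set \<open>S\<close> of roots belonging to \<open>\<zeta>0\<close> need not be closed under conjugation, and adding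
  the missing conjugates would exceed the power. Instead \<open>\<zeta>\<close> is moved away from 0 until the
  set \<open>W\<close> of all roots in the disc just meets the power constraint; this only increases the
  product, because the constraint ties it to \<open>1 + \<zeta>\<^sup>2 c\<close>.\<close>

lemma conjugate_closed_roots_exist:
  fixes N D :: "complex poly" and \<zeta>0 c R :: real
  assumes N0: "poly N 0 = 1" and D0: "poly D 0 = 1"
    and N: "\<And>w. cmod w \<le> 1 \<Longrightarrow> poly N w \<noteq> 0" and D: "\<And>w. cmod w \<le> 1 \<Longrightarrow> poly D w \<noteq> 0"
    and cnj: "\<And>w. poly N (cnj w) = cnj (poly N w)" "\<And>w. poly D (cnj w) = cnj (poly D w)"
    and \<zeta>0: "\<zeta>0 \<noteq> 0" and c: "c > 0"
    and S: "finite S" "\<And>w. w \<in> S \<Longrightarrow> 0 < cmod w \<and> cmod w < 1" "\<And>w. w \<in> S \<Longrightarrow> poly D w = of_real \<zeta>0 * poly N w"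
      "S \<noteq> {}"
    and prod: "(\<Prod>w\<in>S. 1 / cmod w)\<^sup>2 = 1 + \<zeta>0\<^sup>2 * c"
    and R: "1 \<le> R" "R < (\<Prod>w\<in>S. 1 / cmod w)"
  shows "\<exists>\<zeta> W. \<zeta> \<noteq> 0 \<and> finite W \<and> (\<forall>w\<in>W. cnj w \<in> W \<and> 0 < cmod w \<and> cmod w < 1 \<and> poly D w = of_real \<zeta> * poly N w) \<and>
     (\<Prod>w\<in>W. 1 / cmod w)\<^sup>2 < 1 + \<zeta>\<^sup>2 * c \<and> R < (\<Prod>w\<in>W. 1 / cmod w)"
proof (cases "D = N")
  \<comment> \<open>Here the noise is white and every point solves the equation with
    \<open>\<zeta> = 1\<close>, so one real point of modulus \<open>1 / R'\<close> will do.\<close>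
  case True
  obtain v where v: "v \<in> S" using S by auto
  have "poly N v \<noteq> 0" using N S(2)[OF v] by simp
  then have "\<zeta>0 = 1" using S(3)[OF v] True by simp
  obtain R' where R': "R < R'" "R' < (\<Prod>w\<in>S. 1 / cmod w)" using R(2) dense by blast
  have "R'\<^sup>2 < (\<Prod>w\<in>S. 1 / cmod w)\<^sup>2" using R R' by (intro power_strict_mono) auto
  then have "R'\<^sup>2 < 1 + 1\<^sup>2 * c" using prod \<open>\<zeta>0 = 1\<close> by simp
  then show ?thesis using R R' True
    by (intro exI[of _ 1] exI[of _ "{of_real (1 / R')}"]) (auto simp: norm_divide)
next
  case False
  define p where "p u = D - smult (of_real u) N" for u :: real
  have poly_p: "poly (p u) w = poly D w - of_real u * poly N w" for u w by (simp add: p_def)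
  have p0: "cmod (poly (p u) 0) = \<bar>1 - u\<bar>" for u
    unfolding poly_p N0 D0 by (metis mult_1_right norm_of_real of_real_1 of_real_diff)
  have nz: "p u \<noteq> 0" for u
  proof
    assume "p u = 0"
    then have "D = smult (of_real u) N" by (simp add: p_def)
    moreover from this have "u = 1" using N0 D0 by simp
    ultimately show False using False by simp
  qed
  define n where "n = Suc (max (degree D) (degree N))"
  have deg: "degree (p u) < n" for u
    unfolding p_def n_def
    by (intro le_imp_less_Suc degree_diff_le) (auto intro: order_trans[OF degree_smult_le])
  have contM: "continuous_on UNIV (\<lambda>u. mahler (p u))"
    by (rule continuous_on_mahler[OF deg nz]) (auto simp: p_def intro!: continuous_intros)
  have M_pos: "mahler (p u) > 0" for u by (rule mahler_pos[OF nz])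
  \<comment> \<open>A finite set containing all \<open>u\<close> for which \<open>D - u * N\<close>
    has a multiple root in the disc, and the value 1, for which 0 is a root.\<close>
  define Bad where "Bad = insert 1 ((\<lambda>w. Re (poly D w / poly N w)) ` {w. poly (D * pderiv N - pderiv D * N) w = 0})"
  have finBad: "finite Bad"
    unfolding Bad_def using poly_roots_finite[OF wronskian_nonzero[OF N0 D0 False]] by simp
  have simple: "poly (pderiv (p u)) w \<noteq> 0" if "u \<notin> Bad" "cmod w < 1" "poly (p u) w = 0" for u w
  proof
    assume "poly (pderiv (p u)) w = 0"
    then have 1: "poly (pderiv D) w = of_real u * poly (pderiv N) w"
      by (simp add: p_def pderiv_diff pderiv_smult)
    have 2: "poly D w = of_real u * poly N w" using that by (simp add: poly_p)
    have "poly (D * pderiv N - pderiv D * N) w = 0" using 1 2 by simp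
    moreover have "u = Re (poly D w / poly N w)" using 2 N[of w] that by simp
    ultimately have "u \<in> Bad" by (auto simp: Bad_def)
    then show False using that by simp
  qed
  \<comment> \<open>\<open>D / N\<close> is bounded on the closed disc, so \<open>D - u * N\<close>
    has no root there once \<open>\<bar>u\<bar> > B\<close>.\<close>
  obtain B where B: "\<And>w. cmod w \<le> 1 \<Longrightarrow> cmod (poly D w / poly N w) \<le> B"
  proof -
    have "continuous_on (cball 0 1) (\<lambda>w. poly D w / poly N w)"
      using N by (intro continuous_intros) auto
    then have "bounded ((\<lambda>w. poly D w / poly N w) ` cball 0 1)"
      by (intro compact_imp_bounded compact_continuous_image) auto
    then obtain B where "\<forall>w\<in>cball 0 1. cmod (poly D w / poly N w) \<le> B" by (auto simp: bounded_iff)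
    then show ?thesis using that[of B] by simp
  qed
  define s where "s = sgn \<zeta>0"
  have s: "s = 1 \<or> s = -1" "s * \<bar>\<zeta>0\<bar> = \<zeta>0" using \<zeta>0 by (auto simp: s_def sgn_if)
  have s2: "(s * u)\<^sup>2 = u\<^sup>2" "\<bar>s * u\<bar> = \<bar>u\<bar>" for u using s(1) by auto
  \<comment> \<open>For \<open>\<zeta>0\<close> in \<open>(0, 1]\<close> the search starts at 1,
    where the value at 0 vanishes and \<open>\<psi>\<close> is the square of a Mahler measure.
    Otherwise \<open>\<psi> a \<ge> 0\<close> is Jensen's inequality for the roots in
    \<open>S\<close>.\<close>
  define a where "a = (if 0 < \<zeta>0 \<and> \<zeta>0 \<le> 1 then 1 else \<bar>\<zeta>0\<bar>)"
  have a: "a \<ge> \<bar>\<zeta>0\<bar>" "a > 0" using \<zeta>0 by (auto simp: a_def)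
  define b where "b = max (max a B) 1 + 1"
  have b: "b > a" "b > B" "b \<ge> 2" by (auto simp: b_def)
  \<comment> \<open>The sign of \<open>\<psi>\<close> tells whether the squared product of
    \<open>1 / cmod w\<close> over all roots in the disc, with multiplicity, reaches
    \<open>1 + u\<^sup>2 * c\<close>. Multiplication by the squared value at 0 keeps this meaningful
    at \<open>s * u = 1\<close>.\<close>
  define \<psi> where "\<psi> u = (mahler (p (s * u)))\<^sup>2 - (1 - s * u)\<^sup>2 * (1 + u\<^sup>2 * c)" for u
  have contMs: "continuous_on A (\<lambda>u. mahler (p (s * u)))" for A
    by (rule continuous_on_compose2[OF contM]) (auto intro: continuous_intros)
  have cont\<psi>: "continuous_on A \<psi>" for A
    unfolding \<psi>_def by (intro continuous_intros contMs)
  let ?\<Lambda> = "\<Prod>w\<in>S. 1 / cmod w"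
  have prod_pos: "(\<Prod>w\<in>S. cmod w) > 0" using S by (intro prod_pos) auto
  have "\<psi> a \<ge> 0"
  proof (cases "0 < \<zeta>0 \<and> \<zeta>0 \<le> 1")
    case True
    then show ?thesis by (simp add: \<psi>_def a_def s_def)
  next
    case False
    then have "a = \<bar>\<zeta>0\<bar>" unfolding a_def by (rule if_not_P)
    then have sa: "s * a = \<zeta>0" using s(2) by simp
    have "\<bar>1 - \<zeta>0\<bar> \<le> mahler (p \<zeta>0) * (\<Prod>w\<in>S. cmod w)"
      unfolding p0[symmetric] by (rule mahler_ge_roots[OF nz S(1)]) (use S in \<open>auto simp: poly_p less_imp_le\<close>)
    then have "\<bar>1 - \<zeta>0\<bar> * ?\<Lambda> \<le> mahler (p \<zeta>0)"
      using prod_pos by (simp add: prod_dividef pos_divide_le_eq)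
    then have "(\<bar>1 - \<zeta>0\<bar> * ?\<Lambda>)\<^sup>2 \<le> (mahler (p \<zeta>0))\<^sup>2"
      using R by (intro power_mono mult_nonneg_nonneg) auto
    then have "(1 - \<zeta>0)\<^sup>2 * (1 + \<zeta>0\<^sup>2 * c) \<le> (mahler (p \<zeta>0))\<^sup>2" by (simp add: power_mult_distrib prod)
    moreover have "a\<^sup>2 = \<zeta>0\<^sup>2" using sa s2(1)[of a] by simp
    ultimately show ?thesis by (simp add: \<psi>_def sa)
  qed
  have "\<psi> b < 0"
  proof -
    have no: "poly (p (s * b)) w \<noteq> 0" if "cmod w < 1" for w
    proof
      assume "poly (p (s * b)) w = 0"
      then have "poly D w / poly N w = of_real (s * b)" using N[of w] that by (simp add: poly_p)
      then have "cmod (poly D w / poly N w) = \<bar>s * b\<bar>" by (simp only: norm_of_real)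
      also have "\<dots> = b" using s2(2)[of b] b a by simp
      finally show False using B[of w] that b by simp
    qed
    have "mahler (p (s * b)) = \<bar>1 - s * b\<bar>" unfolding p0[symmetric] by (rule mahler_eq_poly_0[OF nz no])
    then have "\<psi> b = - ((1 - s * b)\<^sup>2 * (b\<^sup>2 * c))" by (simp add: \<psi>_def algebra_simps)
    moreover have "s * b \<noteq> 1" using s(1) b by auto
    ultimately show ?thesis using b c by simp
  qed
  \<comment> \<open>Between the last point \<open>u0\<close> of this compact set and
    \<open>b\<close> the power constraint holds strictly, while at \<open>u0\<close> itself the
    product is still large.\<close>
  define T where "T = {u \<in> {a..b}. \<psi> u \<ge> 0}"
  have "T = {a..b} \<inter> \<psi> -` {0..}" by (auto simp: T_def)
  then have "closed T"
    using continuous_closed_preimage[OF cont\<psi>[of "{a..b}"] closed_atLeastAtMost closed_atLeast[of 0]] by simp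
  moreover have "bounded T" unfolding T_def by (rule bounded_subset[of "{a..b}"]) auto
  ultimately have "compact T" by (simp add: compact_eq_bounded_closed)
  moreover have "a \<in> T" using \<open>\<psi> a \<ge> 0\<close> b by (simp add: T_def)
  ultimately obtain u0 where u0: "u0 \<in> T" "\<And>u. u \<in> T \<Longrightarrow> u \<le> u0"
    using compact_attains_sup[of T] by auto
  have u0_ge: "u0 \<ge> a" and u0_psi: "\<psi> u0 \<ge> 0" using u0 by (auto simp: T_def)
  have u0_lt: "u0 < b" using u0(1) \<open>\<psi> b < 0\<close> by (cases "u0 = b") (auto simp: T_def)
  \<comment> \<open>At \<open>u0\<close> the squared product is at least
    \<open>1 + u0\<^sup>2 * c\<close>, hence at least \<open>1 + \<zeta>0\<^sup>2 * c\<close>, which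
    exceeds \<open>R\<^sup>2\<close>. Scaled by the squared value at 0, the strict inequality also
    covers \<open>s * u0 = 1\<close> and persists to the right of \<open>u0\<close>.\<close>
  have key: "(mahler (p (s * u0)))\<^sup>2 - R\<^sup>2 * (1 - s * u0)\<^sup>2 > 0"
  proof (cases "s * u0 = 1")
    case True
    then show ?thesis using M_pos[of 1] by simp
  next
    case False
    have "\<zeta>0\<^sup>2 \<le> u0\<^sup>2" using u0_ge a by (simp add: abs_le_square_iff[symmetric])
    then have "1 + \<zeta>0\<^sup>2 * c \<le> 1 + u0\<^sup>2 * c" using c by simp
    moreover have "R\<^sup>2 < 1 + \<zeta>0\<^sup>2 * c" unfolding prod[symmetric] using R by (intro power_strict_mono) auto
    ultimately have "R\<^sup>2 < 1 + u0\<^sup>2 * c" by simp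
    then have "(1 - s * u0)\<^sup>2 * R\<^sup>2 < (1 - s * u0)\<^sup>2 * (1 + u0\<^sup>2 * c)"
      using False by (intro mult_strict_left_mono) auto
    also have "\<dots> \<le> (mahler (p (s * u0)))\<^sup>2" using u0_psi by (simp add: \<psi>_def)
    finally show ?thesis by (simp add: mult.commute)
  qed
  have "continuous_on UNIV (\<lambda>u. (mahler (p (s * u)))\<^sup>2 - R\<^sup>2 * (1 - s * u)\<^sup>2)"
    by (intro continuous_intros contMs)
  then have "((\<lambda>u. (mahler (p (s * u)))\<^sup>2 - R\<^sup>2 * (1 - s * u)\<^sup>2) \<longlongrightarrow> (mahler (p (s * u0)))\<^sup>2 - R\<^sup>2 * (1 - s * u0)\<^sup>2) (at_right u0)"
    by (auto simp: continuous_on_def intro: tendsto_within_subset)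
  from order_tendstoD(1)[OF this key]
  obtain d where d: "d > u0" "\<And>u. u0 < u \<Longrightarrow> u < d \<Longrightarrow> (mahler (p (s * u)))\<^sup>2 - R\<^sup>2 * (1 - s * u)\<^sup>2 > 0"
    by (auto simp: eventually_at_right_field)
  \<comment> \<open>A parameter just to the right of \<open>u0\<close> and off the finite set
    \<open>Bad\<close> has simple roots, so the set \<open>W\<close>, which ignores multiplicities,
    gives the full product.\<close>
  have "infinite {u0<..<min d b}" using d(1) u0_lt by (intro infinite_Ioo) simp
  moreover have "finite {u. s * u \<in> Bad}"
  proof -
    have "{u. s * u \<in> Bad} \<subseteq> (\<lambda>x. s * x) ` Bad" using s(1) by (force simp: image_iff)
    then show ?thesis using finBad finite_subset by blast
  qed
  ultimately have "infinite ({u0<..<min d b} - {u. s * u \<in> Bad})" by (rule Diff_infinite_finite[rotated])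
  then obtain u where u: "u0 < u" "u < d" "u < b" "s * u \<notin> Bad"
    by (metis (no_types, lifting) DiffE finite.emptyI ex_in_conv greaterThanLessThan_iff mem_Collect_eq min_less_iff_conj)
  define \<zeta> where "\<zeta> = s * u"
  have \<zeta>: "\<zeta> \<notin> Bad" "\<zeta> \<noteq> 1" "\<zeta> \<noteq> 0" "\<zeta>\<^sup>2 = u\<^sup>2"
    using u u0_ge a s(1) by (auto simp: \<zeta>_def Bad_def)
  define W where "W = {w. cmod w < 1 \<and> poly (p \<zeta>) w = 0}"
  have W: "finite W" "mahler (p \<zeta>) * (\<Prod>w\<in>W. cmod w) = \<bar>1 - \<zeta>\<bar>"
    unfolding W_def using mahler_simple_roots[OF nz simple[OF \<zeta>(1)]] by (simp_all add: p0)
  have W_mem: "cnj w \<in> W \<and> 0 < cmod w \<and> cmod w < 1 \<and> poly D w = of_real \<zeta> * poly N w" if "w \<in> W" for w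
  proof (intro conjI)
    show w1: "cmod w < 1" and eq: "poly D w = of_real \<zeta> * poly N w" using that by (auto simp: W_def poly_p)
    have "poly (p \<zeta>) (cnj w) = cnj (poly (p \<zeta>) w)" by (simp add: poly_p cnj)
    then show "cnj w \<in> W" using that by (simp add: W_def)
    have "w \<noteq> 0" using eq N0 D0 \<zeta>(2) by auto
    then show "0 < cmod w" by simp
  qed
  have Wpos: "(\<Prod>w\<in>W. cmod w) > 0" using W_mem by (intro Groups_Big.linordered_semidom_class.prod_pos) auto
  have L: "(\<Prod>w\<in>W. 1 / cmod w) * \<bar>1 - \<zeta>\<bar> = mahler (p \<zeta>)"
    unfolding W(2)[symmetric] using Wpos by (simp add: prod_dividef)
  have z1: "\<bar>1 - \<zeta>\<bar> > 0" using \<zeta> by simp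
  have L0: "(\<Prod>w\<in>W. 1 / cmod w) \<ge> 0" by (intro prod_nonneg) auto
  have "\<not> \<psi> u \<ge> 0" using u0(2)[of u] u u0_ge by (auto simp: T_def)
  then have "(mahler (p \<zeta>))\<^sup>2 < \<bar>1 - \<zeta>\<bar>\<^sup>2 * (1 + \<zeta>\<^sup>2 * c)"
    using \<zeta>(4) by (simp add: \<psi>_def \<zeta>_def[symmetric])
  then have "(\<Prod>w\<in>W. 1 / cmod w)\<^sup>2 < 1 + \<zeta>\<^sup>2 * c"
    unfolding L[symmetric] power_mult_distrib using z1 by (simp add: mult.commute)
  moreover have "R < (\<Prod>w\<in>W. 1 / cmod w)"
  proof -
    have "(R * \<bar>1 - \<zeta>\<bar>)\<^sup>2 < ((\<Prod>w\<in>W. 1 / cmod w) * \<bar>1 - \<zeta>\<bar>)\<^sup>2"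
      unfolding L using d(2)[OF u(1,2)] by (simp add: power_mult_distrib \<zeta>_def)
    then have "R * \<bar>1 - \<zeta>\<bar> < (\<Prod>w\<in>W. 1 / cmod w) * \<bar>1 - \<zeta>\<bar>"
      by (rule power_less_imp_less_base) (use L0 z1 in auto)
    then show ?thesis using z1 by simp
  qed
  ultimately show ?thesis using \<zeta>(3) W(1) W_mem by blast
qed

section \<open>ARMA noise\<close>

context prob_space
begin

text \<open>By monotone convergence the sum has finite expectation, so it is finite almost
  surely.\<close>

lemma AE_summable:
  fixes f :: "nat \<Rightarrow> 'a \<Rightarrow> real"
  assumes int: "\<And>j. integrable M (f j)" and nn: "\<And>j \<omega>. f j \<omega> \<ge> 0"
    and sum: "summable (\<lambda>j. \<integral>\<omega>. f j \<omega> \<partial>M)"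
  shows "AE \<omega> in M. summable (\<lambda>j. f j \<omega>)"
proof -
  have [measurable]: "f j \<in> borel_measurable M" for j using int by auto
  have "(\<integral>\<^sup>+\<omega>. (\<Sum>j. ennreal (f j \<omega>)) \<partial>M) = (\<Sum>j. \<integral>\<^sup>+\<omega>. ennreal (f j \<omega>) \<partial>M)"
    by (rule nn_integral_suminf) simp
  also have "\<dots> = (\<Sum>j. ennreal (\<integral>\<omega>. f j \<omega> \<partial>M))"
    using nn_integral_eq_integral[OF int] nn by simp
  also have "\<dots> \<noteq> \<infinity>"
    using sum nn by (simp add: suminf_ennreal2 integral_nonneg_AE)
  finally have "AE \<omega> in M. (\<Sum>j. ennreal (f j \<omega>)) \<noteq> \<infinity>"
    by (intro nn_integral_PInf_AE) auto
  then show ?thesis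
  proof eventually_elim
    case (elim \<omega>)
    show ?case by (rule summable_suminf_not_top) (use nn elim in simp_all)
  qed
qed

text \<open>\<open>y\<close> is given only as an almost sure limit. Cauchy-Schwarz dominates its
  square by a multiple of the integrable series of
  \<open>\<bar>h j\<bar> * (x j \<omega>)\<^sup>2\<close>; for the mean,
  \<open>\<bar>t\<bar> \<le> 1 + t\<^sup>2\<close> justifies exchanging sum and integral.\<close>

lemma summable_filter_moments:
  fixes h :: "nat \<Rightarrow> real" and x :: "nat \<Rightarrow> 'a \<Rightarrow> real" and y :: "'a \<Rightarrow> real"
  assumes h: "summable (\<lambda>j. \<bar>h j\<bar>)"
    and x: "\<And>j. x j \<in> borel_measurable M" "\<And>j. integrable M (\<lambda>\<omega>. (x j \<omega>)\<^sup>2)"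
      "\<And>j. expectation (\<lambda>\<omega>. (x j \<omega>)\<^sup>2) = B" "\<And>j. expectation (x j) = 0"
    and y: "y \<in> borel_measurable M" "AE \<omega> in M. (\<lambda>j. h j * x j \<omega>) sums y \<omega>"
  shows "integrable M (\<lambda>\<omega>. (y \<omega>)\<^sup>2)" "expectation y = 0"
proof -
  let ?S = "\<Sum>j. \<bar>h j\<bar>"
  have S: "?S \<ge> 0" using h by (rule suminf_nonneg) simp
  have x_int: "integrable M (x j)" for j by (rule square_integrable_imp_integrable[OF x(1,2)])
  have sq_int: "integrable M (\<lambda>\<omega>. \<bar>h j\<bar> * (x j \<omega>)\<^sup>2)" for j using x(2) by simp
  have sum_sq: "summable (\<lambda>j. \<integral>\<omega>. \<bar>h j\<bar> * (x j \<omega>)\<^sup>2 \<partial>M)"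
    using h by (simp add: x(3) summable_mult2)
  have AE_sq: "AE \<omega> in M. summable (\<lambda>j. \<bar>h j\<bar> * (x j \<omega>)\<^sup>2)"
    by (rule AE_summable[OF sq_int _ sum_sq]) simp
  have g_int: "integrable M (\<lambda>\<omega>. \<Sum>j. \<bar>h j\<bar> * (x j \<omega>)\<^sup>2)"
    by (rule integrable_suminf[OF sq_int]) (use AE_sq sum_sq in \<open>simp_all add: abs_mult\<close>)
  have [measurable]: "(\<lambda>\<omega>. \<Sum>j. \<bar>h j\<bar> * (x j \<omega>)\<^sup>2) \<in> borel_measurable M" using g_int by auto
  show "integrable M (\<lambda>\<omega>. (y \<omega>)\<^sup>2)"
  proof (rule Bochner_Integration.integrable_bound)
    show "integrable M (\<lambda>\<omega>. ?S * (\<Sum>j. \<bar>h j\<bar> * (x j \<omega>)\<^sup>2))" using g_int by simp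
    show "(\<lambda>\<omega>. (y \<omega>)\<^sup>2) \<in> borel_measurable M" using y(1) by simp
    show "AE \<omega> in M. norm ((y \<omega>)\<^sup>2) \<le> norm (?S * (\<Sum>j. \<bar>h j\<bar> * (x j \<omega>)\<^sup>2))"
      using AE_sq y(2)
    proof eventually_elim
      case (elim \<omega>)
      have lim: "(\<lambda>n. (\<Sum>j<n. h j * x j \<omega>)\<^sup>2) \<longlonglongrightarrow> (y \<omega>)\<^sup>2"
        using elim(2) unfolding sums_def by (intro tendsto_intros)
      have "(\<Sum>j<n. h j * x j \<omega>)\<^sup>2 \<le> ?S * (\<Sum>j. \<bar>h j\<bar> * (x j \<omega>)\<^sup>2)" for n
      proof -
        have "(\<Sum>j<n. h j * x j \<omega>)\<^sup>2 \<le> (\<Sum>j<n. \<bar>h j\<bar>) * (\<Sum>j<n. \<bar>h j\<bar> * (x j \<omega>)\<^sup>2)"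
          by (rule weighted_Cauchy_Schwarz)
        also have "\<dots> \<le> ?S * (\<Sum>j. \<bar>h j\<bar> * (x j \<omega>)\<^sup>2)"
          using elim(1) h S by (intro mult_mono sum_le_suminf sum_nonneg) auto
        finally show ?thesis .
      qed
      then have "(y \<omega>)\<^sup>2 \<le> ?S * (\<Sum>j. \<bar>h j\<bar> * (x j \<omega>)\<^sup>2)"
        using lim by (intro LIMSEQ_le_const2[OF lim]) auto
      then show ?case by simp
    qed
  qed
  have abs_le: "\<bar>h j * x j \<omega>\<bar> \<le> \<bar>h j\<bar> + \<bar>h j\<bar> * (x j \<omega>)\<^sup>2" for j \<omega>
  proof -
    have "\<bar>x j \<omega>\<bar> \<le> 1 + (x j \<omega>)\<^sup>2"
      using zero_le_power2[of "\<bar>x j \<omega>\<bar> - 1"] by (simp add: power2_diff)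
    then have "\<bar>h j\<bar> * \<bar>x j \<omega>\<bar> \<le> \<bar>h j\<bar> * (1 + (x j \<omega>)\<^sup>2)" by (rule mult_left_mono) simp
    then show ?thesis by (simp add: abs_mult distrib_left)
  qed
  have hx_int: "integrable M (\<lambda>\<omega>. h j * x j \<omega>)" for j using x_int by simp
  have "AE \<omega> in M. summable (\<lambda>j. norm (h j * x j \<omega>))"
    using AE_sq
  proof eventually_elim
    case (elim \<omega>)
    show ?case by (rule summable_comparison_test'[OF summable_add[OF h elim]]) (simp add: abs_le)
  qed
  moreover have "summable (\<lambda>j. \<integral>\<omega>. norm (h j * x j \<omega>) \<partial>M)"
  proof (rule summable_comparison_test'[OF summable_add[OF h sum_sq]])
    fix j
    have "(\<integral>\<omega>. norm (h j * x j \<omega>) \<partial>M) \<le> (\<integral>\<omega>. \<bar>h j\<bar> + \<bar>h j\<bar> * (x j \<omega>)\<^sup>2 \<partial>M)"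
      using hx_int sq_int abs_le by (intro integral_mono) auto
    also have "\<dots> = \<bar>h j\<bar> + (\<integral>\<omega>. \<bar>h j\<bar> * (x j \<omega>)\<^sup>2 \<partial>M)"
      using x(2) by (simp add: prob_space)
    finally show "norm (\<integral>\<omega>. norm (h j * x j \<omega>) \<partial>M) \<le> \<bar>h j\<bar> + (\<integral>\<omega>. \<bar>h j\<bar> * (x j \<omega>)\<^sup>2 \<partial>M)"
      by (simp add: integral_nonneg_AE)
  qed
  ultimately have "(\<integral>\<omega>. (\<Sum>j. h j * x j \<omega>) \<partial>M) = (\<Sum>j. \<integral>\<omega>. h j * x j \<omega> \<partial>M)"
    by (rule integral_suminf[OF hx_int])
  also have "\<dots> = 0" by (simp add: x(4))
  also have "(\<integral>\<omega>. (\<Sum>j. h j * x j \<omega>) \<partial>M) = expectation y"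
  proof (rule integral_cong_AE)
    show "AE \<omega> in M. (\<Sum>j. h j * x j \<omega>) = y \<omega>" using y(2) by eventually_elim (simp add: sums_iff)
    show "(\<lambda>\<omega>. \<Sum>j. h j * x j \<omega>) \<in> borel_measurable M" using x(1) by measurable
  qed (rule y)
  finally show "expectation y = 0" .
qed

lemma white_gaussian_moments:
  assumes w: "white_gaussian M \<sigma> w" and \<sigma>: "\<sigma> > 0"
  shows "w k \<in> borel_measurable M" "expectation (w k) = 0"
    "integrable M (\<lambda>\<omega>. w i \<omega> * w j \<omega>)"
    "expectation (\<lambda>\<omega>. w i \<omega> * w j \<omega>) = (if i = j then \<sigma>\<^sup>2 else 0)"
proof -
  have dist: "distributed M lborel (w k) (normal_density 0 \<sigma>)" for k
    using w by (simp add: white_gaussian_def)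
  have indep: "indep_vars (\<lambda>_. borel) w UNIV" using w by (simp add: white_gaussian_def)
  have meas: "w k \<in> borel_measurable M" for k using distributed_measurable[OF dist] by simp
  then show "w k \<in> borel_measurable M" .
  have int: "integrable M (w k)" for k
    by (rule distributed_integrable_var[OF dist]) (auto intro: integrable_normal_moment_nz_1 \<sigma>)
  have mean: "expectation (w k) = 0" for k
    by (rule normal_distributed_expectation[OF \<sigma> dist])
  then show "expectation (w k) = 0" .
  have sq: "integrable M (\<lambda>\<omega>. (w k \<omega>)\<^sup>2)" for k
    using distributed_integrable[OF dist, of "\<lambda>x. x\<^sup>2" k] integrable_normal_moment[OF \<sigma>, of 0 2] by simp
  have var: "expectation (\<lambda>\<omega>. (w k \<omega>)\<^sup>2) = \<sigma>\<^sup>2" for k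
    using normal_distributed_variance[OF \<sigma> dist[of k]] unfolding mean by simp
  have prod: "integrable M (\<lambda>\<omega>. w i \<omega> * w j \<omega>) \<and> expectation (\<lambda>\<omega>. w i \<omega> * w j \<omega>) = 0" if "i \<noteq> j" for i j
  proof -
    have I: "indep_vars (\<lambda>_. borel) w {i, j}" by (rule indep_vars_subset[OF indep]) simp
    show ?thesis
      using indep_vars_lebesgue_integral[OF _ I] indep_vars_integrable[OF _ I] int mean that by simp
  qed
  show "integrable M (\<lambda>\<omega>. w i \<omega> * w j \<omega>)"
    using prod[of i j] sq[of i] by (cases "i = j") (auto simp: power2_eq_square)
  show "expectation (\<lambda>\<omega>. w i \<omega> * w j \<omega>) = (if i = j then \<sigma>\<^sup>2 else 0)"
    using prod[of i j] var[of i] by (auto simp: power2_eq_square)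
qed

end

section \<open>The ARMA series and whitening without the past\<close>

definition arma_num_fps :: "(nat \<Rightarrow> real) \<Rightarrow> nat \<Rightarrow> real fps" where
  "arma_num_fps g q = 1 + (\<Sum>j=1..q. fps_const (g j) * fps_X ^ j)"

definition arma_den_fps :: "(nat \<Rightarrow> real) \<Rightarrow> nat \<Rightarrow> real fps" where
  "arma_den_fps f p = 1 - (\<Sum>i=1..p. fps_const (f i) * fps_X ^ i)"

lemma fps_const_X_power_mult_nth:
  fixes Z :: "real fps"
  shows "fps_nth (fps_const a * fps_X ^ j * Z) i = (if i < j then 0 else a * fps_nth Z (i - j))"
  by (simp add: mult.assoc fps_X_power_mult_nth)

lemma arma_num_fps_mult_nth:
  "fps_nth (arma_num_fps g q * Z) i = fps_nth Z i + (\<Sum>j=1..q. if i < j then 0 else g j * fps_nth Z (i - j))"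
  unfolding arma_num_fps_def distrib_right sum_distrib_right
  by (simp only: fps_add_nth fps_sum_nth fps_const_X_power_mult_nth mult_1_left)

lemma arma_den_fps_mult_nth:
  "fps_nth (arma_den_fps f p * Z) i = fps_nth Z i - (\<Sum>j=1..p. if i < j then 0 else f j * fps_nth Z (i - j))"
  unfolding arma_den_fps_def left_diff_distrib sum_distrib_right
  by (simp only: fps_sub_nth fps_sum_nth fps_const_X_power_mult_nth mult_1_left)

lemma arma_fps_nth_0: "fps_nth (arma_num_fps g q) 0 = 1" "fps_nth (arma_den_fps f p) 0 = 1"
  using arma_num_fps_mult_nth[of g q 1 0] arma_den_fps_mult_nth[of f p 1 0] by simp_all

text \<open>Starting the whitening at time 1 with zero initial state replaces the true innovations by
  \<open>w + r\<close>, where \<open>r\<close> is the response of \<open>1 / N\<close> to finitely many initial terms.\<close>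

lemma arma_whitened_noise:
  fixes M :: "'a measure" and w v :: "int \<Rightarrow> 'a \<Rightarrow> real"
  assumes M: "prob_space M" and \<sigma>: "\<sigma> > 0" and w: "white_gaussian M \<sigma> w"
    and iN: "summable_fps (inverse (arma_num_fps g q))" and iD: "summable_fps (inverse (arma_den_fps f p))"
    and v: "filter_output M (arma_impulse f p g q) w v" and rec: "arma_recursion M f p g q w v"
  shows "\<exists>r K. whitened_noise M (\<lambda>k. v (int k)) (\<lambda>k. w (int k)) r (arma_num_fps g q * inverse (arma_den_fps f p)) \<sigma> K"
proof -
  interpret prob_space M by fact
  let ?N = "arma_num_fps g q" and ?D = "arma_den_fps f p"
  define F where "F = ?N * inverse ?D"
  note wm = white_gaussian_moments[OF w \<sigma>]
  have [measurable]: "w k \<in> borel_measurable M" for k by (rule wm)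
  have [measurable]: "v k \<in> borel_measurable M" for k using v by (simp add: filter_output_def)
  have imp: "arma_impulse f p g q = fps_nth F"
    unfolding arma_impulse_def F_def arma_num_fps_def[symmetric] arma_den_fps_def[symmetric]
    using arma_fps_nth_0(2)[of f p] by (simp add: fps_divide_unit)
  have sN: "summable_fps ?N"
    unfolding summable_fps_def
  proof (rule summable_finite[of "{..q}"])
    show "norm (fps_nth ?N n) = 0" if "n \<notin> {..q}" for n
      using arma_num_fps_mult_nth[of g q 1 n] that by (auto intro!: sum.neutral)
  qed simp
  have sF: "summable (\<lambda>j. \<bar>fps_nth F j\<bar>)"
    using summable_fps_mult[OF sN iD] by (simp add: F_def summable_fps_def)
  have w_sq: "integrable M (\<lambda>\<omega>. (w k \<omega>)\<^sup>2)" "expectation (\<lambda>\<omega>. (w k \<omega>)\<^sup>2) = \<sigma>\<^sup>2" for k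
    using wm(3,4)[of k k] by (simp_all add: power2_eq_square)
  have v_sq: "integrable M (\<lambda>\<omega>. (v k \<omega>)\<^sup>2)" and v_mean: "expectation (v k) = 0" for k
  proof -
    have AE: "AE \<omega> in M. (\<lambda>j. fps_nth F j * w (k - int j) \<omega>) sums v k \<omega>"
      using v by (simp add: filter_output_def imp)
    show "integrable M (\<lambda>\<omega>. (v k \<omega>)\<^sup>2)" "expectation (v k) = 0"
      by (rule summable_filter_moments[OF sF _ w_sq(1) w_sq(2) wm(2) _ AE]; simp)+
  qed
  define Z where "Z \<omega> = Abs_fps (\<lambda>i. if i = 0 then 0 else v (int i) \<omega>)" for \<omega>
  define E where "E \<omega> = Abs_fps (\<lambda>i. if i = 0 then 0 else w (int i) \<omega>)" for \<omega>
  \<comment> \<open>The failure of the recursion \<open>D v = N w\<close> for the signals cut off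
    before time 1. Almost surely it is confined to the times from 1 to \<open>max p q\<close>, whose
    recursion refers to the missing past.\<close>
  define C where "C \<omega> = ?D * Z \<omega> - ?N * E \<omega>" for \<omega>
  define r where "r i \<omega> = fps_nth (inverse ?N * C \<omega>) i" for i \<omega>
  have innov: "innovation F (\<lambda>i. v (int i) \<omega>) = E \<omega> + inverse ?N * C \<omega>" for \<omega>
  proof -
    have "inverse F = inverse ?N * ?D"
      unfolding F_def using arma_fps_nth_0(2)[of f p] by (simp add: fps_inverse_mult)
    then have "innovation F (\<lambda>i. v (int i) \<omega>) = inverse ?N * (?D * Z \<omega>)"
      by (simp add: innovation_def Z_def mult.assoc)
    also have "\<dots> = inverse ?N * (?N * E \<omega>) + inverse ?N * C \<omega>"
      by (simp add: C_def algebra_simps)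
    also have "inverse ?N * (?N * E \<omega>) = E \<omega>"
      using arma_fps_nth_0(1)[of g q] by (simp add: mult.assoc[symmetric] inverse_mult_eq_1)
    finally show ?thesis .
  qed
  have C_nth: "fps_nth (C \<omega>) i = (fps_nth (Z \<omega>) i - (\<Sum>j=1..p. if i < j then 0 else f j * fps_nth (Z \<omega>) (i - j)))
      - (fps_nth (E \<omega>) i + (\<Sum>j=1..q. if i < j then 0 else g j * fps_nth (E \<omega>) (i - j)))" for i \<omega>
    by (simp only: C_def fps_sub_nth arma_num_fps_mult_nth arma_den_fps_mult_nth)
  have Z_meas [measurable]: "(\<lambda>\<omega>. fps_nth (Z \<omega>) i) \<in> borel_measurable M" for i
    by (cases "i = 0") (auto simp: Z_def)
  have E_meas [measurable]: "(\<lambda>\<omega>. fps_nth (E \<omega>) i) \<in> borel_measurable M" for i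
    by (cases "i = 0") (auto simp: E_def)
  have C_meas [measurable]: "(\<lambda>\<omega>. fps_nth (C \<omega>) i) \<in> borel_measurable M" for i
    unfolding C_def by (simp add: fps_mult_nth)
  have Z_sq: "integrable M (\<lambda>\<omega>. (fps_nth (Z \<omega>) i)\<^sup>2)" for i
    using v_sq by (cases "i = 0") (auto simp: Z_def)
  have E_sq: "integrable M (\<lambda>\<omega>. (fps_nth (E \<omega>) i)\<^sup>2)" for i
    using w_sq by (cases "i = 0") (auto simp: E_def)
  have C_sq: "integrable M (\<lambda>\<omega>. (fps_nth (C \<omega>) i)\<^sup>2)" for i
  proof -
    have 1: "integrable M (\<lambda>\<omega>. (\<Sum>j=0..i. fps_nth ?D j * fps_nth (Z \<omega>) (i - j))\<^sup>2)"
      "integrable M (\<lambda>\<omega>. (\<Sum>j=0..i. (- fps_nth ?N j) * fps_nth (E \<omega>) (i - j))\<^sup>2)"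
      by (rule square_integrable_sum; simp add: Z_sq E_sq)+
    have eq: "fps_nth (C \<omega>) i = (\<Sum>j=0..i. fps_nth ?D j * fps_nth (Z \<omega>) (i - j)) + (\<Sum>j=0..i. (- fps_nth ?N j) * fps_nth (E \<omega>) (i - j))" for \<omega>
      by (simp add: C_def fps_mult_nth sum_negf)
    show ?thesis
      unfolding eq by (rule square_integrable_add[OF _ _ 1]) simp_all
  qed
  define d where "d = max p q"
  have C0: "fps_nth (C \<omega>) 0 = 0" for \<omega> by (simp add: C_def Z_def E_def)
  have C_AE: "AE \<omega> in M. fps_nth (C \<omega>) i = 0" if i: "i > d" for i
  proof -
    have "AE \<omega> in M. v (int i) \<omega> = (\<Sum>j=1..p. f j * v (int i - int j) \<omega>) + w (int i) \<omega> + (\<Sum>j=1..q. g j * w (int i - int j) \<omega>)"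
      using rec by (simp add: arma_recursion_def)
    then show ?thesis
    proof eventually_elim
      case (elim \<omega>)
      have "(\<Sum>j=1..p. if i < j then 0 else f j * fps_nth (Z \<omega>) (i - j)) = (\<Sum>j=1..p. f j * v (int i - int j) \<omega>)"
        using i by (intro sum.cong) (auto simp: d_def Z_def of_nat_diff)
      moreover have "(\<Sum>j=1..q. if i < j then 0 else g j * fps_nth (E \<omega>) (i - j)) = (\<Sum>j=1..q. g j * w (int i - int j) \<omega>)"
        using i by (intro sum.cong) (auto simp: d_def E_def of_nat_diff)
      ultimately show ?case unfolding C_nth using elim i by (simp add: Z_def E_def)
    qed
  qed
  let ?\<nu> = "\<lambda>i s. if s \<le> i then fps_nth (inverse ?N) (i - s) else 0"
  define S where "S = (\<Sum>j. \<bar>fps_nth (inverse ?N) j\<bar>)"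
  have sn: "summable (\<lambda>j. \<bar>fps_nth (inverse ?N) j\<bar>)" using iN by (simp add: summable_fps_def)
  have S0: "S \<ge> 0" unfolding S_def using sn by (rule suminf_nonneg) simp
  \<comment> \<open>The row and column sums of \<open>?\<nu>\<close> are both at most
    \<open>S\<close>: the rows enter through Cauchy-Schwarz, the columns when the energies of
    \<open>r\<close> are added over time.\<close>
  have \<nu>_sum1: "(\<Sum>s\<in>{1..d}. \<bar>?\<nu> i s\<bar>) \<le> S" for i
  proof -
    have "(\<Sum>s\<in>{1..d}. \<bar>?\<nu> i s\<bar>) = (\<Sum>s\<in>{s\<in>{1..d}. s \<le> i}. \<bar>fps_nth (inverse ?N) (i - s)\<bar>)"
      by (intro sum.mono_neutral_cong_right) auto
    also have "\<dots> = (\<Sum>j\<in>(\<lambda>s. i - s) ` {s\<in>{1..d}. s \<le> i}. \<bar>fps_nth (inverse ?N) j\<bar>)"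
      by (subst sum.reindex) (auto simp: inj_on_def)
    also have "\<dots> \<le> S" unfolding S_def by (rule sum_le_suminf[OF sn]) auto
    finally show ?thesis .
  qed
  have \<nu>_sum2: "(\<Sum>i=1..k. \<bar>?\<nu> i s\<bar>) \<le> S" for k s
  proof -
    have "(\<Sum>i=1..k. \<bar>?\<nu> i s\<bar>) = (\<Sum>i\<in>{i\<in>{1..k}. s \<le> i}. \<bar>fps_nth (inverse ?N) (i - s)\<bar>)"
      by (intro sum.mono_neutral_cong_right) auto
    also have "\<dots> = (\<Sum>j\<in>(\<lambda>i. i - s) ` {i\<in>{1..k}. s \<le> i}. \<bar>fps_nth (inverse ?N) j\<bar>)"
      by (subst sum.reindex) (auto simp: inj_on_def)
    also have "\<dots> \<le> S" unfolding S_def by (rule sum_le_suminf[OF sn]) auto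
    finally show ?thesis .
  qed
  have r_AE: "AE \<omega> in M. r i \<omega> = (\<Sum>s\<in>{1..d}. ?\<nu> i s * fps_nth (C \<omega>) s)" for i
  proof -
    have "AE \<omega> in M. \<forall>s\<in>{Suc d..i}. fps_nth (C \<omega>) s = 0"
      using C_AE by (subst AE_finite_all) auto
    then show ?thesis
    proof eventually_elim
      case (elim \<omega>)
      have "r i \<omega> = (\<Sum>s=0..i. fps_nth (C \<omega>) s * fps_nth (inverse ?N) (i - s))"
        unfolding r_def mult.commute[of "inverse _"] by (rule fps_mult_nth)
      also have "\<dots> = (\<Sum>s\<in>{1..d} \<inter> {..i}. ?\<nu> i s * fps_nth (C \<omega>) s)"
        using elim C0 by (intro sum.mono_neutral_cong_right) (auto simp: not_less_eq_eq Suc_le_eq)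
      also have "\<dots> = (\<Sum>s\<in>{1..d}. ?\<nu> i s * fps_nth (C \<omega>) s)"
        by (intro sum.mono_neutral_left) auto
      finally show ?case .
    qed
  qed
  have r_meas [measurable]: "r i \<in> borel_measurable M" for i
    unfolding r_def[abs_def] by (simp add: fps_mult_nth)
  have rC_sq: "integrable M (\<lambda>\<omega>. (\<Sum>s\<in>{1..d}. ?\<nu> i s * fps_nth (C \<omega>) s)\<^sup>2)" for i
    by (rule square_integrable_sum) (simp_all add: C_sq)
  have r_sq: "integrable M (\<lambda>\<omega>. (r i \<omega>)\<^sup>2)"
    and r_exp: "expectation (\<lambda>\<omega>. (r i \<omega>)\<^sup>2) = expectation (\<lambda>\<omega>. (\<Sum>s\<in>{1..d}. ?\<nu> i s * fps_nth (C \<omega>) s)\<^sup>2)" for i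
  proof -
    have AE2: "AE \<omega> in M. (r i \<omega>)\<^sup>2 = (\<Sum>s\<in>{1..d}. ?\<nu> i s * fps_nth (C \<omega>) s)\<^sup>2"
      using r_AE[of i] by eventually_elim simp
    have m2: "(\<lambda>\<omega>. (r i \<omega>)\<^sup>2) \<in> borel_measurable M" by measurable
    show "integrable M (\<lambda>\<omega>. (r i \<omega>)\<^sup>2)"
      using integrable_cong_AE[THEN iffD2, OF m2 _ AE2 rC_sq] rC_sq by blast
    show "expectation (\<lambda>\<omega>. (r i \<omega>)\<^sup>2) = expectation (\<lambda>\<omega>. (\<Sum>s\<in>{1..d}. ?\<nu> i s * fps_nth (C \<omega>) s)\<^sup>2)"
      by (rule integral_cong_AE[OF m2 _ AE2]) measurable
  qed
  let ?c2 = "\<lambda>s. expectation (\<lambda>\<omega>. (fps_nth (C \<omega>) s)\<^sup>2)"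
  have r_sum: "(\<Sum>i=1..k. expectation (\<lambda>\<omega>. (r i \<omega>)\<^sup>2)) \<le> S * (\<Sum>s\<in>{1..d}. S * ?c2 s)" for k
  proof -
    have each: "expectation (\<lambda>\<omega>. (r i \<omega>)\<^sup>2) \<le> S * (\<Sum>s\<in>{1..d}. \<bar>?\<nu> i s\<bar> * ?c2 s)" for i
    proof -
      have "expectation (\<lambda>\<omega>. (r i \<omega>)\<^sup>2) \<le> expectation (\<lambda>\<omega>. S * (\<Sum>s\<in>{1..d}. \<bar>?\<nu> i s\<bar> * (fps_nth (C \<omega>) s)\<^sup>2))"
        unfolding r_exp
      proof (rule integral_mono[OF rC_sq])
        show "integrable M (\<lambda>\<omega>. S * (\<Sum>s\<in>{1..d}. \<bar>?\<nu> i s\<bar> * (fps_nth (C \<omega>) s)\<^sup>2))"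
          by (intro integrable_mult_right Bochner_Integration.integrable_sum C_sq)
        fix \<omega>
        show "(\<Sum>s\<in>{1..d}. ?\<nu> i s * fps_nth (C \<omega>) s)\<^sup>2 \<le> S * (\<Sum>s\<in>{1..d}. \<bar>?\<nu> i s\<bar> * (fps_nth (C \<omega>) s)\<^sup>2)"
          by (rule order_trans[OF weighted_Cauchy_Schwarz mult_right_mono[OF \<nu>_sum1]]) (auto intro: sum_nonneg)
      qed
      also have "\<dots> = S * (\<Sum>s\<in>{1..d}. \<bar>?\<nu> i s\<bar> * ?c2 s)"
        using C_sq by (subst Bochner_Integration.integral_mult_right_zero, subst Bochner_Integration.integral_sum) auto
      finally show ?thesis .
    qed
    have "(\<Sum>i=1..k. expectation (\<lambda>\<omega>. (r i \<omega>)\<^sup>2)) \<le> (\<Sum>i=1..k. S * (\<Sum>s\<in>{1..d}. \<bar>?\<nu> i s\<bar> * ?c2 s))"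
      by (rule sum_mono) (rule each)
    also have "\<dots> = S * (\<Sum>s\<in>{1..d}. (\<Sum>i=1..k. \<bar>?\<nu> i s\<bar>) * ?c2 s)"
      unfolding sum_distrib_left[symmetric] by (subst sum.swap) (simp add: sum_distrib_right)
    also have "\<dots> \<le> S * (\<Sum>s\<in>{1..d}. S * ?c2 s)"
      by (intro mult_left_mono sum_mono mult_right_mono \<nu>_sum2 S0) auto
    finally show ?thesis .
  qed
  have "whitened_noise M (\<lambda>k. v (int k)) (\<lambda>k. w (int k)) r F \<sigma> (S * (\<Sum>s\<in>{1..d}. S * ?c2 s))"
  proof unfold_locales
    show "fps_nth F 0 = 1" by (simp add: F_def arma_fps_nth_0)
    show "AE \<omega> in M. fps_nth (innovation F (\<lambda>i. v (int i) \<omega>)) i = w (int i) \<omega> + r i \<omega>" if "i \<ge> 1" for i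
      using that by (simp add: innov E_def r_def)
    show "expectation (\<lambda>\<omega>. w (int i) \<omega> * w (int j) \<omega>) = (if i = j then \<sigma>\<^sup>2 else 0)" for i j
      by (simp add: wm)
    show "(\<Sum>i=1..k. expectation (\<lambda>\<omega>. (r i \<omega>)\<^sup>2)) \<le> S * (\<Sum>s\<in>{1..d}. S * ?c2 s)" for k
      by (rule r_sum)
  qed (simp_all add: v_sq v_mean wm r_sq)
  then show ?thesis unfolding F_def by blast
qed

section \<open>The lower bound\<close>

definition arma_num_poly :: "(nat \<Rightarrow> real) \<Rightarrow> nat \<Rightarrow> complex poly" where
  "arma_num_poly g q = 1 + (\<Sum>j=1..q. monom (of_real (g j)) j)"

definition arma_den_poly :: "(nat \<Rightarrow> real) \<Rightarrow> nat \<Rightarrow> complex poly" where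
  "arma_den_poly f p = 1 - (\<Sum>i=1..p. monom (of_real (f i)) i)"

text \<open>Also true at \<open>w = 0\<close>, where \<open>1 / 0 = 0\<close> gives both sides the
  value 1.\<close>

lemma poly_arma_num: "poly (arma_num_poly g q) w = arma_num g q (1 / w)"
  and poly_arma_den: "poly (arma_den_poly f p) w = arma_den f p (1 / w)"
  by (simp_all add: arma_num_poly_def arma_den_poly_def arma_num_def arma_den_def poly_sum poly_monom)

lemma fps_cpx_monom: "fps_cpx (fps_const a * fps_X ^ j) = fps_of_poly (monom (of_real a) j)"
  by (rule fps_ext) (simp add: fps_X_power_nth)

lemma fps_cpx_sum: "fps_cpx (\<Sum>i\<in>I. A i) = (\<Sum>i\<in>I. fps_cpx (A i))"
  by (rule fps_ext) (simp add: fps_sum_nth)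

lemma fps_cpx_add_diff:
  "fps_cpx (A + B) = fps_cpx A + fps_cpx B" "fps_cpx (A - B) = fps_cpx A - fps_cpx B" "fps_cpx 1 = 1"
  by (rule fps_ext; simp)+

lemma fps_cpx_arma_num: "fps_cpx (arma_num_fps g q) = fps_of_poly (arma_num_poly g q)"
  by (simp only: arma_num_fps_def arma_num_poly_def fps_cpx_add_diff fps_cpx_sum fps_cpx_monom
      fps_of_poly_add fps_of_poly_sum fps_of_poly_1)

lemma fps_cpx_arma_den: "fps_cpx (arma_den_fps f p) = fps_of_poly (arma_den_poly f p)"
  by (simp only: arma_den_fps_def arma_den_poly_def fps_cpx_add_diff fps_cpx_sum fps_cpx_monom
      fps_of_poly_diff fps_of_poly_sum fps_of_poly_1)

lemma poly_arma_0: "poly (arma_num_poly g q) 0 = 1" "poly (arma_den_poly f p) 0 = 1"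
  by (auto simp: poly_arma_num poly_arma_den arma_num_def arma_den_def power_0_left intro!: sum.neutral)

text \<open>Nonzero points of the closed disc are reciprocals of points outside the open disc, where
  the two conditions exclude zeros. The point \<open>w = 0\<close> is separate because
  \<open>1 / 0 = 0\<close> lies inside the disc.\<close>

lemma poly_arma_nonzero:
  shows "arma_minimum_phase g q \<Longrightarrow> cmod w \<le> 1 \<Longrightarrow> poly (arma_num_poly g q) w \<noteq> 0"
    and "arma_stable f p \<Longrightarrow> cmod w \<le> 1 \<Longrightarrow> poly (arma_den_poly f p) w \<noteq> 0"
proof -
  have *: "\<not> cmod (1 / w) < 1" if "cmod w \<le> 1" "w \<noteq> 0"
    using that by (simp add: norm_divide divide_less_eq)
  show "arma_minimum_phase g q \<Longrightarrow> cmod w \<le> 1 \<Longrightarrow> poly (arma_num_poly g q) w \<noteq> 0"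
    using * poly_arma_0(1)[of g q] by (cases "w = 0") (auto simp: arma_minimum_phase_def poly_arma_num)
  show "arma_stable f p \<Longrightarrow> cmod w \<le> 1 \<Longrightarrow> poly (arma_den_poly f p) w \<noteq> 0"
    using * poly_arma_0(2)[of f p] by (cases "w = 0") (auto simp: arma_stable_def poly_arma_den)
qed

lemma poly_arma_cnj:
  "poly (arma_num_poly g q) (cnj w) = cnj (poly (arma_num_poly g q) w)"
  "poly (arma_den_poly f p) (cnj w) = cnj (poly (arma_den_poly f p) w)"
  by (simp_all add: arma_num_poly_def arma_den_poly_def poly_sum poly_monom)

lemma summable_fps_inverse_arma:
  "arma_minimum_phase g q \<Longrightarrow> summable_fps (inverse (arma_num_fps g q))"
  "arma_stable f p \<Longrightarrow> summable_fps (inverse (arma_den_fps f p))"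
proof -
  show "summable_fps (inverse (arma_num_fps g q))" if "arma_minimum_phase g q"
  proof -
    have "fps_cpx (inverse (arma_num_fps g q)) = inverse (fps_of_poly (arma_num_poly g q))"
      by (simp add: fps_cpx_inverse arma_fps_nth_0 fps_cpx_arma_num)
    then show ?thesis
      using summable_fps_inverse_poly[OF poly_arma_nonzero(1)[OF that]] by (metis summable_fps_cpx)
  qed
  show "summable_fps (inverse (arma_den_fps f p))" if "arma_stable f p"
  proof -
    have "fps_cpx (inverse (arma_den_fps f p)) = inverse (fps_of_poly (arma_den_poly f p))"
      by (simp add: fps_cpx_inverse arma_fps_nth_0 fps_cpx_arma_den)
    then show ?thesis
      using summable_fps_inverse_poly[OF poly_arma_nonzero(2)[OF that]] by (metis summable_fps_cpx)
  qed
qed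

theorem theorem3:
  fixes M :: "'a measure" and vhat v :: "int \<Rightarrow> 'a \<Rightarrow> real"
    and f g :: "nat \<Rightarrow> real" and p q n :: nat and \<sigma> P :: real
    and lam :: "nat \<Rightarrow> complex"
  assumes "prob_space M"
    and "\<sigma> > 0" and "white_gaussian M \<sigma> vhat"
    and "arma_stable f p" and "arma_minimum_phase g q"
    and "filter_output M (arma_impulse f p g q) vhat v"
    and "arma_recursion M f p g q vhat v"
    and "P > 0" and "n \<ge> 1"
    and "\<exists>l. arma_solution f p g q \<sigma> P n l"
    and "is_arg_max (\<lambda>l. cmod (\<Prod>k=1..n. l k)) (arma_solution f p g q \<sigma> P n) lam"
  shows "feedback_capacity M (\<lambda>k. v (int k)) P \<ge> ereal (log 2 (cmod (\<Prod>k=1..n. lam k)))"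
proof -
  let ?N = "arma_num_poly g q" and ?D = "arma_den_poly f p"
  let ?\<Lambda> = "cmod (\<Prod>k=1..n. lam k)"
  have sol: "arma_solution f p g q \<sigma> P n lam" using assms(11) by (simp add: is_arg_max_def)
  then obtain \<zeta>0 :: real where \<zeta>0: "\<zeta>0 \<noteq> 0"
    and eqs: "\<And>k. k \<in> {1..n} \<Longrightarrow> arma_den f p (lam k) = of_real \<zeta>0 * arma_num g q (lam k)"
    and pow: "of_real (\<zeta>0\<^sup>2 * (P / \<sigma>\<^sup>2)) = (\<Prod>k=1..n. (lam k)\<^sup>2) - 1"
    and gt1: "\<And>k. k \<in> {1..n} \<Longrightarrow> cmod (lam k) > 1" and inj: "inj_on lam {1..n}"
    unfolding arma_solution_def by blast
  define c where "c = P / \<sigma>\<^sup>2"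
  have c: "c > 0" using assms by (simp add: c_def)
  define S where "S = (\<lambda>k. 1 / lam k) ` {1..n}"
  have lam0: "lam k \<noteq> 0" if "k \<in> {1..n}" for k using gt1[OF that] by auto
  have inj': "inj_on (\<lambda>k. 1 / lam k) {1..n}"
  proof (rule inj_onI)
    fix j k assume "j \<in> {1..n}" "k \<in> {1..n}" "1 / lam j = 1 / lam k"
    then show "j = k" using inj_onD[OF inj] by (simp add: inverse_eq_divide[symmetric] del: atLeastAtMost_iff)
  qed
  have S: "finite S" "S \<noteq> {}" using assms(9) by (auto simp: S_def)
  have S1: "0 < cmod w \<and> cmod w < 1" if "w \<in> S" for w
    using that gt1 lam0 by (auto simp: S_def norm_divide)
  have S2: "poly ?D w = of_real \<zeta>0 * poly ?N w" if "w \<in> S" for w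
    using that eqs by (auto simp: S_def poly_arma_num poly_arma_den)
  have S_prod: "(\<Prod>w\<in>S. 1 / cmod w) = ?\<Lambda>"
    unfolding S_def by (subst prod.reindex[OF inj']) (simp add: norm_divide prod_norm)
  have \<Lambda>2: "?\<Lambda>\<^sup>2 = 1 + \<zeta>0\<^sup>2 * c"
  proof -
    have "(\<Prod>k=1..n. lam k)\<^sup>2 = of_real (1 + \<zeta>0\<^sup>2 * c)"
      using pow by (simp add: prod_power_distrib c_def)
    then have "?\<Lambda>\<^sup>2 = \<bar>1 + \<zeta>0\<^sup>2 * c\<bar>" by (metis norm_of_real norm_power)
    then show ?thesis using c by simp
  qed
  have \<Lambda>1: "?\<Lambda> > 1"
  proof (rule power2_less_imp_less)
    show "1\<^sup>2 < ?\<Lambda>\<^sup>2" unfolding \<Lambda>2 using c \<zeta>0 by simp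
  qed simp
  obtain r K where wn: "whitened_noise M (\<lambda>k. v (int k)) (\<lambda>k. vhat (int k)) r (arma_num_fps g q * inverse (arma_den_fps f p)) \<sigma> K"
    using arma_whitened_noise[OF assms(1-3) summable_fps_inverse_arma(1)[OF assms(5)] summable_fps_inverse_arma(2)[OF assms(4)] assms(6,7)]
    by blast
  interpret whitened_noise M "\<lambda>k. v (int k)" "\<lambda>k. vhat (int k)" r "arma_num_fps g q * inverse (arma_den_fps f p)" \<sigma> K
    by (rule wn)
  \<comment> \<open>For \<open>R < ?\<Lambda>\<close> the root set meets the power constraint
    strictly, which leaves the slack that \<open>feedback_capacity_ge\<close> spends on the message
    and the residual. The bound itself follows as \<open>R\<close> tends to
    \<open>?\<Lambda>\<close> from the left.\<close>
  have step: "ereal (log 2 R) \<le> feedback_capacity M (\<lambda>k. v (int k)) P" if R: "1 \<le> R" "R < ?\<Lambda>" for R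
  proof -
    obtain \<zeta> W where \<zeta>: "\<zeta> \<noteq> 0" and W: "finite W"
      "\<And>w. w \<in> W \<Longrightarrow> cnj w \<in> W" "\<And>w. w \<in> W \<Longrightarrow> 0 < cmod w \<and> cmod w < 1"
      "\<And>w. w \<in> W \<Longrightarrow> poly ?D w = of_real \<zeta> * poly ?N w"
      and W_pow: "(\<Prod>w\<in>W. 1 / cmod w)\<^sup>2 < 1 + \<zeta>\<^sup>2 * c" and W_R: "R < (\<Prod>w\<in>W. 1 / cmod w)"
      using conjugate_closed_roots_exist[OF poly_arma_0 poly_arma_nonzero(1)[OF assms(5)] poly_arma_nonzero(2)[OF assms(4)]
          poly_arma_cnj \<zeta>0 c S(1) S1 S2 S(2), of R] S_prod \<Lambda>2 R by auto
    obtain G where G: "fps_nth G 0 = 0" "summable_fps G" "summable_fps (arma_num_fps g q * inverse (arma_den_fps f p) + G)"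
      "\<And>w. w \<in> W \<Longrightarrow> (\<lambda>m. of_real (fps_nth (arma_num_fps g q * inverse (arma_den_fps f p) + G) m) * w ^ m) sums 0"
      "\<And>i. (\<Sum>j<i. (fps_nth G j)\<^sup>2) \<le> ((\<Prod>w\<in>W. 1 / (cmod w)\<^sup>2) - 1) / \<zeta>\<^sup>2"
      using feedback_filter_exists[OF fps_cpx_arma_num fps_cpx_arma_den arma_fps_nth_0(2) poly_arma_nonzero(2)[OF assms(4)] \<zeta> W]
      by blast
    \<comment> \<open>An upper bound for the power of the feedback filter; by \<open>W_pow\<close>
      and \<open>c = P / \<sigma>\<^sup>2\<close> it is strictly below \<open>P\<close>.\<close>
    define P0 where "P0 = \<sigma>\<^sup>2 * (((\<Prod>w\<in>W. 1 / (cmod w)\<^sup>2) - 1) / \<zeta>\<^sup>2)"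
    have "(\<Prod>w\<in>W. 1 / (cmod w)\<^sup>2) = (\<Prod>w\<in>W. 1 / cmod w)\<^sup>2"
      by (simp add: prod_power_distrib power_divide)
    then have "((\<Prod>w\<in>W. 1 / (cmod w)\<^sup>2) - 1) / \<zeta>\<^sup>2 < c"
      using W_pow \<zeta> by (simp add: pos_divide_less_eq mult.commute)
    then have "P0 < \<sigma>\<^sup>2 * c" unfolding P0_def using assms(2) by (intro mult_strict_left_mono) auto
    then have P0: "P0 < P" using assms(2) by (simp add: c_def)
    have "ereal (\<Sum>w\<in>W. log 2 (1 / cmod w)) \<le> feedback_capacity M (\<lambda>k. v (int k)) P"
    proof (rule feedback_capacity_ge[OF G(1)])
      show "summable (\<lambda>j. \<bar>fps_nth G j\<bar>)" using G(2) by (simp add: summable_fps_def)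
      show "summable (\<lambda>j. \<bar>fps_nth (arma_num_fps g q * inverse (arma_den_fps f p) + G) j\<bar>)"
        using G(3) by (simp add: summable_fps_def)
      show "\<sigma>\<^sup>2 * (\<Sum>j<i. (fps_nth G j)\<^sup>2) \<le> P0" for i
        unfolding P0_def using G(5)[of i] by (intro mult_left_mono) auto
    qed (use P0 W G(4) in auto)
    moreover have "(\<Sum>w\<in>W. log 2 (1 / cmod w)) = log 2 (\<Prod>w\<in>W. 1 / cmod w)"
    proof -
      have "ln (\<Prod>w\<in>W. 1 / cmod w) = (\<Sum>w\<in>W. ln (1 / cmod w))"
        using W(1,3) by (intro ln_prod) auto
      then show ?thesis by (simp add: log_def sum_divide_distrib)
    qed
    moreover have "log 2 R \<le> log 2 (\<Prod>w\<in>W. 1 / cmod w)"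
      using R W_R by (intro log_mono) auto
    ultimately show ?thesis by (metis ereal_less_eq(3) order_trans)
  qed
  have "((\<lambda>R. ereal (log 2 R)) \<longlongrightarrow> ereal (log 2 L)) (at_left L)" if "L > 1" for L :: real
    using that by (intro tendsto_intros) auto
  note lim = this[OF \<Lambda>1]
  have "eventually (\<lambda>R. R \<in> {1<..<?\<Lambda>}) (at_left ?\<Lambda>)"
    using \<Lambda>1 by (intro eventually_at_leftI[of 1]) auto
  then have "eventually (\<lambda>R. ereal (log 2 R) \<le> feedback_capacity M (\<lambda>k. v (int k)) P) (at_left ?\<Lambda>)"
    by (rule eventually_mono) (auto intro: step)
  then show ?thesis
    by (rule tendsto_upperbound[OF lim]) simp
qed

end
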